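(* Let $\mathbb{R}^7$ carry the standard torsion-free $\mathrm{G}_2$-structure $\overline{\varphi}$ inducing the Euclidean metric, and let $r$ be the distance to the origin. For any $c\in\mathbb{R}$ there exists a one-parameter family of global radially symmetric solitons $(\varphi,Y,c)$ for the isometric flow on $\mathbb{R}^7$, where $\varphi=\varphi(f,X)$ with $X=a(r)\frac{\partial}{\partial r}$, $f=f(r)$, $f^2+a^2=1$, and $Y=c\,r\frac{\partial}{\partial r}$. That is, for each $c\in\mathbb{R}$ and each prescribed nonzero value of $a'(0)$ there is a unique global solution (defined for all $r$) of the ODE $$a''+\frac{a}{f^2}(a')^2+(6-cr^2)\frac{a'}{r}=6\,\frac{f^2}{r^2}\,a,\qquad f^2=1-a^2,$$ satisfying $a(0)=0$ and having the prescribed value of $a'(0)$.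
   Context: Conventions. A $\mathrm{G}_2$-structure $\varphi$ on a 7-manifold $M$ induces a Riemannian metric $g$, an orientation, and $\psi=\star\varphi$; the sign convention is $\varphi_{ijk}\varphi_{abk}=\delta_{ia}\delta_{jb}-\delta_{ib}\delta_{ja}-\psi_{ijab}$ in local orthonormal frames (repeated indices summed). With $\nabla$ the Levi-Civita connection, the torsion $T_{pq}$ is defined by $\nabla_p\varphi_{ijk}=T_{pq}\psi_{qijk}$; torsion-free means $T=0$. Set $(\operatorname{div}T)_k=\nabla_iT_{ik}$, $(Y\lrcorner T)_k=Y_pT_{pk}$, $(\operatorname{curl}_\varphi Y)_k=\nabla_iY_j\varphi_{ijk}$. Given a background $\mathrm{G}_2$-structure $\overline{\varphi}$ with $\overline{\psi}=\star\overline{\varphi}$, the $\mathrm{G}_2$-structures inducing the same metric are, for pairs $(f,X)$ (unique up to overall sign) of a function and a vector field with $f^2+|X|^2=1$, $$\varphi(f,X)=(f^2-|X|^2)\overline{\varphi}-2f\,X\lrcorner\overline{\psi}+2X^\flat\wedge(X\lrcorner\overline{\varphi}).$$ A soliton for the isometric flow $\partial_t\varphi=(\operatorname{div}T)\lrcorner\psi$ is a triple $(\varphi,Y,c)$ with $Y$ a vector field and $c\in\mathbb{R}$ such that $\mathcal{L}_Yg=2c\,g$ and $\operatorname{div}T=-\frac12\operatorname{curl}_\varphi Y+Y\lrcorner T$, where $T$ is the torsion of $\varphi$. Solutions of the ODE are understood as follows: $a$ is a smooth odd function of $r$ (so that $X$ is smooth at the origin), and $a=\sin(\frac12u)$, $f=\cos(\frac12u)$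 for a smooth odd function $u$ of $r\in\mathbb{R}$ satisfying $r^2u''+(6-cr^2)ru'-6\sin u=0$, which is equivalent to the stated ODE where $f\neq0$ (this gives meaning to the ODE where $f$ vanishes). *)

theory Defs
  imports "HOL-Analysis.Analysis"
begin

text \<open>
  Tensor fields on \<open>\<real>\<^sup>7\<close> are given by their components in the standard frame. The indices
  \<open>1, \<dots>, 7\<close> are the elements of the type \<open>7\<close>, in which the numeral \<open>7\<close> is \<open>0\<close>.
  For the Euclidean metric this frame is orthonormal and parallel, so the Levi-Civita derivative
  acts on components by partial derivatives, and upper and lower indices agree.
\<close>

type_synonym vec7 = "real^7"
type_synonym form3 = "7 \<Rightarrow> 7 \<Rightarrow> 7 \<Rightarrow> real"
type_synonym form4 = "7 \<Rightarrow> 7 \<Rightarrow> 7 \<Rightarrow> 7 \<Rightarrow> real"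
type_synonym tensor2 = "7 \<Rightarrow> 7 \<Rightarrow> real"

subsection \<open>Smooth functions\<close>

primrec Ck :: "nat \<Rightarrow> ('a::real_normed_vector \<Rightarrow> real) \<Rightarrow> bool" where
  "Ck 0 h \<longleftrightarrow> continuous_on UNIV h"
| "Ck (Suc n) h \<longleftrightarrow>
     (\<forall>x. h differentiable (at x)) \<and> (\<forall>v. Ck n (\<lambda>x. frechet_derivative h (at x) v))"

definition smooth :: "('a::real_normed_vector \<Rightarrow> real) \<Rightarrow> bool" where
  "smooth h \<longleftrightarrow> (\<forall>n. Ck n h)"

definition partial :: "7 \<Rightarrow> (vec7 \<Rightarrow> real) \<Rightarrow> vec7 \<Rightarrow> real" where
  "partial i h x = frechet_derivative h (at x) (axis i 1)"

subsection \<open>The standard \<open>G\<^sub>2\<close>-structure and the Hodge star\<close>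

text \<open>\<open>e3 p q r\<close> is the form \<open>dx\<^sup>p \<and> dx\<^sup>q \<and> dx\<^sup>r\<close>.\<close>

definition e3 :: "7 \<Rightarrow> 7 \<Rightarrow> 7 \<Rightarrow> form3" where
  "e3 p q r i j k = det (vector
     [vector [of_bool (p = i), of_bool (p = j), of_bool (p = k)],
      vector [of_bool (q = i), of_bool (q = j), of_bool (q = k)],
      vector [of_bool (r = i), of_bool (r = j), of_bool (r = k)]] :: real^3^3)"

text \<open>
  Together with the standard orientation, this choice of signs gives
  \<open>\<phi>\<^sub>i\<^sub>j\<^sub>k \<phi>\<^sub>a\<^sub>b\<^sub>k = \<delta>\<^sub>i\<^sub>a \<delta>\<^sub>j\<^sub>b - \<delta>\<^sub>i\<^sub>b \<delta>\<^sub>j\<^sub>a - \<psi>\<^sub>i\<^sub>j\<^sub>a\<^sub>b\<close> for \<open>\<psi> = \<star>\<phi>\<close>; the other common model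
  \<open>e\<^sup>1\<^sup>2\<^sup>3 + e\<^sup>1\<^sup>4\<^sup>5 + e\<^sup>1\<^sup>6\<^sup>7 + e\<^sup>2\<^sup>4\<^sup>6 - \<dots>\<close> has \<open>+\<psi>\<^sub>i\<^sub>j\<^sub>a\<^sub>b\<close> instead.
\<close>

definition phi0 :: form3 where
  "phi0 i j k = e3 1 2 3 i j k - e3 1 6 7 i j k - e3 5 2 7 i j k - e3 5 6 3 i j k
     - e3 4 1 5 i j k - e3 4 2 6 i j k - e3 4 3 7 i j k"

text \<open>The Levi-Civita symbol, as the Euclidean volume of the basis vectors.\<close>

definition eps7 :: "7 \<Rightarrow> 7 \<Rightarrow> 7 \<Rightarrow> 7 \<Rightarrow> 7 \<Rightarrow> 7 \<Rightarrow> 7 \<Rightarrow> real" where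
  "eps7 a b c i j k l = det (vector
     [axis a 1, axis b 1, axis c 1, axis i 1, axis j 1, axis k 1, axis l 1] :: real^7^7)"

definition hodge3 :: "form3 \<Rightarrow> form4" where
  "hodge3 \<omega> i j k l = (1/6) * (\<Sum>a\<in>UNIV. \<Sum>b\<in>UNIV. \<Sum>c\<in>UNIV. \<omega> a b c * eps7 a b c i j k l)"

definition interior3 :: "vec7 \<Rightarrow> form3 \<Rightarrow> tensor2" where
  "interior3 v \<omega> j k = (\<Sum>i\<in>UNIV. v $ i * \<omega> i j k)"

definition interior4 :: "vec7 \<Rightarrow> form4 \<Rightarrow> form3" where
  "interior4 v \<omega> j k l = (\<Sum>i\<in>UNIV. v $ i * \<omega> i j k l)"

definition wedge12 :: "vec7 \<Rightarrow> tensor2 \<Rightarrow> form3" where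
  "wedge12 v \<beta> i j k = v $ i * \<beta> j k + v $ j * \<beta> k i + v $ k * \<beta> i j"

subsection \<open>\<open>G\<^sub>2\<close>-structures on \<open>\<real>\<^sup>7\<close>\<close>

text \<open>
  The rows of \<open>A\<close> are an adapted coframe: in it \<open>\<omega>\<close> takes the standard form \<^const>\<open>phi0\<close>.
  The metric and orientation induced by \<open>\<omega>\<close> are those for which the coframe is orthonormal and
  positive; since the stabiliser \<open>G\<^sub>2\<close> of \<^const>\<open>phi0\<close> lies in \<open>SO(7)\<close>, they do not depend on \<open>A\<close>.
\<close>

definition adapted_coframe :: "form3 \<Rightarrow> real^7^7 \<Rightarrow> bool" where
  "adapted_coframe \<omega> A \<longleftrightarrow> invertible A \<and>
     (\<forall>i j k. \<omega> i j k =
        (\<Sum>a\<in>UNIV. \<Sum>b\<in>UNIV. \<Sum>c\<in>UNIV. phi0 a b c * (A $ a $ i) * (A $ b $ j) * (A $ c $ k)))"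

definition G2_structure :: "(vec7 \<Rightarrow> form3) \<Rightarrow> bool" where
  "G2_structure \<phi> \<longleftrightarrow>
     (\<forall>i j k. smooth (\<lambda>x. \<phi> x i j k)) \<and> (\<forall>x. \<exists>A. adapted_coframe (\<phi> x) A)"

definition induces_metric :: "(vec7 \<Rightarrow> form3) \<Rightarrow> (vec7 \<Rightarrow> tensor2) \<Rightarrow> bool" where
  "induces_metric \<phi> g \<longleftrightarrow>
     (\<forall>x. \<exists>A. adapted_coframe (\<phi> x) A \<and> (\<forall>i j. g x i j = (\<Sum>m\<in>UNIV. A $ m $ i * A $ m $ j)))"

definition induces_standard_orientation :: "(vec7 \<Rightarrow> form3) \<Rightarrow> bool" where
  "induces_standard_orientation \<phi> \<longleftrightarrow> (\<forall>x. \<exists>A. adapted_coframe (\<phi> x) A \<and> det A > 0)"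

definition euclidean_metric :: "vec7 \<Rightarrow> tensor2" where
  "euclidean_metric x i j = of_bool (i = j)"

definition isometric_form :: "(vec7 \<Rightarrow> real) \<Rightarrow> (vec7 \<Rightarrow> vec7) \<Rightarrow> vec7 \<Rightarrow> form3" where
  "isometric_form f X x i j k =
     ((f x)\<^sup>2 - (norm (X x))\<^sup>2) * phi0 i j k
     - 2 * f x * interior4 (X x) (hodge3 phi0) i j k
     + 2 * wedge12 (X x) (interior3 (X x) phi0) i j k"

subsection \<open>Torsion and solitons of the isometric flow\<close>

text \<open>
  Torsion, divergence and curl are written for the Euclidean metric and the standard orientation, so
  they are the intrinsic notions for \<open>G\<^sub>2\<close>-structures inducing these.
\<close>

definition has_torsion :: "(vec7 \<Rightarrow> form3) \<Rightarrow> (vec7 \<Rightarrow> tensor2) \<Rightarrow> bool" where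
  "has_torsion \<phi> T \<longleftrightarrow>
     (\<forall>x p i j k. partial p (\<lambda>y. \<phi> y i j k) x = (\<Sum>q\<in>UNIV. T x p q * hodge3 (\<phi> x) q i j k))"

definition divergence :: "(vec7 \<Rightarrow> tensor2) \<Rightarrow> vec7 \<Rightarrow> 7 \<Rightarrow> real" where
  "divergence T x k = (\<Sum>i\<in>UNIV. partial i (\<lambda>y. T y i k) x)"

definition curl :: "(vec7 \<Rightarrow> form3) \<Rightarrow> (vec7 \<Rightarrow> vec7) \<Rightarrow> vec7 \<Rightarrow> 7 \<Rightarrow> real" where
  "curl \<phi> Y x k = (\<Sum>i\<in>UNIV. \<Sum>j\<in>UNIV. partial i (\<lambda>y. Y y $ j) x * \<phi> x i j k)"

definition interior_T :: "(vec7 \<Rightarrow> vec7) \<Rightarrow> (vec7 \<Rightarrow> tensor2) \<Rightarrow> vec7 \<Rightarrow> 7 \<Rightarrow> real" where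
  "interior_T Y T x k = (\<Sum>p\<in>UNIV. Y x $ p * T x p k)"

definition lie_derivative :: "(vec7 \<Rightarrow> vec7) \<Rightarrow> (vec7 \<Rightarrow> tensor2) \<Rightarrow> vec7 \<Rightarrow> tensor2" where
  "lie_derivative Y g x i j =
     (\<Sum>k\<in>UNIV. Y x $ k * partial k (\<lambda>y. g y i j) x
        + g x k j * partial i (\<lambda>y. Y y $ k) x + g x i k * partial j (\<lambda>y. Y y $ k) x)"

text \<open>
  Solitons \<open>(\<phi>, Y, c)\<close> whose induced metric and orientation are those of Euclidean \<open>\<real>\<^sup>7\<close>.
  The tensor \<open>T\<close> is determined by \<open>\<phi>\<close>.
\<close>

definition euclidean_soliton :: "(vec7 \<Rightarrow> form3) \<Rightarrow> (vec7 \<Rightarrow> vec7) \<Rightarrow> real \<Rightarrow> bool" where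
  "euclidean_soliton \<phi> Y c \<longleftrightarrow>
     G2_structure \<phi> \<and> induces_metric \<phi> euclidean_metric \<and> induces_standard_orientation \<phi> \<and>
     (\<forall>k. smooth (\<lambda>x. Y x $ k)) \<and>
     (\<forall>x i j. lie_derivative Y euclidean_metric x i j = 2 * c * euclidean_metric x i j) \<and>
     (\<exists>T. has_torsion \<phi> T \<and>
        (\<forall>x k. divergence T x k = - (1/2) * curl \<phi> Y x k + interior_T Y T x k))"

subsection \<open>Radial data\<close>

text \<open>
  The field \<open>h(r) \<partial>/\<partial>r\<close>; here \<^term>\<open>sgn x\<close> is \<open>x / |x|\<close>, and the value at the origin
  is \<open>0\<close>, which is the continuous extension when \<open>h\<close> is continuous with \<open>h(0) = 0\<close>.
\<close>

definition radial_field :: "(real \<Rightarrow> real) \<Rightarrow> vec7 \<Rightarrow> vec7" where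
  "radial_field h x = h (norm x) *\<^sub>R sgn x"

definition odd_fun :: "(real \<Rightarrow> real) \<Rightarrow> bool" where
  "odd_fun h \<longleftrightarrow> (\<forall>r. h (- r) = - h r)"

text \<open>
  The equation for \<open>a\<close> is singular where \<open>f\<close> vanishes; its meaning there is given by the angle \<open>u\<close>.
\<close>

definition global_solution :: "real \<Rightarrow> (real \<Rightarrow> real) \<Rightarrow> (real \<Rightarrow> real) \<Rightarrow> bool" where
  "global_solution c f a \<longleftrightarrow>
     smooth a \<and> odd_fun a \<and> (\<forall>r. (f r)\<^sup>2 = 1 - (a r)\<^sup>2) \<and>
     (\<forall>r. r \<noteq> 0 \<longrightarrow> f r \<noteq> 0 \<longrightarrow>
        deriv (deriv a) r + a r / (f r)\<^sup>2 * (deriv a r)\<^sup>2 + (6 - c * r\<^sup>2) * (deriv a r / r)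
          = 6 * ((f r)\<^sup>2 / r\<^sup>2) * a r) \<and>
     (\<exists>u. smooth u \<and> odd_fun u \<and> (\<forall>r. a r = sin (u r / 2) \<and> f r = cos (u r / 2)) \<and>
        (\<forall>r. r\<^sup>2 * deriv (deriv u) r + (6 - c * r\<^sup>2) * r * deriv u r - 6 * sin (u r) = 0))"

end

theory Submission
  imports Defs
begin

text \<open>
Put \<open>a = sin (u/2)\<close> and \<open>f = cos (u/2)\<close>. Everything is read off from the angle \<open>u\<close>.

\<^emph>\<open>The angle equation.\<close> In the form
\<open>(r\<^sup>6 exp (-c r\<^sup>2/2) u')' = 6 r\<^sup>4 exp (-c r\<^sup>2/2) sin u\<close> the equation makes the difference of two
solutions with equal initial data small: a bound \<open>K r\<^sup>2 exp (L r\<^sup>2)\<close> on it improves to the same bound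
with \<open>3K/7\<close>, since sine is 1-Lipschitz (\<open>angle_equation_contraction\<close>). So solutions are unique, and
therefore odd, because \<open>- u(- r)\<close> solves the same problem. For existence write \<open>u = r v\<close>. The function
\<open>v\<close> solves \<open>v'' + (8/r - c r) v' = h\<close> with \<open>h = c v - 6 (r v - sin (r v))/r\<^sup>3\<close>, which is a radial equation
without singular nonlinearity. Inverting its linear part by two averages along rays and writing
\<open>v = \<beta> + r\<^sup>2 w\<close> turns it into a fixed point problem for \<open>w\<close>, and the fixed point map is a contraction with
constant \<open>13/18\<close> in the sup norm weighted by \<open>exp (- |c| r\<^sup>2)\<close> on the whole line
(\<open>radial_inverse_bound\<close>, \<open>fixed_point_exists\<close>). The weight makes the solution global at once. Averages
preserve differentiability of every order and \<open>v' = r Q\<close> with a weighted average \<open>Q\<close> of \<open>h\<close>, so \<open>v\<close> gains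
derivatives inductively, also at the origin (\<open>angle_equation_exists\<close>).

\<^emph>\<open>The soliton.\<close> The functions \<open>\<sigma> = sin u / r\<close>, \<open>\<kappa> = (1 - cos u)/r\<^sup>2\<close> and \<open>\<tau> = (u' - \<sigma>)/r\<^sup>2\<close> are smooth and
even, so that they define smooth functions of \<open>|x|\<close>, and,
with \<open>\<iota>(x)\<close> for the interior product,
\<open>\<phi> = cos u \<phi>\<^sub>0 - \<sigma> \<iota>(x)\<psi>\<^sub>0 + \<kappa> x\<and>(\<iota>(x)\<phi>\<^sub>0)\<close>. With the unit vector \<open>n = x/|x|\<close>, the complement of \<open>n\<close> is a
complex 3-space with complex structure \<open>n \<times> \<cdot>\<close> on which \<open>\<phi>\<^sub>0\<close> is the real part of a complex volume
form; multiplication by \<open>exp (i u/3)\<close> there, with \<open>n\<close> fixed, is an orthogonal map that carries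
\<open>\<phi>\<^sub>0\<close> to \<open>\<phi>\<close> (\<open>rot_triple\<close>). This provides adapted coframes. The torsion is
\<open>T\<^sub>p\<^sub>q = - (\<sigma> \<delta>\<^sub>p\<^sub>q + \<tau> x\<^sub>p x\<^sub>q + \<kappa> (e\<^sub>p \<times> x)\<^sub>q)\<close>: this is the tensor identity \<open>torsion_identity\<close>, which rests on
the contractions of \<open>\<phi>\<^sub>0\<close> with \<open>\<phi>\<^sub>0\<close> and \<open>\<psi>\<^sub>0\<close> (\<open>hodge3_phi0\<close>, \<open>Psi_cross7\<close>) and on the Hodge star of the three
pieces of \<open>\<phi>\<close> (\<open>hodge3_interior4\<close>, \<open>hodge3_wedge12\<close>). The last term of \<open>T\<close> contributes nothing to
\<open>div T\<close> or to \<open>\<iota>(x)T\<close>, the field \<open>Y = c x\<close> has no curl, and the soliton equation becomes the angle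
equation (\<open>divergence_torsion\<close>, \<open>interior_torsion\<close>).
\<close>

section \<open>Calculus of smooth functions\<close>

lemma Ck_Suc_imp: "Ck (Suc n) h \<Longrightarrow> Ck n h"
proof (induction n arbitrary: h)
  case 0
  then show ?case
    by (auto simp: continuous_on_eq_continuous_at differentiable_imp_continuous_within)
next
  case (Suc n)
  then show ?case by (auto simp del: Ck.simps(1) intro: Suc.IH)
qed

lemma Ck_imp_continuous: "Ck n h \<Longrightarrow> continuous_on UNIV h"
  by (induction n) (use Ck_Suc_imp in \<open>auto simp del: Ck.simps(2)\<close>)

lemma Ck_SucI:
  assumes "\<And>x. (h has_derivative D x) (at x)" "\<And>v. Ck n (\<lambda>x. D x v)"
  shows "Ck (Suc n) h"
proof -
  have "frechet_derivative h (at x) = D x" for x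
    using frechet_derivative_at[OF assms(1)] by metis
  with assms show ?thesis by (auto simp: differentiable_def)
qed

lemma Ck_SucD:
  assumes "Ck (Suc n) h"
  shows "(h has_derivative frechet_derivative h (at x)) (at x)"
    and "Ck n (\<lambda>x. frechet_derivative h (at x) v)"
  using assms by (auto simp: frechet_derivative_works)

lemma Ck_const [intro, simp]: "Ck n (\<lambda>x. k)"
proof (induction n arbitrary: k)
  case (Suc n)
  show ?case by (rule Ck_SucI[where D="\<lambda>_ _. 0"]) (use Suc in auto)
qed simp

lemma Ck_bounded_linear: "bounded_linear h \<Longrightarrow> Ck n h"
proof (cases n)
  case 0
  assume "bounded_linear h" then show ?thesis using 0 by (simp add: linear_continuous_on)
next
  case (Suc m)
  assume h: "bounded_linear h"
  show ?thesis unfolding Suc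
    by (rule Ck_SucI[where D="\<lambda>_. h"]) (use h in \<open>auto intro: bounded_linear_imp_has_derivative\<close>)
qed

lemma Ck_add [intro]: "Ck n g \<Longrightarrow> Ck n h \<Longrightarrow> Ck n (\<lambda>x. g x + h x)"
proof (induction n arbitrary: g h)
  case 0 then show ?case by (auto intro: continuous_intros)
next
  case (Suc n)
  show ?case
    by (rule Ck_SucI[OF has_derivative_add[OF Ck_SucD(1)[OF Suc.prems(1)] Ck_SucD(1)[OF Suc.prems(2)]]])
      (intro Suc.IH Ck_SucD(2) Suc.prems)
qed

lemma Ck_mult [intro]: "Ck n g \<Longrightarrow> Ck n h \<Longrightarrow> Ck n (\<lambda>x. g x * h x)"
proof (induction n arbitrary: g h)
  case 0 then show ?case by (auto intro: continuous_intros)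
next
  case (Suc n)
  show ?case
    by (rule Ck_SucI[OF has_derivative_mult[OF Ck_SucD(1)[OF Suc.prems(1)] Ck_SucD(1)[OF Suc.prems(2)]]])
      (intro Ck_add Suc.IH Ck_SucD(2) Suc.prems Ck_Suc_imp)
qed

lemma Ck_minus [intro]: "Ck n g \<Longrightarrow> Ck n (\<lambda>x. - g x)"
  using Ck_mult[of n "\<lambda>_. -1" g] by simp

lemma Ck_diff [intro]: "Ck n g \<Longrightarrow> Ck n h \<Longrightarrow> Ck n (\<lambda>x. g x - h x)"
  using Ck_add[of n g "\<lambda>x. - h x"] by auto

lemma Ck_power [intro]: "Ck n g \<Longrightarrow> Ck n (\<lambda>x. g x ^ m)"
  by (induction m) auto

lemma Ck_ident [intro, simp]: "Ck n (\<lambda>x::real. x)"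
  by (rule Ck_bounded_linear) simp

text \<open>
On the line, \<^const>\<open>Ck\<close> can be tested on the ordinary derivative, because the directional derivatives
are its constant multiples.
\<close>

lemma Ck_realI:
  fixes h :: "real \<Rightarrow> real"
  assumes "\<And>x. (h has_field_derivative h' x) (at x)" "Ck n h'"
  shows "Ck (Suc n) h"
  by (rule Ck_SucI[OF assms(1)[unfolded has_field_derivative_def]]) (use assms(2) in auto)

lemma Ck_realD:
  fixes h :: "real \<Rightarrow> real"
  assumes "Ck (Suc n) h"
  shows "(h has_field_derivative deriv h x) (at x)" "Ck n (deriv h)"
proof -
  have d: "(h has_field_derivative frechet_derivative h (at x) 1) (at x)" for x
  proof -
    have "frechet_derivative h (at x) y = frechet_derivative h (at x) 1 * y" for y
      using linear_cmul[OF has_derivative_linear[OF Ck_SucD(1)[OF assms]], of x y 1] by simp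
    then show ?thesis
      using Ck_SucD(1)[OF assms, of x] unfolding has_field_derivative_def by (metis ext)
  qed
  then have e: "deriv h x = frechet_derivative h (at x) 1" for x
    using DERIV_imp_deriv by blast
  show "(h has_field_derivative deriv h x) (at x)" using d e by simp
  show "Ck n (deriv h)" using Ck_SucD(2)[OF assms, of 1] unfolding e[symmetric] .
qed

lemma Ck_compose:
  fixes g :: "real \<Rightarrow> real"
  shows "Ck n g \<Longrightarrow> Ck n h \<Longrightarrow> Ck n (\<lambda>x. g (h x))"
proof (induction n arbitrary: g h)
  case 0 then show ?case by (auto intro: continuous_on_compose2)
next
  case (Suc n)
  show ?case
  proof (rule Ck_SucI)
    show "((\<lambda>x. g (h x)) has_derivative (\<lambda>v. frechet_derivative h (at x) v * deriv g (h x))) (at x)" for x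
      using has_derivative_compose[OF Ck_SucD(1)[OF Suc.prems(2)]
          Ck_realD(1)[OF Suc.prems(1), unfolded has_field_derivative_def]]
      by (simp add: mult.commute)
    show "Ck n (\<lambda>x. frechet_derivative h (at x) v * deriv g (h x))" for v
      by (rule Ck_mult[OF Ck_SucD(2)[OF Suc.prems(2)]
            Suc.IH[OF Ck_realD(2)[OF Suc.prems(1)] Ck_Suc_imp[OF Suc.prems(2)]]])
  qed
qed

lemma Ck_exp: "Ck n (exp :: real \<Rightarrow> real)"
proof (induction n)
  case 0
  show ?case unfolding Ck.simps(1) by (rule continuous_on_exp[OF continuous_on_id])
next
  case (Suc n)
  show ?case by (rule Ck_realI[OF DERIV_exp Suc])
qed

lemma Ck_sin_cos: "Ck n (sin :: real \<Rightarrow> real) \<and> Ck n (cos :: real \<Rightarrow> real)"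
proof (induction n)
  case 0
  show ?case unfolding Ck.simps(1)
    by (rule conjI continuous_on_sin[OF continuous_on_id] continuous_on_cos[OF continuous_on_id])+
next
  case (Suc n)
  have "Ck (Suc n) (sin :: real \<Rightarrow> real)"
    by (rule Ck_realI[OF DERIV_sin]) (use Suc in blast)
  moreover have "Ck (Suc n) (cos :: real \<Rightarrow> real)"
    by (rule Ck_realI[OF DERIV_cos]) (use Suc Ck_minus in blast)
  ultimately show ?case ..
qed

lemma smoothD: "smooth h \<Longrightarrow> Ck n h" by (simp add: smooth_def)

lemma smooth_deriv:
  fixes h :: "real \<Rightarrow> real"
  assumes "smooth h"
  shows "smooth (deriv h)" "(h has_field_derivative deriv h x) (at x)"
proof -
  show "smooth (deriv h)"
    unfolding smooth_def using Ck_realD(2)[OF smoothD[OF assms]] by (rule allI)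
  show "(h has_field_derivative deriv h x) (at x)"
    by (rule Ck_realD(1)[OF smoothD[OF assms]])
qed

lemma smooth_const [intro, simp]: "smooth (\<lambda>x. k)"
  by (simp add: smooth_def)

lemma smooth_ident [intro, simp]: "smooth (\<lambda>x::real. x)"
  by (simp add: smooth_def)

lemma smooth_bounded_linear: "bounded_linear h \<Longrightarrow> smooth h"
  by (simp add: smooth_def Ck_bounded_linear)

lemma smooth_sin [intro]: "smooth h \<Longrightarrow> smooth (\<lambda>x. sin (h x))"
  by (simp add: smooth_def Ck_compose[OF conjunct1[OF Ck_sin_cos]])

lemma smooth_cos [intro]: "smooth h \<Longrightarrow> smooth (\<lambda>x. cos (h x))"
  by (simp add: smooth_def Ck_compose[OF conjunct2[OF Ck_sin_cos]])

lemma smooth_exp [intro]: "smooth h \<Longrightarrow> smooth (\<lambda>x. exp (h x))"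
  by (simp add: smooth_def Ck_compose[OF Ck_exp])

lemma smooth_minus [intro]: "smooth h \<Longrightarrow> smooth (\<lambda>x. - h x)"
  by (simp add: smooth_def Ck_minus)

lemma smooth_power [intro]: "smooth h \<Longrightarrow> smooth (\<lambda>x. h x ^ m)"
  by (simp add: smooth_def Ck_power)

lemma smooth_add [intro]: "smooth g \<Longrightarrow> smooth h \<Longrightarrow> smooth (\<lambda>x. g x + h x)"
  by (simp add: smooth_def Ck_add)

lemma smooth_diff [intro]: "smooth g \<Longrightarrow> smooth h \<Longrightarrow> smooth (\<lambda>x. g x - h x)"
  by (simp add: smooth_def Ck_diff)

lemma smooth_mult [intro]: "smooth g \<Longrightarrow> smooth h \<Longrightarrow> smooth (\<lambda>x. g x * h x)"
  by (simp add: smooth_def Ck_mult)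

section \<open>Weighted averages along rays\<close>

text \<open>
The average of \<open>f\<close> over the segment from \<open>0\<close> to \<open>x\<close> with weight \<open>t\<^sup>n\<close>. For \<open>x \<noteq> 0\<close> this is
\<open>x\<^sup>-\<^sup>n\<^sup>-\<^sup>1 \<integral>\<^sub>0\<^sup>x s\<^sup>n f(s) ds\<close>, but the integral over \<open>{0..1}\<close> extends that smoothly across \<open>x = 0\<close>.
\<close>

definition avg :: "nat \<Rightarrow> (real \<Rightarrow> real) \<Rightarrow> real \<Rightarrow> real" where
  "avg n f x = integral {0..1} (\<lambda>t. t ^ n * f (t * x))"

lemma avg_integrand_continuous:
  fixes f :: "real \<Rightarrow> real"
  assumes "continuous_on UNIV f"
  shows "continuous_on S (\<lambda>(x, t). t ^ n * f (t * x))"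
  unfolding case_prod_beta by (intro continuous_intros continuous_on_compose2[OF assms]) auto

lemma avg_integrand_continuous1:
  fixes f :: "real \<Rightarrow> real"
  assumes "continuous_on UNIV f"
  shows "continuous_on S (\<lambda>t. t ^ n * f (t * x))"
  by (intro continuous_intros continuous_on_compose2[OF assms]) auto

lemma avg_integrable:
  fixes f :: "real \<Rightarrow> real"
  assumes "continuous_on UNIV f"
  shows "(\<lambda>t. t ^ n * f (t * x)) integrable_on {0..1}"
  by (intro integrable_continuous_real avg_integrand_continuous1 assms)

lemma avg_continuous:
  assumes "continuous_on UNIV f"
  shows "continuous_on UNIV (avg n f)"
  unfolding avg_def
  using integral_continuous_on_param[OF avg_integrand_continuous[OF assms], of UNIV 0 1 n]
  by (simp add: cbox_interval)

text \<open>
Differentiation under the integral sign produces one more factor \<open>t\<close>, hence the shift of the weight.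
\<close>

lemma avg_has_derivative:
  assumes "\<And>x. (f has_field_derivative f' x) (at x)" and c: "continuous_on UNIV f'"
  shows "(avg n f has_field_derivative avg (Suc n) f' x) (at x)"
proof -
  have cf: "continuous_on UNIV f"
    using assms(1) DERIV_isCont by (auto simp: continuous_on_eq_continuous_at)
  have "((\<lambda>x. integral (cbox 0 1) (\<lambda>t. t ^ n * f (t * x))) has_field_derivative
      integral (cbox 0 1) (\<lambda>t. t ^ Suc n * f' (t * x))) (at x within UNIV)"
  proof (rule leibniz_rule_field_derivative[where f="\<lambda>x t. t ^ n * f (t * x)" and fx="\<lambda>x t. t ^ Suc n * f' (t * x)"])
    show "((\<lambda>x. t ^ n * f (t * x)) has_field_derivative t ^ Suc n * f' (t * x)) (at x)" for x t
      by (auto intro!: derivative_eq_intros DERIV_chain2[OF assms(1)] simp: field_simps)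
  qed (use avg_integrable[OF cf] avg_integrand_continuous[OF c, of _ "Suc n"] in
      \<open>auto simp: cbox_interval simp del: power_Suc\<close>)
  then show ?thesis by (simp add: avg_def[abs_def] cbox_interval)
qed

lemma Ck_avg: "Ck k f \<Longrightarrow> Ck k (avg n f)"
proof (induction k arbitrary: f n)
  case 0 then show ?case by (simp add: avg_continuous)
next
  case (Suc k)
  show ?case
    by (rule Ck_realI[OF avg_has_derivative[OF Ck_realD(1)[OF Suc.prems]]])
      (auto intro!: Suc.IH Ck_realD(2)[OF Suc.prems] Ck_imp_continuous)
qed

lemma smooth_avg: "smooth f \<Longrightarrow> smooth (avg n f)"
  by (simp add: smooth_def Ck_avg)

text \<open>
This is how averages solve differential equations: \<open>x\<^sup>n\<^sup>+\<^sup>1\<close> times the average is the antiderivative of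
\<open>x\<^sup>n f(x)\<close> that vanishes at the origin, on both sides of it.
\<close>

lemma avg_antiderivative:
  assumes f: "continuous_on UNIV f"
  shows "((\<lambda>x. x ^ Suc n * avg n f x) has_field_derivative x ^ n * f x) (at x)"
proof -
  have "\<exists>F. \<forall>x. (F has_vector_derivative x ^ n * f x) (at x)"
    using einterval_antiderivative[of "-\<infinity>" \<infinity> "\<lambda>x. x ^ n * f x"] f
    by (auto simp: continuous_on_eq_continuous_at intro!: continuous_intros)
  then obtain F where F: "\<And>x. (F has_field_derivative x ^ n * f x) (at x)"
    by (auto simp: has_real_derivative_iff_has_vector_derivative)
  have "x ^ Suc n * avg n f x = F x - F 0" for x
  proof -
    have "((\<lambda>t. (t * x) ^ n * f (t * x) * x) has_integral F (1 * x) - F (0 * x)) {0..1}"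
      by (rule fundamental_theorem_of_calculus)
        (auto intro!: derivative_eq_intros DERIV_chain2[OF F]
          simp: has_real_derivative_iff_has_vector_derivative[symmetric])
    moreover have "(\<lambda>t. (t * x) ^ n * f (t * x) * x) = (\<lambda>t. x ^ Suc n * (t ^ n * f (t * x)))"
      by (simp add: fun_eq_iff power_mult_distrib)
    ultimately have "((\<lambda>t. x ^ Suc n * (t ^ n * f (t * x))) has_integral F x - F 0) {0..1}"
      by (simp only: mult_1 mult_zero_left)
    then have "integral {0..1} (\<lambda>t. x ^ Suc n * (t ^ n * f (t * x))) = F x - F 0"
      by (rule integral_unique)
    then show ?thesis by (simp add: avg_def)
  qed
  then show ?thesis using F[of x] by (auto intro!: derivative_eq_intros)
qed

text \<open>
Hadamard's lemma in one variable: the difference quotient at \<open>0\<close> is an average of the derivative, so it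
is as smooth as the derivative.
\<close>

lemma avg_0_deriv:
  assumes "smooth f"
  shows "f x = f 0 + x * avg 0 (deriv f) x"
proof -
  have c: "continuous_on UNIV (deriv f)"
    using smooth_deriv(1)[OF assms] Ck_imp_continuous smoothD by blast
  have "((\<lambda>y. f y - y ^ Suc 0 * avg 0 (deriv f) y) has_field_derivative 0) (at y)" for y
    by (rule DERIV_cong[OF DERIV_diff[OF smooth_deriv(2)[OF assms] avg_antiderivative[OF c]]]) simp
  from DERIV_isconst_all[of "\<lambda>y. f y - y ^ Suc 0 * avg 0 (deriv f) y" x 0, OF allI, OF this]
  show ?thesis by simp
qed

lemma avg_abs_le:
  assumes "continuous_on UNIV f" and "(\<lambda>t. t ^ n * g t) integrable_on {0..1}"
    and "\<And>t. 0 \<le> t \<Longrightarrow> t \<le> 1 \<Longrightarrow> \<bar>f (t * x)\<bar> \<le> g t"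
  shows "\<bar>avg n f x\<bar> \<le> integral {0..1} (\<lambda>t. t ^ n * g t)"
proof -
  have "norm (avg n f x) \<le> integral {0..1} (\<lambda>t. t ^ n * g t)"
    unfolding avg_def
    by (rule integral_norm_bound_integral)
      (use assms avg_integrable in \<open>auto simp: abs_mult intro!: mult_left_mono\<close>)
  then show ?thesis by simp
qed

lemma avg_abs_le_const:
  assumes "continuous_on UNIV f" and "\<And>t. 0 \<le> t \<Longrightarrow> t \<le> 1 \<Longrightarrow> \<bar>f (t * x)\<bar> \<le> K"
  shows "\<bar>avg n f x\<bar> \<le> K / Suc n"
proof -
  have "((\<lambda>t::real. t ^ n * K) has_integral K / Suc n * 1 ^ Suc n - K / Suc n * 0 ^ Suc n) {0..1}"
    by (rule fundamental_theorem_of_calculus)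
      (auto intro!: derivative_eq_intros
        simp: has_real_derivative_iff_has_vector_derivative[symmetric] field_simps simp del: power_Suc of_nat_Suc)
  then have "((\<lambda>t::real. t ^ n * K) has_integral K / Suc n) {0..1}" by simp
  from avg_abs_le[OF assms(1) has_integral_integrable[OF this] assms(2)] integral_unique[OF this]
  show ?thesis by simp
qed

lemma avg_diff:
  assumes "continuous_on UNIV f" "continuous_on UNIV g"
  shows "avg n (\<lambda>x. f x - g x) x = avg n f x - avg n g x"
  unfolding avg_def using integral_diff[OF avg_integrable[OF assms(1)] avg_integrable[OF assms(2)]]
  by (simp add: right_diff_distrib)

lemma avg_even: "(\<And>x. f (- x) = f x) \<Longrightarrow> avg n f (- x) = avg n f x"
  by (simp add: avg_def)

section \<open>Even and odd functions\<close>

definition even_fun :: "(real \<Rightarrow> real) \<Rightarrow> bool" where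
  "even_fun g \<longleftrightarrow> (\<forall>r. g (- r) = g r)"

lemma deriv_even_odd:
  assumes "smooth g"
  shows "odd_fun g \<Longrightarrow> even_fun (deriv g)" "even_fun g \<Longrightarrow> odd_fun (deriv g)"
proof -
  have d: "((\<lambda>r. g (- r)) has_field_derivative - deriv g (- r)) (at r)" for r
    by (rule DERIV_cong[OF DERIV_chain2[OF smooth_deriv(2)[OF assms]]])
      (auto intro!: derivative_eq_intros)
  show "even_fun (deriv g)" if "odd_fun g"
  proof -
    have "((\<lambda>r. - g r) has_field_derivative - deriv g (- r)) (at r)" for r
      using d[of r] that by (simp add: odd_fun_def)
    from DERIV_unique[OF this DERIV_minus[OF smooth_deriv(2)[OF assms]]]
    show ?thesis by (simp add: even_fun_def)
  qed
  show "odd_fun (deriv g)" if "even_fun g"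
  proof -
    have "(g has_field_derivative - deriv g (- r)) (at r)" for r
      using d[of r] that by (simp add: even_fun_def)
    from DERIV_unique[OF this smooth_deriv(2)[OF assms]]
    show ?thesis unfolding odd_fun_def by (metis add.inverse_inverse)
  qed
qed

lemma smooth_odd_factor:
  assumes "smooth g" "odd_fun g"
  obtains q where "smooth q" "even_fun q" "\<And>r. g r = r * q r"
proof
  show "smooth (avg 0 (deriv g))" by (intro smooth_avg smooth_deriv assms)
  show "even_fun (avg 0 (deriv g))"
    using deriv_even_odd(1)[OF assms] by (simp add: even_fun_def avg_even)
  have "g 0 = 0" using assms(2) unfolding odd_fun_def by (metis add.inverse_neutral equal_neg_zero)
  then show "g r = r * avg 0 (deriv g) r" for r using avg_0_deriv[OF assms(1), of r] by simp
qed

text \<open>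
The derivative of \<open>g\<close> is odd, hence \<open>r p(r)\<close> with \<open>p\<close> even; integrating \<open>r p(r)\<close> gives \<open>r\<^sup>2\<close> times an
average of \<open>p\<close>.
\<close>

lemma smooth_even_factor:
  assumes "smooth g" "even_fun g"
  obtains q where "smooth q" "even_fun q" "\<And>r. g r = g 0 + r\<^sup>2 * q r"
proof -
  obtain p where p: "smooth p" "even_fun p" "\<And>r. deriv g r = r * p r"
    using smooth_odd_factor[OF smooth_deriv(1)[OF assms(1)] deriv_even_odd(2)[OF assms]] by blast
  have c: "continuous_on UNIV p" using p(1) Ck_imp_continuous smoothD by blast
  show ?thesis
  proof
    show "smooth (avg 1 p)" by (intro smooth_avg p)
    show "even_fun (avg 1 p)" using p(2) by (simp add: even_fun_def avg_even)
    fix r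
    have "((\<lambda>y. g y - y ^ Suc 1 * avg 1 p y) has_field_derivative 0) (at y)" for y
      by (rule DERIV_cong[OF DERIV_diff[OF smooth_deriv(2)[OF assms(1)] avg_antiderivative[OF c]]])
        (simp add: p(3))
    from DERIV_isconst_all[of "\<lambda>y. g y - y ^ Suc 1 * avg 1 p y" r 0, OF allI, OF this]
    show "g r = g 0 + r\<^sup>2 * avg 1 p r" by (simp add: power2_eq_square)
  qed
qed

text \<open>
Away from the origin this is the chain rule with \<open>q = g'/r\<close>; the form of the derivative remains valid at
the origin, where it vanishes.
\<close>

lemma radial_has_derivative:
  fixes x :: "'a::real_inner"
  assumes "smooth g" "\<And>r. deriv g r = r * q r"
  shows "((\<lambda>x. g (norm x)) has_derivative (\<lambda>v. q (norm x) * (x \<bullet> v))) (at x)"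
proof (cases "x = 0")
  case False
  have "((\<lambda>x. g (norm x)) has_derivative (\<lambda>v. deriv g (norm x) * (v \<bullet> sgn x))) (at x)"
    by (rule has_derivative_compose[OF has_derivative_norm[OF False]
          smooth_deriv(2)[OF assms(1), unfolded has_field_derivative_def]])
  moreover have "deriv g (norm x) * (v \<bullet> sgn x) = q (norm x) * (x \<bullet> v)" for v
    using False by (simp add: assms(2) sgn_div_norm inner_commute field_simps)
  ultimately show ?thesis by simp
next
  case True
  have "(g has_field_derivative 0) (at 0)"
    using smooth_deriv(2)[OF assms(1), of 0] assms(2)[of 0] by simp
  then have "((\<lambda>h. (g h - g 0) / h) \<longlongrightarrow> 0) (at 0)"
    by (simp add: has_field_derivative_iff)
  then have "((\<lambda>h::'a. (g (norm h) - g 0) / norm h) \<longlongrightarrow> 0) (at 0)"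
    by (rule filterlim_compose) (auto simp: filterlim_at eventually_at_filter intro!: tendsto_eq_intros)
  then have "((\<lambda>h::'a. norm ((g (norm h) - g 0) / norm h)) \<longlongrightarrow> 0) (at 0)"
    by (rule tendsto_norm_zero)
  then show ?thesis unfolding True has_derivative_at by (simp add: divide_inverse abs_mult)
qed

text \<open>
A partial derivative of \<open>g(|x|)\<close> is a linear function times \<open>q(|x|)\<close> with \<open>q = g'/r\<close> again smooth and even.
So the statement for \<open>k\<close> derivatives of \<open>q\<close> gives the one for \<open>k + 1\<close> derivatives of \<open>g\<close>.
\<close>

lemma smooth_radial:
  fixes g :: "real \<Rightarrow> real"
  assumes "smooth g" "even_fun g"
  shows "smooth (\<lambda>x::'a::real_inner. g (norm x))"
proof -
  have "Ck n (\<lambda>x::'a. g (norm x))" for n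
    using assms
  proof (induction n arbitrary: g)
    case 0
    have "continuous_on UNIV g" using 0 Ck_imp_continuous smoothD by blast
    then show ?case by (auto intro!: continuous_intros continuous_on_compose2[of UNIV g])
  next
    case (Suc n)
    obtain q where q: "smooth q" "even_fun q" "\<And>r. deriv g r = r * q r"
      using smooth_odd_factor[OF smooth_deriv(1)[OF Suc.prems(1)] deriv_even_odd(2)[OF Suc.prems]] by blast
    show ?case
      by (rule Ck_SucI[OF radial_has_derivative[OF Suc.prems(1) q(3)]])
        (intro Ck_mult Suc.IH q Ck_bounded_linear bounded_linear_inner_left)
  qed
  then show ?thesis by (simp add: smooth_def)
qed

section \<open>The equation for the angle: uniqueness\<close>

definition angle_equation :: "real \<Rightarrow> (real \<Rightarrow> real) \<Rightarrow> bool" where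
  "angle_equation c u \<longleftrightarrow>
     (\<forall>r. r\<^sup>2 * deriv (deriv u) r + (6 - c * r\<^sup>2) * r * deriv u r - 6 * sin (u r) = 0)"

lemma abs_le_of_deriv_le_power:
  fixes f :: "real \<Rightarrow> real"
  assumes "0 \<le> s" "f 0 = 0" and d: "\<And>t. (f has_field_derivative f' t) (at t)"
    and "\<And>t. 0 \<le> t \<Longrightarrow> t \<le> s \<Longrightarrow> \<bar>f' t\<bar> \<le> B * t ^ n"
  shows "\<bar>f s\<bar> \<le> B / Suc n * s ^ Suc n"
proof (cases "s = 0")
  case False
  have "norm (f s - f 0) \<le> B / Suc n * s ^ Suc n - B / Suc n * 0 ^ Suc n"
  proof (rule differentiable_bound_general[where f' = f' and \<phi>' = "\<lambda>t. B * t ^ n"])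
    show "continuous_on {0..s} f"
      using d by (meson DERIV_isCont continuous_at_imp_continuous_on)
    show "((\<lambda>t. B / Suc n * t ^ Suc n) has_vector_derivative B * t ^ n) (at t)" for t
      unfolding has_real_derivative_iff_has_vector_derivative[symmetric]
      by (rule derivative_eq_intros refl | simp del: of_nat_Suc)+
  qed (use False assms in \<open>auto intro!: continuous_intros
        simp: has_real_derivative_iff_has_vector_derivative[symmetric]\<close>)
  then show ?thesis using assms by simp
qed (use assms in auto)

lemma abs_sin_diff_le: "\<bar>sin x - sin y\<bar> \<le> \<bar>x - y\<bar>" for x y :: real
proof -
  have "norm (sin x - sin y) \<le> 1 * norm (x - y)"
    by (rule field_differentiable_bound[where S=UNIV and f'=cos])
      (auto intro!: derivative_eq_intros)
  then show ?thesis by simp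
qed

text \<open>
The difference of two solutions vanishes to second order at \<open>0\<close>. The quantity
\<open>F = r\<^sup>6 exp (-c r\<^sup>2/2) (u - w)'\<close> has derivative \<open>6 r\<^sup>4 exp (-c r\<^sup>2/2) (sin u - sin w)\<close>, so a bound by \<open>K r\<^sup>2\<close> returns
with the factor \<open>6/7\<close> from integrating \<open>r\<^sup>6\<close> and a factor \<open>1/2\<close> from integrating \<open>r\<close>. The weight
\<open>exp (L r\<^sup>2)\<close> absorbs \<open>exp (c r\<^sup>2/2)\<close>, which grows when \<open>c > 0\<close>.
\<close>

lemma angle_equation_contraction:
  assumes u: "smooth u" "angle_equation c u" and w: "smooth w" "angle_equation c w"
    and init: "u 0 = w 0" "deriv u 0 = deriv w 0"
    and L: "L = max 0 (c / 2)" and K: "0 \<le> K"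
    and bound: "\<And>t. 0 \<le> t \<Longrightarrow> t \<le> R \<Longrightarrow> \<bar>u t - w t\<bar> \<le> K * exp (L * t\<^sup>2) * t\<^sup>2"
    and r: "0 \<le> r" "r \<le> R"
  shows "\<bar>u r - w r\<bar> \<le> (3/7 * K) * exp (L * r\<^sup>2) * r\<^sup>2"
proof -
  define D where "D t = deriv u t - deriv w t" for t
  define F where "F t = t ^ 6 * exp (- (c * t\<^sup>2 / 2)) * D t" for t
  define F' where "F' t = 6 * t ^ 4 * exp (- (c * t\<^sup>2 / 2)) * (sin (u t) - sin (w t))" for t
  have dD: "(D has_field_derivative deriv (deriv u) t - deriv (deriv w) t) (at t)" for t
    unfolding D_def by (intro DERIV_diff smooth_deriv u w)
  have dF: "(F has_field_derivative F' t) (at t)" for t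
  proof -
    have "(F has_field_derivative t ^ 4 * exp (- (c * t\<^sup>2 / 2)) *
        (t\<^sup>2 * (deriv (deriv u) t - deriv (deriv w) t) + (6 - c * t\<^sup>2) * t * D t)) (at t)"
      unfolding F_def
      by (rule derivative_eq_intros dD refl | simp)+ (simp add: algebra_simps power_numeral_reduce)
    moreover have "t\<^sup>2 * (deriv (deriv u) t - deriv (deriv w) t) + (6 - c * t\<^sup>2) * t * D t
        = 6 * (sin (u t) - sin (w t))"
      using u(2)[unfolded angle_equation_def, rule_format, of t]
        w(2)[unfolded angle_equation_def, rule_format, of t]
      unfolding D_def by (simp add: algebra_simps)
    ultimately show ?thesis unfolding F'_def by (simp only: mult_ac)
  qed
  have D_le: "\<bar>D s\<bar> \<le> 6/7 * K * exp (L * s\<^sup>2) * s" if s: "0 \<le> s" "s \<le> R" for s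
  proof (cases "s = 0")
    case True then show ?thesis using init by (simp add: D_def)
  next
    case False
    let ?B = "6 * K * exp (L * s\<^sup>2) * exp (- (c * s\<^sup>2 / 2))"
    have "\<bar>F s\<bar> \<le> ?B / Suc 6 * s ^ Suc 6"
    proof (rule abs_le_of_deriv_le_power[OF s(1) _ dF])
      fix t assume t: "0 \<le> t" "t \<le> s"
      (* L is at least c/2, so the exponent (L - c/2) t^2 is increasing and the weight
         can be taken out of the integral at its upper end. *)
      have "exp (L * t\<^sup>2) * exp (- (c * t\<^sup>2 / 2)) \<le> exp (L * s\<^sup>2) * exp (- (c * s\<^sup>2 / 2))"
      proof -
        have "(L - c / 2) * t\<^sup>2 \<le> (L - c / 2) * s\<^sup>2"
          by (rule mult_left_mono) (use t L in auto)
        then show ?thesis by (simp add: exp_add[symmetric] algebra_simps)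
      qed
      then have 1: "K * (exp (L * t\<^sup>2) * exp (- (c * t\<^sup>2 / 2)))
          \<le> K * (exp (L * s\<^sup>2) * exp (- (c * s\<^sup>2 / 2)))"
        using K by (rule mult_left_mono)
      have "\<bar>F' t\<bar> = 6 * t ^ 4 * exp (- (c * t\<^sup>2 / 2)) * \<bar>sin (u t) - sin (w t)\<bar>"
        by (simp add: F'_def abs_mult)
      also have "\<dots> \<le> 6 * t ^ 4 * exp (- (c * t\<^sup>2 / 2)) * (K * exp (L * t\<^sup>2) * t\<^sup>2)"
        by (rule mult_left_mono[OF order_trans[OF abs_sin_diff_le bound]]) (use t s in auto)
      also have "\<dots> = 6 * t ^ 6 * (K * (exp (L * t\<^sup>2) * exp (- (c * t\<^sup>2 / 2))))"
        by (simp add: power_numeral_reduce)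
      also have "\<dots> \<le> 6 * t ^ 6 * (K * (exp (L * s\<^sup>2) * exp (- (c * s\<^sup>2 / 2))))"
        by (rule mult_left_mono[OF 1]) simp
      finally show "\<bar>F' t\<bar> \<le> ?B * t ^ 6" by (simp add: mult_ac)
    qed (simp add: F_def)
    moreover have "\<bar>F s\<bar> = (s ^ 6 * exp (- (c * s\<^sup>2 / 2))) * \<bar>D s\<bar>"
      using s by (simp add: F_def abs_mult)
    moreover have "?B / Suc 6 * s ^ Suc 6
        = (s ^ 6 * exp (- (c * s\<^sup>2 / 2))) * (6/7 * K * exp (L * s\<^sup>2) * s)"
      by (simp add: power_numeral_reduce)
    ultimately have "(s ^ 6 * exp (- (c * s\<^sup>2 / 2))) * \<bar>D s\<bar>
        \<le> (s ^ 6 * exp (- (c * s\<^sup>2 / 2))) * (6/7 * K * exp (L * s\<^sup>2) * s)"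
      by (simp only:)
    moreover have "0 < s ^ 6 * exp (- (c * s\<^sup>2 / 2))" using False by simp
    ultimately show ?thesis by (simp only: mult_le_cancel_left_pos)
  qed
  have "\<bar>u r - w r\<bar> \<le> (6/7 * K * exp (L * r\<^sup>2)) / Suc 1 * r ^ Suc 1"
  proof (rule abs_le_of_deriv_le_power[OF r(1), where f = "\<lambda>t. u t - w t" and f' = D])
    show "((\<lambda>t. u t - w t) has_field_derivative D t) (at t)" for t
      unfolding D_def by (intro DERIV_diff smooth_deriv u w)
    fix t assume t: "0 \<le> t" "t \<le> r"
    have "L * t\<^sup>2 \<le> L * r\<^sup>2" by (rule mult_left_mono) (use t L in auto)
    then have "6/7 * K * exp (L * t\<^sup>2) * t \<le> 6/7 * K * exp (L * r\<^sup>2) * t"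
      using t K by (intro mult_right_mono mult_left_mono) auto
    moreover have "\<bar>D t\<bar> \<le> 6/7 * K * exp (L * t\<^sup>2) * t"
      using D_le t r by simp
    ultimately show "\<bar>D t\<bar> \<le> 6/7 * K * exp (L * r\<^sup>2) * t ^ 1"
      unfolding power_one_right by (rule order_trans[rotated])
  qed (use init in simp)
  then show ?thesis by (simp add: power2_eq_square)
qed

text \<open>
Taylor's formula provides some constant \<open>K\<close> to start the contraction with; iterating it sends the bound
to \<open>0\<close>.
\<close>

lemma angle_equation_unique:
  assumes u: "smooth u" "angle_equation c u" and w: "smooth w" "angle_equation c w"
    and init: "u 0 = w 0" "deriv u 0 = deriv w 0" and r: "0 \<le> r"
  shows "u r = w r"
proof -
  define L where "L = max 0 (c / 2)"
  define D where "D t = deriv u t - deriv w t" for t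
  have sD: "smooth (\<lambda>t. deriv (deriv u) t - deriv (deriv w) t)"
    by (intro smooth_diff smooth_deriv u w)
  have "compact ((\<lambda>t. deriv (deriv u) t - deriv (deriv w) t) ` {0..r})"
    using Ck_imp_continuous[OF smoothD[OF sD]]
    by (intro compact_continuous_image) (auto intro: continuous_on_subset)
  then have "bounded ((\<lambda>t. deriv (deriv u) t - deriv (deriv w) t) ` {0..r})"
    by (rule compact_imp_bounded)
  then obtain M where "\<forall>y\<in>(\<lambda>t. deriv (deriv u) t - deriv (deriv w) t) ` {0..r}. norm y \<le> M"
    unfolding bounded_iff by blast
  then have M: "\<bar>deriv (deriv u) t - deriv (deriv w) t\<bar> \<le> M" if "0 \<le> t" "t \<le> r" for t
    using that by auto
  have M0: "0 \<le> M" using M[of 0] r by linarith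
  have D1: "\<bar>D s\<bar> \<le> M * s" if "0 \<le> s" "s \<le> r" for s
  proof -
    have "\<bar>D s\<bar> \<le> M / Suc 0 * s ^ Suc 0"
    proof (rule abs_le_of_deriv_le_power[OF that(1)])
      show "(D has_field_derivative deriv (deriv u) t - deriv (deriv w) t) (at t)" for t
        unfolding D_def by (intro DERIV_diff smooth_deriv u w)
    qed (use init M that in \<open>auto simp: D_def\<close>)
    then show ?thesis by simp
  qed
  have base: "\<bar>u s - w s\<bar> \<le> M * exp (L * s\<^sup>2) * s\<^sup>2" if s: "0 \<le> s" "s \<le> r" for s
  proof -
    have "\<bar>u s - w s\<bar> \<le> M / Suc 1 * s ^ Suc 1"
    proof (rule abs_le_of_deriv_le_power[OF that(1), where f = "\<lambda>t. u t - w t" and f' = D])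
      show "((\<lambda>t. u t - w t) has_field_derivative D t) (at t)" for t
        unfolding D_def by (intro DERIV_diff smooth_deriv u w)
    qed (use init D1 that in auto)
    also have "\<dots> \<le> M * exp (L * s\<^sup>2) * s\<^sup>2"
    proof -
      have "M / 2 \<le> M * exp (L * s\<^sup>2)"
        using mult_left_mono[OF one_le_exp_iff[THEN iffD2] M0, of "L * s\<^sup>2"] M0 by (simp add: L_def)
      then show ?thesis using mult_right_mono[of "M/2" _ "s\<^sup>2"] by (simp add: power2_eq_square)
    qed
    finally show ?thesis .
  qed
  have iter: "\<forall>s. 0 \<le> s \<and> s \<le> r \<longrightarrow> \<bar>u s - w s\<bar> \<le> ((3/7) ^ n * M) * exp (L * s\<^sup>2) * s\<^sup>2" for n
  proof (induction n)
    case 0 then show ?case using base by simp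
  next
    case (Suc n)
    show ?case
      using angle_equation_contraction[OF u w init L_def _ Suc.IH[rule_format], of r] M0
      by (simp add: mult.assoc)
  qed
  have "(\<lambda>n. ((3/7) ^ n * M) * exp (L * r\<^sup>2) * r\<^sup>2) \<longlonglongrightarrow> (0 * M) * exp (L * r\<^sup>2) * r\<^sup>2"
    by (intro tendsto_intros LIMSEQ_power_zero) simp
  then have "\<bar>u r - w r\<bar> \<le> (0 * M) * exp (L * r\<^sup>2) * r\<^sup>2"
    by (rule LIMSEQ_le_const) (use iter r in auto)
  then show ?thesis by simp
qed

lemma smooth_reflect:
  fixes u :: "real \<Rightarrow> real"
  assumes "smooth u"
  shows "smooth (\<lambda>r. - u (- r))" "deriv (\<lambda>r. - u (- r)) r = deriv u (- r)"
proof -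
  show "smooth (\<lambda>r. - u (- r))"
    unfolding smooth_def
    by (intro allI Ck_minus Ck_compose[OF smoothD[OF assms]] Ck_ident)
  show "deriv (\<lambda>r. - u (- r)) r = deriv u (- r)"
    by (rule DERIV_imp_deriv, rule DERIV_cong[OF DERIV_minus[OF DERIV_chain2[OF smooth_deriv(2)[OF assms]]]])
      (auto intro!: derivative_eq_intros)
qed

text \<open>
The equation is invariant under \<open>u \<mapsto> - u(- \<cdot>)\<close>, which also preserves \<open>u(0) = 0\<close> and \<open>u'(0)\<close>.
\<close>

lemma angle_equation_odd:
  assumes u: "smooth u" "angle_equation c u" "u 0 = 0"
  shows "odd_fun u"
proof -
  let ?w = "\<lambda>r. - u (- r)"
  have d1: "deriv ?w = (\<lambda>r. deriv u (- r))"
    using smooth_reflect(2)[OF u(1)] by auto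
  have d2: "deriv (\<lambda>r. deriv u (- r)) r = - deriv (deriv u) (- r)" for r
    by (rule DERIV_imp_deriv, rule DERIV_cong[OF DERIV_chain2[OF smooth_deriv(2)[OF smooth_deriv(1)[OF u(1)]]]])
      (auto intro!: derivative_eq_intros)
  have "angle_equation c ?w"
    unfolding angle_equation_def d1 d2
  proof
    fix r
    show "r\<^sup>2 * - deriv (deriv u) (- r) + (6 - c * r\<^sup>2) * r * deriv u (- r) - 6 * sin (- u (- r)) = 0"
      using u(2)[unfolded angle_equation_def, rule_format, of "- r"] by simp
  qed
  then have *: "u r = ?w r" if "0 \<le> r" for r
    using angle_equation_unique[OF u(1,2) smooth_reflect(1)[OF u(1)], of r] u(3) d1 that by simp
  have "u (- r) = - u r" for r
    using *[of r] *[of "- r"] by (cases "0 \<le> r") auto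
  then show ?thesis by (simp add: odd_fun_def)
qed

section \<open>The equation for the angle: existence\<close>

text \<open>
The entire function \<open>(x - sin x)/x\<^sup>3\<close>. The three averages correspond to the three divisions by \<open>x\<close>, and
they make smoothness at the origin evident.
\<close>

definition cubic_rest :: "real \<Rightarrow> real" where
  "cubic_rest = avg 2 (avg 1 (avg 0 cos))"

lemma smooth_cubic_rest: "smooth cubic_rest"
  unfolding cubic_rest_def by (intro smooth_avg) (simp add: smooth_def Ck_sin_cos)

lemma cube_cubic_rest: "x ^ 3 * cubic_rest x = x - sin x"
proof -
  have c: "continuous_on UNIV (cos :: real \<Rightarrow> real)" by (simp add: continuous_at_imp_continuous_on)
  note c0 = avg_continuous[OF c, of 0]
  note c1 = avg_continuous[OF c0, of 1]
  have const: "f x = g x" if "\<And>y. (f has_field_derivative h y) (at y)"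
    "\<And>y. (g has_field_derivative h y) (at y)" "f 0 = g 0" for f g h :: "real \<Rightarrow> real" and x
    using DERIV_isconst_all[of "\<lambda>y. f y - g y" x 0] DERIV_diff[OF that(1,2)] that(3) by simp
  have 1: "y ^ Suc 0 * avg 0 cos y = sin y" for y :: real
    by (rule const[OF avg_antiderivative[OF c]]) (auto intro!: derivative_eq_intros)
  have 2: "y ^ Suc 1 * avg 1 (avg 0 cos) y = 1 - cos y" for y :: real
    by (rule const[OF avg_antiderivative[OF c0]]) (use 1 in \<open>auto intro!: derivative_eq_intros\<close>)
  have 3: "y ^ Suc 2 * avg 2 (avg 1 (avg 0 cos)) y = y - sin y" for y :: real
    by (rule const[OF avg_antiderivative[OF c1]])
      (use 2 in \<open>auto intro!: derivative_eq_intros simp: power2_eq_square\<close>)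
  from 3[of x] show ?thesis by (simp add: cubic_rest_def numeral_3_eq_3)
qed

lemma abs_cubic_rest_le_1: "\<bar>cubic_rest x\<bar> \<le> 1"
proof -
  have c: "continuous_on UNIV (cos :: real \<Rightarrow> real)" by (simp add: continuous_at_imp_continuous_on)
  have *: "\<bar>avg n f x\<bar> \<le> 1" if "continuous_on UNIV f" "\<And>x. \<bar>f x\<bar> \<le> 1" for n f x
  proof -
    have "\<bar>avg n f x\<bar> \<le> 1 / Suc n" by (rule avg_abs_le_const) (use that in auto)
    also have "\<dots> \<le> 1" by simp
    finally show ?thesis .
  qed
  show ?thesis unfolding cubic_rest_def by (intro * avg_continuous c) simp
qed

text \<open>
The right-hand side of \<open>v'' + (8/t - c t) v' = source c v t\<close>, the angle equation for \<open>u = t v\<close>. The linear part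
of \<open>6 sin (t v)/t\<^sup>3\<close> has been absorbed by the left-hand side, and the rest is regular at \<open>t = 0\<close>.
\<close>

definition source :: "real \<Rightarrow> real \<Rightarrow> real \<Rightarrow> real" where
  "source c v t = c * v - 6 * (v ^ 3 * cubic_rest (t * v))"

lemma source_mult_cube: "t ^ 3 * source c v t = c * t ^ 3 * v - 6 * (t * v - sin (t * v))"
  using cube_cubic_rest[of "t * v"] by (simp add: source_def algebra_simps power_mult_distrib)

text \<open>
For general \<open>v\<close> the Lipschitz constant is of size \<open>12/t\<^sup>2\<close>. It becomes harmless for functions
\<open>\<beta> + t\<^sup>2 w\<close> with the same value \<open>\<beta>\<close> at the origin.
\<close>

lemma source_lipschitz:
  "\<bar>source c (\<beta> + t\<^sup>2 * w) t - source c (\<beta> + t\<^sup>2 * z) t\<bar> \<le> (12 + \<bar>c\<bar> * t\<^sup>2) * \<bar>w - z\<bar>"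
proof (cases "t = 0")
  case False
  let ?v = "\<beta> + t\<^sup>2 * w" and ?y = "\<beta> + t\<^sup>2 * z"
  have "t ^ 3 * (source c ?v t - source c ?y t)
      = c * t ^ 3 * (?v - ?y) - 6 * (t * (?v - ?y) - (sin (t * ?v) - sin (t * ?y)))"
    unfolding right_diff_distrib source_mult_cube by (simp add: algebra_simps)
  moreover have "\<bar>X\<bar> \<le> \<bar>A\<bar> + 6 * (\<bar>B\<bar> + \<bar>C\<bar>)" if "X = A - 6 * (B - C)" for X A B C :: real
    using that by (auto simp: abs_if)
  ultimately have "\<bar>t ^ 3 * (source c ?v t - source c ?y t)\<bar>
      \<le> \<bar>c * t ^ 3 * (?v - ?y)\<bar> + 6 * (\<bar>t * (?v - ?y)\<bar> + \<bar>sin (t * ?v) - sin (t * ?y)\<bar>)"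
    by blast
  also have "\<bar>sin (t * ?v) - sin (t * ?y)\<bar> \<le> \<bar>t * (?v - ?y)\<bar>"
    using abs_sin_diff_le[of "t * ?v" "t * ?y"] by (simp only: right_diff_distrib)
  also have "?v - ?y = t\<^sup>2 * (w - z)" by (simp add: algebra_simps)
  also have "\<bar>c * t ^ 3 * (t\<^sup>2 * (w - z))\<bar> + 6 * (\<bar>t * (t\<^sup>2 * (w - z))\<bar> + \<bar>t * (t\<^sup>2 * (w - z))\<bar>)
      = \<bar>t ^ 3\<bar> * ((12 + \<bar>c\<bar> * t\<^sup>2) * \<bar>w - z\<bar>)"
  proof -
    have "\<bar>t ^ 3\<bar> = \<bar>t\<bar> * t\<^sup>2" by (simp add: abs_mult power3_eq_cube power2_eq_square)
    then show ?thesis unfolding abs_mult abs_power2 by (simp only: algebra_simps)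
  qed
  finally show ?thesis using False by (simp add: abs_mult)
qed simp

text \<open>
If \<open>v = \<beta> + r\<^sup>2 w\<close> with \<open>w = radial_inverse c h\<close>, then \<open>(r\<^sup>8 exp (-c r\<^sup>2/2) v')' = r\<^sup>8 exp (-c r\<^sup>2/2) h\<close>: the inner
average integrates once and gives \<open>v'/r\<close>, the outer one integrates \<open>r (v'/r)\<close>.
\<close>

definition radial_inverse :: "real \<Rightarrow> (real \<Rightarrow> real) \<Rightarrow> real \<Rightarrow> real" where
  "radial_inverse c h = avg 1 (\<lambda>s. exp (c * s\<^sup>2 / 2) * avg 8 (\<lambda>t. exp (- (c * t\<^sup>2 / 2)) * h t) s)"

lemma radial_inverse_continuous:
  assumes "continuous_on UNIV h"
  shows "continuous_on UNIV (\<lambda>t. exp (- (c * t\<^sup>2 / 2)) * h t)"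
    "continuous_on UNIV (\<lambda>s. exp (c * s\<^sup>2 / 2) * avg 8 (\<lambda>t. exp (- (c * t\<^sup>2 / 2)) * h t) s)"
    "continuous_on UNIV (radial_inverse c h)"
proof -
  show 1: "continuous_on UNIV (\<lambda>t. exp (- (c * t\<^sup>2 / 2)) * h t)"
    by (intro continuous_intros assms) simp
  show 2: "continuous_on UNIV (\<lambda>s. exp (c * s\<^sup>2 / 2) * avg 8 (\<lambda>t. exp (- (c * t\<^sup>2 / 2)) * h t) s)"
    by (intro continuous_intros avg_continuous 1) simp
  show "continuous_on UNIV (radial_inverse c h)"
    unfolding radial_inverse_def by (rule avg_continuous[OF 2])
qed

lemma radial_inverse_diff:
  assumes "continuous_on UNIV h" "continuous_on UNIV k"
  shows "radial_inverse c (\<lambda>t. h t - k t) r = radial_inverse c h r - radial_inverse c k r"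
  unfolding radial_inverse_def right_diff_distrib
    avg_diff[OF radial_inverse_continuous(1)[OF assms(1)] radial_inverse_continuous(1)[OF assms(2)]]
  by (rule avg_diff) (intro radial_inverse_continuous(2) assms)+

text \<open>
The weights \<open>t\<^sup>8\<close> and \<open>t\<close> turn the constant \<open>12\<close> into \<open>12/9 \<cdot> 1/2 = 2/3\<close>. The unbounded part
\<open>|c| t\<^sup>2\<close> costs only \<open>1/9 \<cdot> 1/2 = 1/18\<close>, because \<open>2 |c| r\<^sup>2 t exp (|c| r\<^sup>2 t\<^sup>2)\<close> is the derivative of the
exponential weight. Together this is \<open>13/18 < 1\<close>.
\<close>

lemma radial_inverse_bound:
  assumes h: "continuous_on UNIV h" and K: "0 \<le> K"
    and bound: "\<And>t. \<bar>h t\<bar> \<le> (12 + \<bar>c\<bar> * t\<^sup>2) * (K * exp (\<bar>c\<bar> * t\<^sup>2))"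
  shows "\<bar>radial_inverse c h r\<bar> \<le> 13/18 * K * exp (\<bar>c\<bar> * r\<^sup>2)"
proof -
  let ?Q = "\<lambda>s. exp (c * s\<^sup>2 / 2) * avg 8 (\<lambda>t. exp (- (c * t\<^sup>2 / 2)) * h t) s"
  have Q: "\<bar>?Q s\<bar> \<le> (12 + \<bar>c\<bar> * s\<^sup>2) / 9 * K * exp (\<bar>c\<bar> * s\<^sup>2)" for s
  proof -
    have "\<bar>avg 8 (\<lambda>t. exp (- (c * t\<^sup>2 / 2)) * h t) s\<bar>
        \<le> ((12 + \<bar>c\<bar> * s\<^sup>2) * (K * exp ((\<bar>c\<bar> - c / 2) * s\<^sup>2))) / Suc 8"
    proof (rule avg_abs_le_const[OF radial_inverse_continuous(1)[OF h]])
      fix t :: real assume t: "0 \<le> t" "t \<le> 1"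
      have ts: "(t * s)\<^sup>2 \<le> s\<^sup>2"
        using t mult_right_mono[of "t\<^sup>2" 1 "s\<^sup>2"] by (simp add: power_mult_distrib power_le_one)
      have e: "(\<bar>c\<bar> - c / 2) * (t * s)\<^sup>2 \<le> (\<bar>c\<bar> - c / 2) * s\<^sup>2"
        by (rule mult_left_mono[OF ts]) (auto simp: abs_if)
      have "\<bar>exp (- (c * (t * s)\<^sup>2 / 2)) * h (t * s)\<bar>
          \<le> exp (- (c * (t * s)\<^sup>2 / 2)) * ((12 + \<bar>c\<bar> * (t * s)\<^sup>2) * (K * exp (\<bar>c\<bar> * (t * s)\<^sup>2)))"
        unfolding abs_mult abs_exp_cancel by (rule mult_left_mono[OF bound]) simp
      also have "\<dots> = (12 + \<bar>c\<bar> * (t * s)\<^sup>2) * (K * exp ((\<bar>c\<bar> - c / 2) * (t * s)\<^sup>2))"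
        by (simp add: exp_add[symmetric] exp_diff[symmetric] left_diff_distrib exp_diff exp_minus field_simps)
      also have "\<dots> \<le> (12 + \<bar>c\<bar> * s\<^sup>2) * (K * exp ((\<bar>c\<bar> - c / 2) * s\<^sup>2))"
        by (intro mult_mono add_left_mono) (use ts e K in \<open>auto intro: mult_left_mono\<close>)
      finally show "\<bar>exp (- (c * (t * s)\<^sup>2 / 2)) * h (t * s)\<bar>
          \<le> (12 + \<bar>c\<bar> * s\<^sup>2) * (K * exp ((\<bar>c\<bar> - c / 2) * s\<^sup>2))" .
    qed
    then have "exp (c * s\<^sup>2 / 2) * \<bar>avg 8 (\<lambda>t. exp (- (c * t\<^sup>2 / 2)) * h t) s\<bar>
        \<le> exp (c * s\<^sup>2 / 2) * (((12 + \<bar>c\<bar> * s\<^sup>2) * (K * exp ((\<bar>c\<bar> - c / 2) * s\<^sup>2))) / Suc 8)"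
      by (rule mult_left_mono) simp
    also have "\<dots> = (12 + \<bar>c\<bar> * s\<^sup>2) / 9 * K * (exp (c * s\<^sup>2 / 2) * exp ((\<bar>c\<bar> - c / 2) * s\<^sup>2))"
      by simp
    also have "exp (c * s\<^sup>2 / 2) * exp ((\<bar>c\<bar> - c / 2) * s\<^sup>2) = exp (\<bar>c\<bar> * s\<^sup>2)"
      unfolding exp_add[symmetric] by (simp add: algebra_simps)
    finally show ?thesis by (simp add: abs_mult)
  qed
  define m where "m = \<bar>c\<bar> * r\<^sup>2"
  have m0: "0 \<le> m" by (simp add: m_def)
  define g where "g t = (12 + m * t\<^sup>2) / 9 * K * exp (m * t\<^sup>2)" for t
  (* Z is an explicit function with Z' at least t g(t); an antiderivative of t g(t)
     itself has m in the denominator, which vanishes for c = 0 or r = 0. *)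
  define Z where "Z t = K * (2/3 * t\<^sup>2 + 1/18) * exp (m * t\<^sup>2)" for t
  define Z' where "Z' t = K * t * exp (m * t\<^sup>2) * (4/3 + 4/3 * (m * t\<^sup>2) + m / 9)" for t
  have Z: "(Z' has_integral Z 1 - Z 0) {0..1}"
  proof (rule fundamental_theorem_of_calculus)
    fix t
    have "(Z has_field_derivative Z' t) (at t)"
      unfolding Z_def Z'_def
      by (rule derivative_eq_intros refl | simp)+ (simp add: algebra_simps power2_eq_square)
    then show "(Z has_vector_derivative Z' t) (at t within {0..1})"
      by (simp add: has_real_derivative_iff_has_vector_derivative[symmetric] has_field_derivative_at_within)
  qed simp
  have gi: "(\<lambda>t. t ^ 1 * g t) integrable_on {0..1}"
    unfolding g_def by (intro integrable_continuous_real continuous_intros) auto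
  have "\<bar>radial_inverse c h r\<bar> \<le> integral {0..1} (\<lambda>t. t ^ 1 * g t)"
    unfolding radial_inverse_def
  proof (rule avg_abs_le[OF radial_inverse_continuous(2)[OF h] gi])
    fix t
    show "\<bar>?Q (t * r)\<bar> \<le> g t"
      using Q[of "t * r"] by (simp add: g_def m_def power_mult_distrib mult_ac)
  qed
  also have "\<dots> \<le> integral {0..1} Z'"
  proof (rule integral_le[OF gi has_integral_integrable[OF Z]])
    fix t :: real assume t: "t \<in> {0..1}"
    have "K * t * exp (m * t\<^sup>2) * ((12 + m * t\<^sup>2) / 9) \<le> Z' t"
      unfolding Z'_def by (rule mult_left_mono) (use t m0 K in \<open>auto simp: field_simps\<close>)
    then show "t ^ 1 * g t \<le> Z' t" by (simp add: g_def mult_ac)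
  qed
  also have "\<dots> = Z 1 - Z 0" by (rule integral_unique[OF Z])
  also have "\<dots> \<le> 13/18 * K * exp m" using K by (simp add: Z_def)
  finally show ?thesis by (simp add: m_def)
qed

lemma source_continuous:
  assumes "continuous_on UNIV v"
  shows "continuous_on UNIV (\<lambda>t. source c (v t) t)"
  unfolding source_def
  by (intro continuous_intros continuous_on_compose2[OF Ck_imp_continuous[OF smoothD[OF smooth_cubic_rest]]] assms) auto

text \<open>
Banach's fixed point theorem for \<open>\<omega> = exp (- |c| t\<^sup>2) w\<close> in the space of bounded continuous functions on the
line.
\<close>

lemma fixed_point_exists:
  obtains w where "continuous_on UNIV w"
    "\<And>r. w r = radial_inverse c (\<lambda>t. source c (\<beta> + t\<^sup>2 * w t) t) r"
proof -
  define E where "E t = exp (\<bar>c\<bar> * t\<^sup>2)" for t :: real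
  have Epos: "0 < E t" for t by (simp add: E_def)
  have Econt: "continuous_on UNIV E" unfolding E_def by (intro continuous_intros)
  define V where "V \<omega> t = \<beta> + t\<^sup>2 * (E t * apply_bcontfun \<omega> t)" for \<omega> and t :: real
  define h where "h \<omega> t = source c (V \<omega> t) t" for \<omega> t
  define T where "T \<omega> r = radial_inverse c (h \<omega>) r / E r" for \<omega> r
  have hcont: "continuous_on UNIV (h \<omega>)" for \<omega>
    unfolding h_def V_def by (intro source_continuous continuous_intros Econt) auto
  have lip: "\<bar>T \<omega> r - T \<zeta> r\<bar> \<le> 13/18 * dist \<omega> \<zeta>" for \<omega> \<zeta> r
  proof -
    have "\<bar>radial_inverse c (\<lambda>t. h \<omega> t - h \<zeta> t) r\<bar> \<le> 13/18 * dist \<omega> \<zeta> * exp (\<bar>c\<bar> * r\<^sup>2)"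
    proof (rule radial_inverse_bound)
      fix t
      have "\<bar>h \<omega> t - h \<zeta> t\<bar> \<le> (12 + \<bar>c\<bar> * t\<^sup>2) * \<bar>E t * apply_bcontfun \<omega> t - E t * apply_bcontfun \<zeta> t\<bar>"
        unfolding h_def V_def by (rule source_lipschitz)
      also have "\<bar>E t * apply_bcontfun \<omega> t - E t * apply_bcontfun \<zeta> t\<bar>
          = dist (apply_bcontfun \<omega> t) (apply_bcontfun \<zeta> t) * E t"
        using Epos[of t] by (simp add: dist_real_def right_diff_distrib[symmetric] abs_mult)
      also have "(12 + \<bar>c\<bar> * t\<^sup>2) * \<dots> \<le> (12 + \<bar>c\<bar> * t\<^sup>2) * (dist \<omega> \<zeta> * E t)"
        using dist_bounded[of \<omega> t \<zeta>] Epos[of t]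
        by (intro mult_left_mono mult_right_mono) auto
      finally show "\<bar>h \<omega> t - h \<zeta> t\<bar> \<le> (12 + \<bar>c\<bar> * t\<^sup>2) * (dist \<omega> \<zeta> * exp (\<bar>c\<bar> * t\<^sup>2))"
        by (simp add: E_def)
    qed (auto intro!: continuous_intros hcont)
    then have "\<bar>radial_inverse c (h \<omega>) r - radial_inverse c (h \<zeta>) r\<bar> \<le> 13/18 * dist \<omega> \<zeta> * E r"
      by (simp add: radial_inverse_diff[OF hcont hcont] E_def)
    moreover have "T \<omega> r - T \<zeta> r = (radial_inverse c (h \<omega>) r - radial_inverse c (h \<zeta>) r) / E r"
      by (simp add: T_def diff_divide_distrib)
    ultimately show ?thesis
      using Epos[of r] by (simp add: abs_divide pos_divide_le_eq)
  qed
  have base: "\<bar>T 0 r\<bar> \<le> 13/18 * (\<bar>c * \<beta>\<bar> + 6 * \<bar>\<beta>\<bar> ^ 3)" for r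
  proof -
    let ?K = "\<bar>c * \<beta>\<bar> + 6 * \<bar>\<beta>\<bar> ^ 3"
    have "\<bar>radial_inverse c (h 0) r\<bar> \<le> 13/18 * ?K * exp (\<bar>c\<bar> * r\<^sup>2)"
    proof (rule radial_inverse_bound[OF hcont])
      fix t
      have "\<bar>h 0 t\<bar> \<le> \<bar>c * \<beta>\<bar> + 6 * (\<bar>\<beta>\<bar> ^ 3 * \<bar>cubic_rest (t * \<beta>)\<bar>)"
        unfolding h_def V_def source_def
        by (rule order_trans[OF abs_triangle_ineq4]) (simp add: abs_mult power_abs)
      also have "\<dots> \<le> ?K"
        using mult_left_mono[OF abs_cubic_rest_le_1, of "\<bar>\<beta>\<bar> ^ 3" "t * \<beta>"] by simp
      also have "\<dots> \<le> (12 + \<bar>c\<bar> * t\<^sup>2) * (?K * exp (\<bar>c\<bar> * t\<^sup>2))"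
      proof -
        have "1 * (?K * 1) \<le> (12 + \<bar>c\<bar> * t\<^sup>2) * (?K * exp (\<bar>c\<bar> * t\<^sup>2))"
          by (intro mult_mono) (auto intro!: add_nonneg_nonneg mult_nonneg_nonneg simp: add.commute[of 12] intro: add_increasing)
        then show ?thesis by simp
      qed
      finally show "\<bar>h 0 t\<bar> \<le> (12 + \<bar>c\<bar> * t\<^sup>2) * (?K * exp (\<bar>c\<bar> * t\<^sup>2))" .
    qed simp
    then show ?thesis using Epos[of r] by (simp add: T_def E_def abs_divide pos_divide_le_eq)
  qed
  have T_bcontfun: "T \<omega> \<in> bcontfun" for \<omega>
  proof -
    have "continuous_on UNIV (T \<omega>)"
      unfolding T_def
      by (intro continuous_intros radial_inverse_continuous hcont Econt) (use Epos in \<open>auto simp: less_imp_neq[symmetric]\<close>)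
    moreover have "\<bar>T \<omega> r\<bar> \<le> 13/18 * dist \<omega> 0 + 13/18 * (\<bar>c * \<beta>\<bar> + 6 * \<bar>\<beta>\<bar> ^ 3)" for r
      using lip[of \<omega> r 0] base[of r] by linarith
    ultimately show ?thesis unfolding bcontfun_def bounded_iff by auto
  qed
  have T_app: "apply_bcontfun (Bcontfun (T \<omega>)) = T \<omega>" for \<omega>
    using Bcontfun_inverse[OF T_bcontfun] .
  have "dist (Bcontfun (T \<omega>)) (Bcontfun (T \<zeta>)) \<le> 13/18 * dist \<omega> \<zeta>" for \<omega> \<zeta>
    by (rule dist_bound) (simp only: T_app dist_real_def lip)
  then obtain \<omega> where \<omega>: "Bcontfun (T \<omega>) = \<omega>"
    using banach_fix_type[of "13/18" "\<lambda>\<omega>. Bcontfun (T \<omega>)"] by auto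
  show ?thesis
  proof (rule that[of "\<lambda>t. E t * apply_bcontfun \<omega> t"])
    show "continuous_on UNIV (\<lambda>t. E t * apply_bcontfun \<omega> t)"
      by (intro continuous_intros Econt) auto
    show "E r * apply_bcontfun \<omega> r
        = radial_inverse c (\<lambda>t. source c (\<beta> + t\<^sup>2 * (E t * apply_bcontfun \<omega> t)) t) r" for r
    proof -
      have "apply_bcontfun \<omega> r = T \<omega> r" using T_app[of \<omega>] \<omega> by simp
      then show ?thesis using Epos[of r] by (simp add: T_def h_def[abs_def] V_def)
    qed
  qed
qed

lemma smooth_gaussian: "smooth (\<lambda>t. exp (k * t\<^sup>2 / 2))" for k :: real
  using smooth_exp[OF smooth_mult[OF smooth_const[of "k / 2"] smooth_power[OF smooth_ident, of 2]]]
  by simp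

text \<open>
The fixed point \<open>w\<close> is only continuous at first. But \<open>v' = r Q\<close>, where \<open>Q\<close> is a weighted average of \<open>h\<close> and \<open>h\<close> is a
smooth function of \<open>v\<close> and \<open>r\<close>; so \<open>k\<close> derivatives of \<open>v\<close> yield \<open>k + 1\<close>.
\<close>

lemma angle_equation_exists:
  obtains u where "smooth u" "u 0 = 0" "deriv u 0 = \<beta>" "angle_equation c u"
proof -
  obtain w where w: "continuous_on UNIV w"
    "\<And>r. w r = radial_inverse c (\<lambda>t. source c (\<beta> + t\<^sup>2 * w t) t) r"
    using fixed_point_exists[of c \<beta>] by blast
  define v where "v r = \<beta> + r\<^sup>2 * w r" for r
  define h where "h t = source c (v t) t" for t
  define A where "A = avg 8 (\<lambda>t. exp (- (c * t\<^sup>2 / 2)) * h t)"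
  define Q where "Q s = exp (c * s\<^sup>2 / 2) * A s" for s
  have vcont: "continuous_on UNIV v" unfolding v_def by (intro continuous_intros w)
  have hcont: "continuous_on UNIV h" unfolding h_def by (rule source_continuous[OF vcont])
  have Qcont: "continuous_on UNIV Q"
    unfolding Q_def A_def by (rule radial_inverse_continuous(2)[OF hcont])
  have wQ: "w r = avg 1 Q r" for r
    using w(2)[of r] unfolding radial_inverse_def Q_def A_def h_def v_def .
  have dv: "(v has_field_derivative r * Q r) (at r)" for r
  proof -
    have "v = (\<lambda>r. \<beta> + r ^ Suc 1 * avg 1 Q r)" by (simp add: fun_eq_iff v_def wQ power2_eq_square)
    then show ?thesis
      using DERIV_add[OF DERIV_const[of \<beta>] avg_antiderivative[OF Qcont, of 1 r]] by simp
  qed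
  have "Ck n v" for n
  proof (induction n)
    case 0 then show ?case using vcont by simp
  next
    case (Suc n)
    have "Ck n (\<lambda>t. cubic_rest (t * v t))"
      by (rule Ck_compose[OF smoothD[OF smooth_cubic_rest] Ck_mult[OF Ck_ident Suc]])
    then have "Ck n h"
      unfolding h_def source_def
      by (rule Ck_diff[OF Ck_mult[OF Ck_const Suc] Ck_mult[OF Ck_const Ck_mult[OF Ck_power[OF Suc]]]])
    then have "Ck n (\<lambda>t. exp (- (c * t\<^sup>2 / 2)) * h t)"
      using Ck_mult[OF smoothD[OF smooth_gaussian[of "- c"]]] by simp
    then have "Ck n Q"
      unfolding Q_def A_def by (rule Ck_mult[OF smoothD[OF smooth_gaussian] Ck_avg])
    then show ?case by (rule Ck_realI[OF dv Ck_mult[OF Ck_ident]])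
  qed
  then have v: "smooth v" by (simp add: smooth_def)
  have dvQ: "deriv v = (\<lambda>r. r * Q r)" using DERIV_imp_deriv[OF dv] by auto
  note dv' = smooth_deriv(2)[OF v] and dv'' = smooth_deriv(2)[OF smooth_deriv(1)[OF v]]
  have ode: "8 * r ^ 7 * deriv v r - c * r ^ 9 * deriv v r + r ^ 8 * deriv (deriv v) r = r ^ 8 * h r" for r
  proof -
    let ?e = "\<lambda>r. exp (- (c * r\<^sup>2 / 2))"
    have "((\<lambda>r. r ^ Suc 8 * A r) has_field_derivative r ^ 8 * (?e r * h r)) (at r)"
      unfolding A_def by (rule avg_antiderivative[OF radial_inverse_continuous(1)[OF hcont]])
    moreover have "(\<lambda>r. r ^ Suc 8 * A r) = (\<lambda>r. r ^ 8 * ?e r * deriv v r)"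
      unfolding dvQ Q_def by (simp add: fun_eq_iff exp_minus power_numeral_reduce)
    moreover have "((\<lambda>r. r ^ 8 * ?e r * deriv v r) has_field_derivative
        ?e r * (8 * r ^ 7 * deriv v r - c * r ^ 9 * deriv v r + r ^ 8 * deriv (deriv v) r)) (at r)"
      by (rule derivative_eq_intros dv'' refl | simp)+ (simp add: algebra_simps power_numeral_reduce)
    ultimately have "?e r * (8 * r ^ 7 * deriv v r - c * r ^ 9 * deriv v r + r ^ 8 * deriv (deriv v) r)
        = r ^ 8 * (?e r * h r)"
      using DERIV_unique by fastforce
    then show ?thesis by simp
  qed
  define u where "u r = r * v r" for r
  have u: "smooth u" unfolding u_def by (intro smooth_mult smooth_ident v)
  have du: "deriv u = (\<lambda>r. v r + r * deriv v r)"
  proof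
    show "deriv u r = v r + r * deriv v r" for r
      unfolding u_def by (rule DERIV_imp_deriv) (rule derivative_eq_intros dv' refl | simp)+
  qed
  have ddu: "deriv (\<lambda>r. v r + r * deriv v r) r = 2 * deriv v r + r * deriv (deriv v) r" for r
    by (rule DERIV_imp_deriv) (rule derivative_eq_intros dv' dv'' refl | simp)+
  have "angle_equation c u"
    unfolding angle_equation_def du ddu
  proof
    fix r
    show "r\<^sup>2 * (2 * deriv v r + r * deriv (deriv v) r)
        + (6 - c * r\<^sup>2) * r * (v r + r * deriv v r) - 6 * sin (u r) = 0" (is "?X = 0")
    (* The relation ode carries the factor r^8, the equation for u only r^3;
       multiplication by r^5 brings them together. *)
    proof (cases "r = 0")
      case False
      have "r ^ 5 * ?X = (8 * r ^ 7 * deriv v r - c * r ^ 9 * deriv v r + r ^ 8 * deriv (deriv v) r)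
          - r ^ 5 * (c * r ^ 3 * v r - 6 * (r * v r - sin (r * v r)))"
        by (simp add: u_def algebra_simps power_numeral_reduce)
      also have "\<dots> = r ^ 8 * h r - r ^ 5 * (r ^ 3 * h r)"
        unfolding ode h_def source_mult_cube ..
      also have "\<dots> = 0" by (simp add: power_numeral_reduce)
      finally show ?thesis using False by simp
    qed (simp add: u_def)
  qed
  moreover have "deriv u 0 = \<beta>" by (simp add: du v_def)
  ultimately show ?thesis using that[OF u] by (simp add: u_def)
qed

section \<open>Solutions of the equation for the amplitude\<close>

text \<open>
The terms with \<open>(u')\<^sup>2\<close> cancel, and \<open>sin u = 2 sin (u/2) cos (u/2)\<close> turns the rest into \<open>cos (u/2)/(2 r\<^sup>2)\<close> times
the angle equation.
\<close>

lemma amplitude_equation: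
  assumes u: "smooth u" "angle_equation c u" and r: "r \<noteq> 0" "cos (u r / 2) \<noteq> 0"
  defines "a \<equiv> \<lambda>r. sin (u r / 2)"
  shows "deriv (deriv a) r + a r / (cos (u r / 2))\<^sup>2 * (deriv a r)\<^sup>2
      + (6 - c * r\<^sup>2) * (deriv a r / r) = 6 * ((cos (u r / 2))\<^sup>2 / r\<^sup>2) * a r"
proof -
  note d = smooth_deriv(2)[OF u(1)] and dd = smooth_deriv(2)[OF smooth_deriv(1)[OF u(1)]]
  have da: "deriv a = (\<lambda>r. cos (u r / 2) * deriv u r / 2)"
    unfolding a_def by (rule ext, rule DERIV_imp_deriv) (rule derivative_eq_intros d refl | simp)+
  have dda: "deriv (\<lambda>r. cos (u r / 2) * deriv u r / 2) r
      = cos (u r / 2) * deriv (deriv u) r / 2 - sin (u r / 2) * (deriv u r)\<^sup>2 / 4" for r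
    by (rule DERIV_imp_deriv) (rule derivative_eq_intros d dd refl | simp add: power2_eq_square)+
  have s: "sin (u r) = 2 * sin (u r / 2) * cos (u r / 2)" using sin_double[of "u r / 2"] by simp
  have "r\<^sup>2 * deriv (deriv u) r + (6 - c * r\<^sup>2) * r * deriv u r
      = 12 * sin (u r / 2) * cos (u r / 2)"
    using u(2) s unfolding angle_equation_def by (simp add: algebra_simps)
  then have "deriv (deriv u) r + (6 - c * r\<^sup>2) * (deriv u r / r)
      = 12 * sin (u r / 2) * cos (u r / 2) / r\<^sup>2"
    using r(1) by (simp add: field_simps power2_eq_square)
  then have e: "deriv (deriv u) r
      = 12 * sin (u r / 2) * cos (u r / 2) / r\<^sup>2 - (6 - c * r\<^sup>2) * (deriv u r / r)"
    by simp
  show ?thesis unfolding da dda e unfolding a_def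
    using r by (simp add: field_simps power2_eq_square)
qed

lemma global_solution_exists:
  obtains f a where "global_solution c f a" "a 0 = 0" "deriv a 0 = b"
proof -
  obtain u where u: "smooth u" "u 0 = 0" "deriv u 0 = 2 * b" "angle_equation c u"
    using angle_equation_exists[of "2 * b" c] by blast
  have odd: "odd_fun u" by (rule angle_equation_odd[OF u(1,4,2)])
  let ?a = "\<lambda>r. sin (u r / 2)" and ?f = "\<lambda>r. cos (u r / 2)"
  have sm: "smooth (\<lambda>r. u r / 2)" using smooth_mult[OF u(1) smooth_const[of "1/2"]] by simp
  have "global_solution c ?f ?a"
    unfolding global_solution_def
  proof (intro conjI exI[of _ u] allI impI)
    show "smooth ?a" by (rule smooth_sin[OF sm])
    show "odd_fun ?a" using odd by (simp add: odd_fun_def)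
    show "(?f r)\<^sup>2 = 1 - (?a r)\<^sup>2" for r by (simp add: cos_squared_eq)
  qed (use u odd amplitude_equation[OF u(1,4)] in \<open>auto simp: angle_equation_def\<close>)
  moreover have "deriv ?a 0 = b"
    by (rule DERIV_imp_deriv) (rule derivative_eq_intros smooth_deriv(2)[OF u(1)] refl | simp add: u)+
  ultimately show ?thesis using that[of ?f ?a] u(2) by simp
qed

lemma global_solutionE:
  assumes "global_solution c f a"
  obtains u where "smooth u" "odd_fun u" "u 0 = 0" "angle_equation c u" "deriv u 0 = 2 * deriv a 0"
    "a = (\<lambda>r. sin (u r / 2))" "f = (\<lambda>r. cos (u r / 2))"
proof -
  obtain u where u: "smooth u" "odd_fun u" "\<And>r. a r = sin (u r / 2) \<and> f r = cos (u r / 2)"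
    "angle_equation c u"
    using assms unfolding global_solution_def angle_equation_def by blast
  have u0: "u 0 = 0" using u(2) unfolding odd_fun_def by (metis add.inverse_neutral equal_neg_zero)
  have a: "a = (\<lambda>r. sin (u r / 2))" and f: "f = (\<lambda>r. cos (u r / 2))" using u(3) by auto
  have "deriv a 0 = deriv u 0 / 2"
    unfolding a
    by (rule DERIV_imp_deriv) (rule derivative_eq_intros smooth_deriv(2)[OF u(1)] refl | simp add: u0)+
  then show ?thesis using that[OF u(1,2) u0 u(4) _ a f] by simp
qed

text \<open>
The angle of a solution starts at \<open>0\<close> with slope \<open>2 a'(0)\<close>, so the angles agree even though \<open>a\<close> determines its
angle only up to reflection and periods.
\<close>

lemma global_solution_unique:
  assumes "global_solution c f a" "global_solution c g d" "deriv a 0 = deriv d 0"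
  shows "f = g \<and> a = d"
proof -
  obtain u where u: "smooth u" "odd_fun u" "u 0 = 0" "angle_equation c u" "deriv u 0 = 2 * deriv a 0"
    "a = (\<lambda>r. sin (u r / 2))" "f = (\<lambda>r. cos (u r / 2))"
    using global_solutionE[OF assms(1)] .
  obtain w where w: "smooth w" "odd_fun w" "w 0 = 0" "angle_equation c w" "deriv w 0 = 2 * deriv d 0"
    "d = (\<lambda>r. sin (w r / 2))" "g = (\<lambda>r. cos (w r / 2))"
    using global_solutionE[OF assms(2)] .
  have *: "u r = w r" if "0 \<le> r" for r
    by (rule angle_equation_unique[OF u(1,4) w(1,4)]) (use u w assms(3) that in auto)
  have "u r = w r" for r
    using *[of r] *[of "- r"] u(2) w(2) unfolding odd_fun_def by (cases "0 \<le> r") auto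
  then show ?thesis using u w by auto
qed

section \<open>The index type of \<open>\<real>\<^sup>7\<close>\<close>

lemma exhaust_7: "x = 1 \<or> x = 2 \<or> x = 3 \<or> x = 4 \<or> x = 5 \<or> x = 6 \<or> x = 7" for x :: 7
proof (induct x)
  case (of_int z)
  then have "0 \<le> z" and "z < 7" by simp_all
  then have "z = 0 \<or> z = 1 \<or> z = 2 \<or> z = 3 \<or> z = 4 \<or> z = 5 \<or> z = 6" by arith
  then show ?case by auto
qed

lemma UNIV_7: "UNIV = {1, 2, 3, 4, 5, 6, 7 :: 7}"
  using exhaust_7 by auto

lemma forall_7: "(\<forall>i::7. P i) \<longleftrightarrow> P 1 \<and> P 2 \<and> P 3 \<and> P 4 \<and> P 5 \<and> P 6 \<and> P 7"
  by (metis exhaust_7)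

lemma sum_7: "sum f (UNIV :: 7 set) = f 1 + f 2 + f 3 + f 4 + f 5 + f 6 + f 7"
  unfolding UNIV_7 by (simp add: ac_simps)

lemma vector_7:
  "(vector [a, b, c, d, e, f, g] :: 'a::zero ^ 7) $ 1 = a"
  "(vector [a, b, c, d, e, f, g] :: 'a ^ 7) $ 2 = b"
  "(vector [a, b, c, d, e, f, g] :: 'a ^ 7) $ 3 = c"
  "(vector [a, b, c, d, e, f, g] :: 'a ^ 7) $ 4 = d"
  "(vector [a, b, c, d, e, f, g] :: 'a ^ 7) $ 5 = e"
  "(vector [a, b, c, d, e, f, g] :: 'a ^ 7) $ 6 = f"
  "(vector [a, b, c, d, e, f, g] :: 'a ^ 7) $ 7 = g"
  by (simp_all add: vector_def)

lemma phi0_swap: "phi0 j i k = - phi0 i j k" "phi0 i k j = - phi0 i j k"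
  unfolding phi0_def e3_def det_3 vector_3 by (simp_all add: algebra_simps)

section \<open>The cross product\<close>

text \<open>
The product with \<open>\<langle>x \<times> y, z\<rangle> = \<phi>\<^sub>0(x, y, z)\<close>, that is, the imaginary part of the product of imaginary
octonions.
\<close>

definition cross7 :: "vec7 \<Rightarrow> vec7 \<Rightarrow> vec7" where
  "cross7 x y = (\<chi> k. \<Sum>i\<in>UNIV. \<Sum>j\<in>UNIV. phi0 i j k * x $ i * y $ j)"

lemma cross7_component:
  "cross7 x y $ 1 = x $ 2 * y $ 3 - x $ 3 * y $ 2 + x $ 7 * y $ 6 - x $ 6 * y $ 7 + x $ 4 * y $ 5 - x $ 5 * y $ 4"
  "cross7 x y $ 2 = x $ 3 * y $ 1 - x $ 1 * y $ 3 + x $ 5 * y $ 7 - x $ 7 * y $ 5 + x $ 4 * y $ 6 - x $ 6 * y $ 4"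
  "cross7 x y $ 3 = x $ 1 * y $ 2 - x $ 2 * y $ 1 + x $ 6 * y $ 5 - x $ 5 * y $ 6 + x $ 4 * y $ 7 - x $ 7 * y $ 4"
  "cross7 x y $ 4 = x $ 5 * y $ 1 - x $ 1 * y $ 5 + x $ 6 * y $ 2 - x $ 2 * y $ 6 + x $ 7 * y $ 3 - x $ 3 * y $ 7"
  "cross7 x y $ 5 = x $ 7 * y $ 2 - x $ 2 * y $ 7 + x $ 3 * y $ 6 - x $ 6 * y $ 3 + x $ 1 * y $ 4 - x $ 4 * y $ 1"
  "cross7 x y $ 6 = x $ 1 * y $ 7 - x $ 7 * y $ 1 + x $ 5 * y $ 3 - x $ 3 * y $ 5 + x $ 2 * y $ 4 - x $ 4 * y $ 2"
  "cross7 x y $ 7 = x $ 6 * y $ 1 - x $ 1 * y $ 6 + x $ 2 * y $ 5 - x $ 5 * y $ 2 + x $ 3 * y $ 4 - x $ 4 * y $ 3"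
  by (simp_all add: cross7_def sum_7 phi0_def e3_def det_3)

lemma cross7_axis: "cross7 (axis i 1) (axis j 1) $ k = phi0 i j k"
  by (simp add: cross7_def axis_def mult_delta_right mult_delta_left)

lemma cross7_axis_table:
  "cross7 (axis 1 1) (axis 2 1) = axis 3 1" "cross7 (axis 1 1) (axis 3 1) = - axis 2 1"
  "cross7 (axis 1 1) (axis 4 1) = axis 5 1" "cross7 (axis 1 1) (axis 5 1) = - axis 4 1"
  "cross7 (axis 1 1) (axis 6 1) = - axis 7 1" "cross7 (axis 1 1) (axis 7 1) = axis 6 1"
  "cross7 (axis 2 1) (axis 3 1) = axis 1 1" "cross7 (axis 2 1) (axis 4 1) = axis 6 1"
  "cross7 (axis 2 1) (axis 5 1) = axis 7 1" "cross7 (axis 2 1) (axis 6 1) = - axis 4 1"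
  "cross7 (axis 2 1) (axis 7 1) = - axis 5 1" "cross7 (axis 3 1) (axis 4 1) = axis 7 1"
  "cross7 (axis 3 1) (axis 5 1) = - axis 6 1" "cross7 (axis 3 1) (axis 6 1) = axis 5 1"
  "cross7 (axis 3 1) (axis 7 1) = - axis 4 1" "cross7 (axis 4 1) (axis 5 1) = axis 1 1"
  "cross7 (axis 4 1) (axis 6 1) = axis 2 1" "cross7 (axis 4 1) (axis 7 1) = axis 3 1"
  "cross7 (axis 5 1) (axis 6 1) = - axis 3 1" "cross7 (axis 5 1) (axis 7 1) = axis 2 1"
  "cross7 (axis 6 1) (axis 7 1) = - axis 1 1"
  by (simp_all add: vec_eq_iff forall_7 cross7_component axis_def)

lemma cross7_bilinear:
  "cross7 (x + x') y = cross7 x y + cross7 x' y" "cross7 x (y + y') = cross7 x y + cross7 x y'"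
  "cross7 (t *\<^sub>R x) y = t *\<^sub>R cross7 x y" "cross7 x (t *\<^sub>R y) = t *\<^sub>R cross7 x y"
  by (simp_all add: vec_eq_iff forall_7 cross7_component algebra_simps)

lemma cross7_swap: "cross7 y x = - cross7 x y"
  by (simp add: vec_eq_iff forall_7 cross7_component algebra_simps)

lemma inner_cross7_swap: "cross7 x z \<bullet> y = - (cross7 x y \<bullet> z)"
  by (simp add: inner_vec_def sum_7 cross7_component algebra_simps)

text \<open>
Octonions form a composition algebra. This identity and the antisymmetry of \<open>\<phi>\<^sub>0\<close> are the only facts about the
coefficients of \<open>\<phi>\<^sub>0\<close> behind all tensor identities below; the table of products is needed once more, for
the signs in the Hodge star of \<open>\<phi>\<^sub>0\<close>.
\<close>

lemma cross7_norm: "cross7 x y \<bullet> cross7 x y = (x \<bullet> x) * (y \<bullet> y) - (x \<bullet> y) * (x \<bullet> y)"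
  by (simp add: inner_vec_def sum_7 cross7_component algebra_simps)

lemma cross7_polarised1:
  "cross7 x y \<bullet> cross7 x z = (x \<bullet> x) * (y \<bullet> z) - (x \<bullet> y) * (x \<bullet> z)"
  using cross7_norm[of x "y + z"] cross7_norm[of x y] cross7_norm[of x z]
    inner_commute[of "cross7 x z" "cross7 x y"] inner_commute[of z y]
  by (simp add: cross7_bilinear inner_add_left inner_add_right algebra_simps)

lemma cross7_polarised2:
  "cross7 a b \<bullet> cross7 c d + cross7 c b \<bullet> cross7 a d
    = 2 * (a \<bullet> c) * (b \<bullet> d) - (a \<bullet> b) * (c \<bullet> d) - (c \<bullet> b) * (a \<bullet> d)"
  using cross7_polarised1[of "a + c" b d] cross7_polarised1[of a b d] cross7_polarised1[of c b d]
    inner_commute[of c a]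
  by (simp add: cross7_bilinear inner_add_left inner_add_right algebra_simps)

text \<open>
The 4-form \<open>\<psi>\<^sub>0\<close> on vectors, defined by the contraction identity
\<open>\<phi>\<^sub>i\<^sub>j\<^sub>k \<phi>\<^sub>a\<^sub>b\<^sub>k = \<delta>\<^sub>i\<^sub>a \<delta>\<^sub>j\<^sub>b - \<delta>\<^sub>i\<^sub>b \<delta>\<^sub>j\<^sub>a - \<psi>\<^sub>i\<^sub>j\<^sub>a\<^sub>b\<close>. That it is the Hodge dual of \<open>\<phi>\<^sub>0\<close> is \<open>hodge3_phi0\<close> below.
\<close>

definition Psi :: "vec7 \<Rightarrow> vec7 \<Rightarrow> vec7 \<Rightarrow> vec7 \<Rightarrow> real" where
  "Psi a b c d = (a \<bullet> c) * (b \<bullet> d) - (a \<bullet> d) * (b \<bullet> c) - cross7 a b \<bullet> cross7 c d"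

text \<open>
Only the transposition of the two middle arguments is not obvious; it is the polarised norm identity.
\<close>

lemma Psi_swap:
  "Psi b a c d = - Psi a b c d" "Psi a c b d = - Psi a b c d" "Psi a b d c = - Psi a b c d"
proof -
  show "Psi b a c d = - Psi a b c d"
    unfolding Psi_def cross7_swap[of a b] by (simp add: algebra_simps)
  show "Psi a b d c = - Psi a b c d"
    unfolding Psi_def cross7_swap[of c d] by (simp add: algebra_simps)
  show "Psi a c b d = - Psi a b c d"
    using cross7_polarised2[of b a c d]
    unfolding Psi_def cross7_swap[of a b] cross7_swap[of a c]
    by (simp add: inner_commute[of b a] inner_commute[of c a] inner_commute[of c b] algebra_simps)
qed

lemma Psi_linear: "linear (\<lambda>a. Psi a b c d)"
  by (simp add: linear_iff Psi_def cross7_bilinear inner_add_left algebra_simps)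

lemma cross7_cyclic: "cross7 b c \<bullet> a = cross7 a b \<bullet> c"
  using inner_cross7_swap[of b a c] cross7_swap[of b a] by simp

text \<open>
The contraction of \<open>\<phi>\<^sub>0\<close> with \<open>\<psi>\<^sub>0\<close>. The relation \<open>R\<close> expresses \<open>\<psi>(a \<times> b, c, d, e) + \<psi>(d \<times> e, c, a, b)\<close> by
products of \<open>\<phi>\<^sub>0\<close> and the metric. It links pairs of arguments that are disjoint, and \<open>ab, de, bc, ea, cd\<close> is a
cycle of odd length of such pairs. The alternating sum around the cycle leaves \<open>2 \<psi>(a \<times> b, c, d, e)\<close>.
\<close>

lemma Psi_cross7:
  "Psi (cross7 a b) c d e
    = - ((a \<bullet> c) * (cross7 b d \<bullet> e) + (a \<bullet> d) * (cross7 b e \<bullet> c) + (a \<bullet> e) * (cross7 b c \<bullet> d)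
       - (b \<bullet> c) * (cross7 a d \<bullet> e) - (b \<bullet> d) * (cross7 a e \<bullet> c) - (b \<bullet> e) * (cross7 a c \<bullet> d))"
proof -
  have R: "Psi (cross7 a b) c d e + Psi (cross7 d e) c a b
      = (cross7 a b \<bullet> d) * (c \<bullet> e) - (cross7 a b \<bullet> e) * (c \<bullet> d)
        + (cross7 d e \<bullet> a) * (c \<bullet> b) - (cross7 d e \<bullet> b) * (c \<bullet> a)" for a b c d e
    using inner_cross7_swap[of "cross7 a b" c "cross7 d e"] cross7_swap[of "cross7 a b" "cross7 d e"]
      cross7_swap[of "cross7 d e" c] inner_cross7_swap[of "cross7 d e" "cross7 a b" c]
    unfolding Psi_def by (simp add: algebra_simps inner_commute)
  have cyc: "Psi p d e c = Psi p c d e" for p c d e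
    using Psi_swap(2)[of p d c e] Psi_swap(3)[of p d c e] by simp
  note inner = inner_commute[of b a] inner_commute[of c a] inner_commute[of d a] inner_commute[of e a]
    inner_commute[of c b] inner_commute[of d b] inner_commute[of e b] inner_commute[of d c]
    inner_commute[of e c] inner_commute[of e d]
  have triple: "cross7 d e \<bullet> a = cross7 a d \<bullet> e" "cross7 d e \<bullet> b = cross7 b d \<bullet> e"
    "cross7 d e \<bullet> c = cross7 c d \<bullet> e" "cross7 b c \<bullet> a = cross7 a b \<bullet> c" "cross7 e a \<bullet> b = cross7 a b \<bullet> e"
    "cross7 e a \<bullet> c = cross7 a c \<bullet> e" "cross7 e a \<bullet> d = cross7 a d \<bullet> e" "cross7 c d \<bullet> a = cross7 a c \<bullet> d"
    "cross7 c d \<bullet> b = cross7 b c \<bullet> d" "cross7 b e \<bullet> c = - (cross7 b c \<bullet> e)"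
    "cross7 a e \<bullet> c = - (cross7 a c \<bullet> e)"
    by (metis cross7_cyclic inner_cross7_swap)+
  note perm = cyc[of "cross7 d e" a b c] cyc[of "cross7 b c" d e a] cyc[of "cross7 e a" b c d]
    cyc[of "cross7 c d" e a b] cyc[of "cross7 a b" c d e]
  show ?thesis
    using R[of a b c d e] R[of d e a b c] R[of b c d e a] R[of e a b c d] R[of c d e a b] perm
    unfolding inner triple mult_minus_right by (simp only: algebra_simps)
qed

section \<open>The Hodge star\<close>

definition alt3 :: "form3 \<Rightarrow> bool" where
  "alt3 \<omega> \<longleftrightarrow> (\<forall>i j k. \<omega> j i k = - \<omega> i j k \<and> \<omega> i k j = - \<omega> i j k)"

definition alt4 :: "form4 \<Rightarrow> bool" where
  "alt4 \<omega> \<longleftrightarrow> (\<forall>i j k l. \<omega> j i k l = - \<omega> i j k l \<and> \<omega> i k j l = - \<omega> i j k l \<and> \<omega> i j l k = - \<omega> i j k l)"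

definition wedge13 :: "vec7 \<Rightarrow> form3 \<Rightarrow> form4" where
  "wedge13 v \<omega> i j k l = v $ i * \<omega> j k l - v $ j * \<omega> i k l + v $ k * \<omega> i j l - v $ l * \<omega> i j k"

lemma det_swap_rows:
  fixes A :: "real^'n^'n"
  assumes "p \<noteq> q"
  shows "det (\<chi> r. A $ Transposition.transpose p q r) = - det A"
  using det_permute_rows[OF permutes_swap_id[of p UNIV q], of A] assms by (simp add: sign_swap_id)

lemma eps7_swap:
  "eps7 b a c i j k l = - eps7 a b c i j k l"
  "eps7 a c b i j k l = - eps7 a b c i j k l"
  "eps7 a b i c j k l = - eps7 a b c i j k l"
  "eps7 a b c j i k l = - eps7 a b c i j k l"
  "eps7 a b c i k j l = - eps7 a b c i j k l"
  "eps7 a b c i j l k = - eps7 a b c i j k l"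
proof -
  have *: "det (vector ys :: real^7^7) = - det (vector xs :: real^7^7)"
    if "p \<noteq> q" "\<forall>r. (vector ys :: real^7^7) $ r = (vector xs :: real^7^7) $ Transposition.transpose p q r"
    for p q :: 7 and xs ys
  proof -
    have "(vector ys :: real^7^7) = (\<chi> r. vector xs $ Transposition.transpose p q r)"
      using that(2) by (simp add: vec_eq_iff)
    then show ?thesis using det_swap_rows[OF that(1), of "vector xs"] by simp
  qed
  show "eps7 b a c i j k l = - eps7 a b c i j k l"
    unfolding eps7_def by (rule *[of 1 2]) (simp_all add: forall_7 vector_7 transpose_def)
  show "eps7 a c b i j k l = - eps7 a b c i j k l"
    unfolding eps7_def by (rule *[of 2 3]) (simp_all add: forall_7 vector_7 transpose_def)
  show "eps7 a b i c j k l = - eps7 a b c i j k l"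
    unfolding eps7_def by (rule *[of 3 4]) (simp_all add: forall_7 vector_7 transpose_def)
  show "eps7 a b c j i k l = - eps7 a b c i j k l"
    unfolding eps7_def by (rule *[of 4 5]) (simp_all add: forall_7 vector_7 transpose_def)
  show "eps7 a b c i k j l = - eps7 a b c i j k l"
    unfolding eps7_def by (rule *[of 5 6]) (simp_all add: forall_7 vector_7 transpose_def)
  show "eps7 a b c i j l k = - eps7 a b c i j k l"
    unfolding eps7_def by (rule *[of 6 7]) (simp_all add: forall_7 vector_7 transpose_def)
qed

lemma eps7_not_distinct:
  assumes "\<not> distinct [a, b, c, i, j, k, l]"
  shows "eps7 a b c i j k l = 0"
proof -
  let ?A = "vector [axis a 1, axis b 1, axis c 1, axis i 1, axis j 1, axis k 1, axis l 1] :: real^7^7"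
  have "\<exists>r s. r \<noteq> s \<and> ?A $ r = ?A $ s"
  proof (rule ccontr)
    assume "\<not> ?thesis"
    then have "\<forall>r s. r = s \<or> ?A $ r \<noteq> ?A $ s" by blast
    then have "distinct [a, b, c, i, j, k, l]"
      unfolding forall_7 vector_7 by (simp add: axis_eq_axis)
    with assms show False by contradiction
  qed
  then obtain r s where "r \<noteq> s" "?A $ r = ?A $ s" by blast
  then show ?thesis unfolding eps7_def by (intro det_identical_rows[of r s]) (simp_all add: row_def vec_eq_iff)
qed

lemma eps7_square:
  assumes "distinct [a, b, c, i, j, k, l]"
  shows "eps7 a b c i j k l * eps7 a b c i j k l = 1"
proof -
  let ?A = "vector [axis a 1, axis b 1, axis c 1, axis i 1, axis j 1, axis k 1, axis l 1] :: real^7^7"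
  have row: "row r ?A = ?A $ r" for r by (simp add: row_def vec_eq_iff)
  have "distinct (rev [a, b, c, i, j, k, l])" using assms by (simp only: distinct_rev)
  then have d: "l \<noteq> k \<and> l \<noteq> j \<and> l \<noteq> i \<and> l \<noteq> c \<and> l \<noteq> b \<and> l \<noteq> a \<and> k \<noteq> j \<and> k \<noteq> i \<and> k \<noteq> c
      \<and> k \<noteq> b \<and> k \<noteq> a \<and> j \<noteq> i \<and> j \<noteq> c \<and> j \<noteq> b \<and> j \<noteq> a \<and> i \<noteq> c \<and> i \<noteq> b \<and> i \<noteq> a
      \<and> c \<noteq> b \<and> c \<noteq> a \<and> b \<noteq> a"
    by simp
  have "orthogonal_matrix ?A"
    unfolding orthogonal_matrix_orthonormal_rows row forall_7 vector_7
    using assms d by (simp add: orthogonal_def inner_axis_axis norm_axis_1)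
  then show ?thesis unfolding eps7_def using det_orthogonal_matrix by fastforce
qed

lemma eps7_identity: "eps7 1 2 3 4 5 6 7 = 1"
proof -
  have "(vector [axis 1 1, axis 2 1, axis 3 1, axis 4 1, axis 5 1, axis 6 1, axis 7 1] :: real^7^7) = mat 1"
    by (simp add: vec_eq_iff forall_7 vector_7 mat_def axis_def)
  then show ?thesis by (simp add: eps7_def)
qed

text \<open>
The transposition rules oriented by the order of natural numbers: for indices given as \<open>p n\<close>
they rewrite every arrangement to the increasing one and terminate.
\<close>

lemma eps7_sort:
  fixes p :: "nat \<Rightarrow> 7"
  shows
  "n1 < n0 \<Longrightarrow> eps7 (p n0) (p n1) c i j k l = - eps7 (p n1) (p n0) c i j k l"
  "n1 < n0 \<Longrightarrow> eps7 a (p n0) (p n1) i j k l = - eps7 a (p n1) (p n0) i j k l"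
  "n1 < n0 \<Longrightarrow> eps7 a b (p n0) (p n1) j k l = - eps7 a b (p n1) (p n0) j k l"
  "n1 < n0 \<Longrightarrow> eps7 a b c (p n0) (p n1) k l = - eps7 a b c (p n1) (p n0) k l"
  "n1 < n0 \<Longrightarrow> eps7 a b c i (p n0) (p n1) l = - eps7 a b c i (p n1) (p n0) l"
  "n1 < n0 \<Longrightarrow> eps7 a b c i j (p n0) (p n1) = - eps7 a b c i j (p n1) (p n0)"
  by (rule eps7_swap)+

lemma alt3_sort:
  fixes p :: "nat \<Rightarrow> 7"
  assumes "alt3 \<omega>"
  shows "n1 < n0 \<Longrightarrow> \<omega> (p n0) (p n1) k = - \<omega> (p n1) (p n0) k"
    "n1 < n0 \<Longrightarrow> \<omega> i (p n0) (p n1) = - \<omega> i (p n1) (p n0)"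
  using assms unfolding alt3_def by blast+

lemma alt3_repeat:
  assumes "alt3 \<omega>"
  shows "\<omega> i i k = 0" "\<omega> i k k = 0" "\<omega> i k i = 0"
proof -
  show 1: "\<omega> i i k = 0" and "\<omega> i k k = 0" for i k
    using assms unfolding alt3_def by (metis equal_neg_zero)+
  show "\<omega> i k i = 0"
    using assms 1[of i k] unfolding alt3_def by (metis neg_equal_0_iff_equal)
qed

lemma alt4_repeat:
  assumes "alt4 \<omega>" "\<not> distinct [i, j, k, l]"
  shows "\<omega> i j k l = 0"
proof -
  have "\<omega> i i k l = 0" "\<omega> i k k l = 0" "\<omega> i k l l = 0" for i k l
    using assms(1) unfolding alt4_def by (metis equal_neg_zero)+
  moreover have "\<omega> i j k l = - \<omega> i k j l" "\<omega> i j k l = - \<omega> i j l k" "\<omega> i k j l = - \<omega> i k l j"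
      "\<omega> i j l k = - \<omega> i l j k"
    using assms(1) unfolding alt4_def by metis+
  ultimately show ?thesis using assms(2) by auto
qed

lemma hodge3_alt4: "alt4 (hodge3 \<omega>)"
  unfolding alt4_def
proof (intro allI conjI)
  fix i j k l
  show "hodge3 \<omega> j i k l = - hodge3 \<omega> i j k l"
    by (simp add: hodge3_def eps7_swap(4)[of _ _ _ j i] sum_negf)
  show "hodge3 \<omega> i k j l = - hodge3 \<omega> i j k l"
    by (simp add: hodge3_def eps7_swap(5)[of _ _ _ i k j] sum_negf)
  show "hodge3 \<omega> i j l k = - hodge3 \<omega> i j k l"
    by (simp add: hodge3_def eps7_swap(6)[of _ _ _ i j l k] sum_negf)
qed

text \<open>
An enumeration of all seven indices. Naming the indices \<open>p 0, \<dots>, p 6\<close> makes signs of permutations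
computable by \<open>eps7_sort\<close>.
\<close>

definition enumerates :: "(nat \<Rightarrow> 7) \<Rightarrow> bool" where
  "enumerates p \<longleftrightarrow> inj_on p {..<7}"

lemma enumerates_eq_iff:
  assumes "enumerates p" "m < 7" "n < 7"
  shows "p m = p n \<longleftrightarrow> m = n"
  using assms by (auto simp: enumerates_def inj_on_eq_iff)

lemma enumerates_distinct:
  assumes "enumerates p"
  shows "distinct [p 0, p 1, p 2, p 3, p 4, p 5, p 6]"
  by (simp add: enumerates_eq_iff[OF assms])

lemma lessThan_7: "{..<7} = {0, 1, 2, 3, 4, 5, 6 :: nat}"
  by auto

lemma enumerates_sum:
  assumes "enumerates p"
  shows "sum f UNIV = f (p 0) + f (p 1) + f (p 2) + f (p 3) + f (p 4) + f (p 5) + f (p 6)"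
proof -
  have inj: "inj_on p {..<7}" using assms by (simp add: enumerates_def)
  then have "p ` {..<7} = UNIV"
    by (intro card_subset_eq) (simp_all add: card_image)
  then have "sum f UNIV = sum f (p ` {..<7})" by simp
  also have "\<dots> = (\<Sum>n<7. f (p n))" using sum.reindex[OF inj, of f] by simp
  finally show ?thesis unfolding lessThan_7 by (simp add: add.assoc)
qed

text \<open>
Of the \<open>343\<close> terms only the six arrangements of the complementary triple survive; they are equal and cancel
the factor \<open>1/6\<close>.
\<close>

lemma hodge3_distinct:
  assumes \<omega>: "alt3 \<omega>" and d: "distinct [a, b, c, i, j, k, l]"
  shows "hodge3 \<omega> i j k l = \<omega> a b c * eps7 a b c i j k l"
proof -
  have p: "enumerates (\<lambda>n. [a, b, c, i, j, k, l] ! n)"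
    unfolding enumerates_def using inj_on_nth[OF d] by simp
  have S: "sum f UNIV = f a + f b + f c + f i + f j + f k + f l" for f :: "7 \<Rightarrow> real"
    using enumerates_sum[OF p, of f] by simp
  have w: "\<omega> a c b = - \<omega> a b c" "\<omega> b a c = - \<omega> a b c" "\<omega> b c a = \<omega> a b c" "\<omega> c a b = \<omega> a b c"
      "\<omega> c b a = - \<omega> a b c"
    using \<omega> unfolding alt3_def by (metis minus_minus)+
  have e: "eps7 a c b i j k l = - eps7 a b c i j k l" "eps7 b a c i j k l = - eps7 a b c i j k l"
      "eps7 b c a i j k l = eps7 a b c i j k l" "eps7 c a b i j k l = eps7 a b c i j k l"
      "eps7 c b a i j k l = - eps7 a b c i j k l"
    using eps7_swap(1,2) by (metis minus_minus)+
  show ?thesis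
    unfolding hodge3_def S using d by (simp add: eps7_not_distinct w e)
qed

lemma enumerate_distinct:
  assumes "distinct [i, j, k, l]"
  obtains p where "enumerates p" "p 3 = i" "p 4 = j" "p 5 = k" "p 6 = l"
proof -
  have "card (UNIV - set [i, j, k, l]) = 3"
    using distinct_card[OF assms] by (subst card_Diff_subset) auto
  then obtain a b c where abc: "UNIV - set [i, j, k, l] = {a, b, c}" "a \<noteq> b" "b \<noteq> c" "a \<noteq> c"
    by (auto simp: card_3_iff)
  have "{a, b, c} \<inter> set [i, j, k, l] = {}" using abc(1) by blast
  then have "distinct [a, b, c, i, j, k, l]" using abc assms by auto
  then have "enumerates (\<lambda>n. [a, b, c, i, j, k, l] ! n)"
    unfolding enumerates_def using inj_on_nth[of "[a, b, c, i, j, k, l]" "{..<7}"] by simp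
  then show ?thesis by (rule that) simp_all
qed

lemma form4_eqI:
  assumes "alt4 F" "alt4 H"
    and "\<And>p. enumerates p \<Longrightarrow> F (p 3) (p 4) (p 5) (p 6) = H (p 3) (p 4) (p 5) (p 6)"
  shows "F i j k l = H i j k l"
proof (cases "distinct [i, j, k, l]")
  case True
  then show ?thesis using assms(3) enumerate_distinct by metis
next
  case False
  then show ?thesis using alt4_repeat assms(1,2) by metis
qed

lemma wedge13_alt4:
  assumes "alt3 \<omega>"
  shows "alt4 (wedge13 v \<omega>)"
proof -
  have w: "\<omega> j i k = - \<omega> i j k" "\<omega> i k j = - \<omega> i j k" for i j k
    using assms unfolding alt3_def by blast+
  show ?thesis
    unfolding alt4_def wedge13_def
  proof (intro allI conjI)
    fix i j k l
    show "v $ j * \<omega> i k l - v $ i * \<omega> j k l + v $ k * \<omega> j i l - v $ l * \<omega> j i k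
        = - (v $ i * \<omega> j k l - v $ j * \<omega> i k l + v $ k * \<omega> i j l - v $ l * \<omega> i j k)"
      by (simp add: w(1)[of j i])
    show "v $ i * \<omega> k j l - v $ k * \<omega> i j l + v $ j * \<omega> i k l - v $ l * \<omega> i k j
        = - (v $ i * \<omega> j k l - v $ j * \<omega> i k l + v $ k * \<omega> i j l - v $ l * \<omega> i j k)"
      by (simp add: w(1)[of k j l] w(2)[of i k j])
    show "v $ i * \<omega> j l k - v $ j * \<omega> i l k + v $ l * \<omega> i j k - v $ k * \<omega> i j l
        = - (v $ i * \<omega> j k l - v $ j * \<omega> i k l + v $ k * \<omega> i j l - v $ l * \<omega> i j k)"
      by (simp add: w(2)[of _ l k])
  qed
qed

lemma interior4_alt3:
  assumes "alt4 \<omega>"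
  shows "alt3 (interior4 v \<omega>)"
proof -
  have w: "\<omega> m j i k = - \<omega> m i j k" "\<omega> m i k j = - \<omega> m i j k" for m i j k
    using assms unfolding alt4_def by blast+
  have "interior4 v \<omega> j i k = - interior4 v \<omega> i j k" for i j k
    by (simp add: interior4_def w(1)[of _ i j k] sum_negf)
  moreover have "interior4 v \<omega> i k j = - interior4 v \<omega> i j k" for i j k
    by (simp add: interior4_def w(2)[of _ i j k] sum_negf)
  ultimately show ?thesis unfolding alt3_def by blast
qed

lemma wedge12_alt3:
  assumes "alt3 \<omega>"
  shows "alt3 (wedge12 v (interior3 v \<omega>))"
proof -
  have w: "\<omega> m k j = - \<omega> m j k" for m j k using assms unfolding alt3_def by blast
  have P: "interior3 v \<omega> k j = - interior3 v \<omega> j k" for j k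
    by (simp add: interior3_def w[of _ k j] sum_negf)
  have "wedge12 v (interior3 v \<omega>) j i k = - wedge12 v (interior3 v \<omega>) i j k"
    "wedge12 v (interior3 v \<omega>) i k j = - wedge12 v (interior3 v \<omega>) i j k" for i j k
    using P[of i j] P[of j k] P[of i k] by (simp_all add: wedge12_def)
  then show ?thesis unfolding alt3_def by blast
qed

lemma alt4_lincomb: "alt4 F \<Longrightarrow> alt4 H \<Longrightarrow> alt4 (\<lambda>i j k l. s * F i j k l + t * H i j k l)"
  unfolding alt4_def
proof (intro allI conjI)
  fix i j k l
  assume F: "\<forall>i j k l. F j i k l = - F i j k l \<and> F i k j l = - F i j k l \<and> F i j l k = - F i j k l"
    and H: "\<forall>i j k l. H j i k l = - H i j k l \<and> H i k j l = - H i j k l \<and> H i j l k = - H i j k l"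
  have F': "F j i k l = - F i j k l" "F i k j l = - F i j k l" "F i j l k = - F i j k l" using F by blast+
  have H': "H j i k l = - H i j k l" "H i k j l = - H i j k l" "H i j l k = - H i j k l" using H by blast+
  show "s * F j i k l + t * H j i k l = - (s * F i j k l + t * H i j k l)"
    "s * F i k j l + t * H i k j l = - (s * F i j k l + t * H i j k l)"
    "s * F i j l k + t * H i j l k = - (s * F i j k l + t * H i j k l)"
    unfolding F' H' by simp_all
qed

text \<open>
The identity \<open>\<star>(\<iota>(v)\<star>\<omega>) = - v\<and>\<omega>\<close>. On complementary indices \<open>(abc|ijkl)\<close> the left-hand side picks from \<open>v\<close> the
components \<open>i, j, k, l\<close>, and the two Levi-Civita symbols in each term agree up to the sign of a rearrangement,
so that their product is that sign.
\<close>

lemma hodge3_interior4: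
  assumes \<omega>: "alt3 \<omega>"
  shows "hodge3 (interior4 v (hodge3 \<omega>)) i j k l = - wedge13 v \<omega> i j k l"
proof -
  have "hodge3 (interior4 v (hodge3 \<omega>)) i j k l = (-1) * wedge13 v \<omega> i j k l + 0 * wedge13 v \<omega> i j k l"
  proof (rule form4_eqI[OF hodge3_alt4 alt4_lincomb[OF wedge13_alt4[OF \<omega>] wedge13_alt4[OF \<omega>]]])
    fix p assume p: "enumerates p"
    note D = enumerates_distinct[OF p]
    let ?e = "eps7 (p 0) (p 1) (p 2) (p 3) (p 4) (p 5) (p 6)"
    have H: "hodge3 \<omega> (p 3) (p 0) (p 1) (p 2) = \<omega> (p 4) (p 5) (p 6) * eps7 (p 4) (p 5) (p 6) (p 3) (p 0) (p 1) (p 2)"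
      "hodge3 \<omega> (p 4) (p 0) (p 1) (p 2) = \<omega> (p 3) (p 5) (p 6) * eps7 (p 3) (p 5) (p 6) (p 4) (p 0) (p 1) (p 2)"
      "hodge3 \<omega> (p 5) (p 0) (p 1) (p 2) = \<omega> (p 3) (p 4) (p 6) * eps7 (p 3) (p 4) (p 6) (p 5) (p 0) (p 1) (p 2)"
      "hodge3 \<omega> (p 6) (p 0) (p 1) (p 2) = \<omega> (p 3) (p 4) (p 5) * eps7 (p 3) (p 4) (p 5) (p 6) (p 0) (p 1) (p 2)"
      by (rule hodge3_distinct[OF \<omega>]; simp add: enumerates_eq_iff[OF p])+
    have Z: "hodge3 \<omega> (p 0) (p 0) (p 1) (p 2) = 0" "hodge3 \<omega> (p 1) (p 0) (p 1) (p 2) = 0"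
      "hodge3 \<omega> (p 2) (p 0) (p 1) (p 2) = 0"
      by (rule alt4_repeat[OF hodge3_alt4]; simp)+
    have "interior4 v (hodge3 \<omega>) (p 0) (p 1) (p 2) = - wedge13 v \<omega> (p 3) (p 4) (p 5) (p 6) * ?e"
      unfolding interior4_def enumerates_sum[OF p] H Z wedge13_def
      by (simp add: eps7_sort[where p=p] algebra_simps)
    then have "hodge3 (interior4 v (hodge3 \<omega>)) (p 3) (p 4) (p 5) (p 6)
        = - wedge13 v \<omega> (p 3) (p 4) (p 5) (p 6) * (?e * ?e)"
      by (simp only: hodge3_distinct[OF interior4_alt3[OF hodge3_alt4] D] mult.assoc)
    then show "hodge3 (interior4 v (hodge3 \<omega>)) (p 3) (p 4) (p 5) (p 6)
        = (-1) * wedge13 v \<omega> (p 3) (p 4) (p 5) (p 6) + 0 * wedge13 v \<omega> (p 3) (p 4) (p 5) (p 6)"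
      unfolding eps7_square[OF D] by simp
  qed
  then show ?thesis by simp
qed

text \<open>
The identity \<open>\<star>(v\<and>(\<iota>(v)\<omega>)) = |v|\<^sup>2 \<star>\<omega> - v\<and>(\<iota>(v)\<star>\<omega>)\<close>. On complementary indices \<open>(abc|ijkl)\<close> the term \<open>v\<and>(\<iota>(v)\<star>\<omega>)\<close>
consists of the squares of the components \<open>i, j, k, l\<close> of \<open>v\<close>, which reduce \<open>|v|\<^sup>2\<close> to the squares of the
components \<open>a, b, c\<close>, and of mixed products that also occur in \<open>v\<and>(\<iota>(v)\<omega>)\<close>.
\<close>

lemma hodge3_wedge12:
  assumes \<omega>: "alt3 \<omega>"
  shows "hodge3 (wedge12 v (interior3 v \<omega>)) i j k l
    = (v \<bullet> v) * hodge3 \<omega> i j k l - wedge13 v (interior4 v (hodge3 \<omega>)) i j k l"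
proof -
  let ?S = "interior4 v (hodge3 \<omega>)"
  have "hodge3 (wedge12 v (interior3 v \<omega>)) i j k l
      = (v \<bullet> v) * hodge3 \<omega> i j k l + (-1) * wedge13 v ?S i j k l"
  proof (rule form4_eqI[OF hodge3_alt4 alt4_lincomb[OF hodge3_alt4 wedge13_alt4[OF interior4_alt3[OF hodge3_alt4]]]])
    fix p assume p: "enumerates p"
    note D = enumerates_distinct[OF p]
    let ?e = "eps7 (p 0) (p 1) (p 2) (p 3) (p 4) (p 5) (p 6)"
    have H: "hodge3 \<omega> (p m) (p n) (p q) (p r) = \<omega> (p a) (p b) (p c) * eps7 (p a) (p b) (p c) (p m) (p n) (p q) (p r)"
      if "distinct [p a, p b, p c, p m, p n, p q, p r]" for a b c m n q r
      by (rule hodge3_distinct[OF \<omega> that])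
    have Z: "hodge3 \<omega> i i k l = 0" "hodge3 \<omega> i k i l = 0" "hodge3 \<omega> i k l i = 0" for i k l
      by (rule alt4_repeat[OF hodge3_alt4]; simp)+
    note expand = interior4_def enumerates_sum[OF p] Z
    note s = eps7_sort[where p=p] alt3_sort[OF \<omega>, where p=p] alt3_repeat[OF \<omega>]
    have S: "?S (p 4) (p 5) (p 6) = (- v $ p 0 * \<omega> (p 1) (p 2) (p 3) + v $ p 1 * \<omega> (p 0) (p 2) (p 3)
          - v $ p 2 * \<omega> (p 0) (p 1) (p 3) + v $ p 3 * \<omega> (p 0) (p 1) (p 2)) * ?e"
      unfolding expand by (simp add: enumerates_eq_iff[OF p] H[of 1 2 3 0 4 5 6] H[of 0 2 3 "Suc 0" 4 5 6] H[of 0 1 3 2 4 5 6]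
          H[of 0 1 2 3 4 5 6] s algebra_simps)
    have S2: "?S (p 3) (p 5) (p 6) = (v $ p 0 * \<omega> (p 1) (p 2) (p 4) - v $ p 1 * \<omega> (p 0) (p 2) (p 4)
          + v $ p 2 * \<omega> (p 0) (p 1) (p 4) - v $ p 4 * \<omega> (p 0) (p 1) (p 2)) * ?e"
      unfolding expand by (simp add: enumerates_eq_iff[OF p] H[of 1 2 4 0 3 5 6] H[of 0 2 4 "Suc 0" 3 5 6] H[of 0 1 4 2 3 5 6]
          H[of 0 1 2 4 3 5 6] s algebra_simps)
    have S3: "?S (p 3) (p 4) (p 6) = (- v $ p 0 * \<omega> (p 1) (p 2) (p 5) + v $ p 1 * \<omega> (p 0) (p 2) (p 5)
          - v $ p 2 * \<omega> (p 0) (p 1) (p 5) + v $ p 5 * \<omega> (p 0) (p 1) (p 2)) * ?e"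
      unfolding expand by (simp add: enumerates_eq_iff[OF p] H[of 1 2 5 0 3 4 6] H[of 0 2 5 "Suc 0" 3 4 6] H[of 0 1 5 2 3 4 6]
          H[of 0 1 2 5 3 4 6] s algebra_simps)
    have S4: "?S (p 3) (p 4) (p 5) = (v $ p 0 * \<omega> (p 1) (p 2) (p 6) - v $ p 1 * \<omega> (p 0) (p 2) (p 6)
          + v $ p 2 * \<omega> (p 0) (p 1) (p 6) - v $ p 6 * \<omega> (p 0) (p 1) (p 2)) * ?e"
      unfolding expand by (simp add: enumerates_eq_iff[OF p] H[of 1 2 6 0 3 4 5] H[of 0 2 6 "Suc 0" 3 4 5] H[of 0 1 6 2 3 4 5]
          H[of 0 1 2 6 3 4 5] s algebra_simps)
    have N: "v \<bullet> v = (\<Sum>n\<in>UNIV. v $ n * v $ n)" by (simp add: inner_vec_def)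
    show "hodge3 (wedge12 v (interior3 v \<omega>)) (p 3) (p 4) (p 5) (p 6)
        = (v \<bullet> v) * hodge3 \<omega> (p 3) (p 4) (p 5) (p 6) + (-1) * wedge13 v ?S (p 3) (p 4) (p 5) (p 6)"
      unfolding hodge3_distinct[OF wedge12_alt3[OF \<omega>] D] hodge3_distinct[OF \<omega> D]
        wedge13_def S S2 S3 S4 N wedge12_def interior3_def enumerates_sum[OF p]
      by (simp add: s algebra_simps)
  qed
  then show ?thesis by simp
qed

lemma antisymmetric_sorted_zero:
  fixes F :: "nat \<Rightarrow> nat \<Rightarrow> nat \<Rightarrow> nat \<Rightarrow> real"
  assumes s: "\<And>m n q r. F n m q r = - F m n q r" "\<And>m n q r. F m q n r = - F m n q r"
      "\<And>m n q r. F m n r q = - F m n q r"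
    and base: "\<And>m n q r. m < n \<Longrightarrow> n < q \<Longrightarrow> q < r \<Longrightarrow> r < N \<Longrightarrow> F m n q r = 0"
    and N: "m < N" "n < N" "q < N" "r < N"
  shows "F m n q r = 0"
proof -
  have z: "F m m q r = 0" "F m n n r = 0" "F m n q q = 0" for m n q r
    using s(1)[of m m q r] s(2)[of m n n r] s(3)[of m n q q] by simp_all
  have 1: "F m n q r = 0" if "m < n" "n < q" "m < N" "n < N" "q < N" "r < N" for m n q r
  proof -
    consider "q < r" | "r = q" | "n < r" "r < q" | "r = n" | "m < r" "r < n" | "r = m" | "r < m"
      by linarith
    then show ?thesis
      using that s(3)[of m n q r] s(2)[of m n r q] s(1)[of m r n q] z
        base[of m n q r] base[of m n r q] base[of m r n q] base[of r m n q] by cases auto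
  qed
  have 2: "F m n q r = 0" if "m < n" "m < N" "n < N" "q < N" "r < N" for m n q r
  proof -
    consider "n < q" | "q = n" | "m < q" "q < n" | "q = m" | "q < m" by linarith
    then show ?thesis
      using that s(2)[of m n q r] s(1)[of m q n r] z 1[of m n q r] 1[of m q n r] 1[of q m n r] by cases auto
  qed
  consider "m < n" | "m = n" | "n < m" by linarith
  then show ?thesis using N 2[of m n q r] 2[of n m q r] s(1)[of m n q r] z by cases auto
qed

text \<open>
For each increasing quadruple from \<open>{0..6}\<close>, in the last four entries, the complementary triple in an order
that makes the whole an even permutation.
\<close>

definition complements :: "(nat \<times> nat \<times> nat \<times> nat \<times> nat \<times> nat \<times> nat) list" where
  "complements =
    [(4, 5, 6, 0, 1, 2, 3), (3, 6, 5, 0, 1, 2, 4), (3, 4, 6, 0, 1, 2, 5), (3, 5, 4, 0, 1, 2, 6), (2, 5, 6, 0, 1, 3, 4),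
     (2, 6, 4, 0, 1, 3, 5), (2, 4, 5, 0, 1, 3, 6), (2, 3, 6, 0, 1, 4, 5), (2, 5, 3, 0, 1, 4, 6), (2, 3, 4, 0, 1, 5, 6),
     (1, 6, 5, 0, 2, 3, 4), (1, 4, 6, 0, 2, 3, 5), (1, 5, 4, 0, 2, 3, 6), (1, 6, 3, 0, 2, 4, 5), (1, 3, 5, 0, 2, 4, 6),
     (1, 4, 3, 0, 2, 5, 6), (1, 2, 6, 0, 3, 4, 5), (1, 5, 2, 0, 3, 4, 6), (1, 2, 4, 0, 3, 5, 6), (1, 3, 2, 0, 4, 5, 6),
     (0, 5, 6, 1, 2, 3, 4), (0, 6, 4, 1, 2, 3, 5), (0, 4, 5, 1, 2, 3, 6), (0, 3, 6, 1, 2, 4, 5), (0, 5, 3, 1, 2, 4, 6),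
     (0, 3, 4, 1, 2, 5, 6), (0, 6, 2, 1, 3, 4, 5), (0, 2, 5, 1, 3, 4, 6), (0, 4, 2, 1, 3, 5, 6), (0, 2, 3, 1, 4, 5, 6),
     (0, 1, 6, 2, 3, 4, 5), (0, 5, 1, 2, 3, 4, 6), (0, 1, 4, 2, 3, 5, 6), (0, 3, 1, 2, 4, 5, 6), (0, 1, 2, 3, 4, 5, 6)]"

lemma complements_cover:
  "\<forall>r\<in>set [0..<7]. \<forall>q\<in>set [0..<r]. \<forall>n\<in>set [0..<q]. \<forall>m\<in>set [0..<n].
     \<exists>(a, b, c, i, j, k, l)\<in>set complements. i = m \<and> j = n \<and> k = q \<and> l = r"
  unfolding complements_def by code_simp

lemma phi0_alt3: "alt3 phi0"
  unfolding alt3_def using phi0_swap by blast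

text \<open>
Both sides are alternating, which leaves the 35 increasing quadruples of indices. There the left-hand side is the
coefficient of \<open>\<phi>\<^sub>0\<close> on the complementary triple and the right-hand side a product of two entries of
the multiplication table.
\<close>

lemma hodge3_phi0: "hodge3 phi0 i j k l = Psi (axis i 1) (axis j 1) (axis k 1) (axis l 1)"
proof -
  (* The shift by one lists the indices in the order 1, ..., 7 of the volume form;
     without it the list would begin with 0, which is the index 7. *)
  define p :: "nat \<Rightarrow> 7" where "p n = of_nat (Suc n)" for n
  define F where "F m n q r = hodge3 phi0 (p m) (p n) (p q) (p r)
     - Psi (axis (p m) 1) (axis (p n) 1) (axis (p q) 1) (axis (p r) 1)" for m n q r
  have p_simps: "p 0 = 1" "p (Suc 0) = 2" "p 2 = 3" "p 3 = 4" "p 4 = 5" "p 5 = 6" "p 6 = 7"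
    by (simp_all add: p_def)
  have p_range: "\<exists>n<7. p n = i" for i
  proof -
    have "i \<in> p ` {0, 1, 2, 3, 4, 5, 6}" using exhaust_7[of i] by (auto simp: p_simps)
    then obtain n where "n \<in> {0, 1, 2, 3, 4, 5, 6}" "p n = i" by blast
    then show ?thesis by (intro exI[of _ n]) auto
  qed
  have p: "enumerates p"
    unfolding enumerates_def
  proof (rule eq_card_imp_inj_on)
    have "i \<in> p ` {..<7}" for i using p_range[of i] by blast
    then have "p ` {..<7} = UNIV" by blast
    then show "card (p ` {..<7}) = card {..<7::nat}" by simp
  qed simp
  have e: "eps7 (p 0) (p 1) (p 2) (p 3) (p 4) (p 5) (p 6) = 1"
    using eps7_identity by (simp add: p_simps)
  have eps: "\<forall>(a, b, c, i, j, k, l)\<in>set complements.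
      eps7 (p a) (p b) (p c) (p i) (p j) (p k) (p l) = eps7 (p 0) (p 1) (p 2) (p 3) (p 4) (p 5) (p 6)"
    unfolding complements_def by (simp add: eps7_sort[where p=p])
  have dist: "\<forall>(a, b, c, i, j, k, l)\<in>set complements. distinct [p a, p b, p c, p i, p j, p k, p l]"
    unfolding complements_def by (simp add: enumerates_eq_iff[OF p])
  have phi: "\<forall>(a, b, c, i, j, k, l)\<in>set complements.
     phi0 (p a) (p b) (p c) = Psi (axis (p i) 1) (axis (p j) 1) (axis (p k) 1) (axis (p l) 1)"
    unfolding complements_def Psi_def cross7_axis[symmetric]
    by (simp add: p_simps cross7_axis_table inner_axis_axis) (simp add: axis_def)
  have F0: "F i j k l = 0" if t: "(a, b, c, i, j, k, l) \<in> set complements" for a b c i j k l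
  proof -
    have "hodge3 phi0 (p i) (p j) (p k) (p l)
        = phi0 (p a) (p b) (p c) * eps7 (p a) (p b) (p c) (p i) (p j) (p k) (p l)"
      by (rule hodge3_distinct[OF phi0_alt3]) (use bspec[OF dist t] in simp)
    then show ?thesis
      using bspec[OF eps t, unfolded prod.case] bspec[OF phi t, unfolded prod.case] e unfolding F_def by simp
  qed
  have base: "F m n q r = 0" if mnqr: "m < n" "n < q" "q < r" "r < 7" for m n q r
  proof -
    have "\<exists>(a, b, c, i, j, k, l)\<in>set complements. i = m \<and> j = n \<and> k = q \<and> l = r"
      by (rule complements_cover[rule_format])
        (simp_all only: set_upt atLeastLessThan_iff le0 simp_thms mnqr)
    then show ?thesis using F0 by blast
  qed
  have "F m n q r = 0" if mnqr: "m < 7" "n < 7" "q < 7" "r < 7" for m n q r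
  proof (rule antisymmetric_sorted_zero[OF _ _ _ base mnqr])
    have h: "hodge3 phi0 j i k l = - hodge3 phi0 i j k l" "hodge3 phi0 i k j l = - hodge3 phi0 i j k l"
      "hodge3 phi0 i j l k = - hodge3 phi0 i j k l" for i j k l
      using hodge3_alt4[of phi0] unfolding alt4_def by blast+
    fix m n q r
    let ?x = "\<lambda>m. axis (p m) 1 :: vec7"
    show "F n m q r = - F m n q r"
      using h(1)[of "p n" "p m" "p q" "p r"] Psi_swap(1)[of "?x n" "?x m" "?x q" "?x r"] unfolding F_def by simp
    show "F m q n r = - F m n q r"
      using h(2)[of "p m" "p q" "p n" "p r"] Psi_swap(2)[of "?x m" "?x q" "?x n" "?x r"] unfolding F_def by simp
    show "F m n r q = - F m n q r"
      using h(3)[of "p m" "p n" "p r" "p q"] Psi_swap(3)[of "?x m" "?x n" "?x r" "?x q"] unfolding F_def by simp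
  qed
  then show ?thesis using p_range[of i] p_range[of j] p_range[of k] p_range[of l]
    unfolding F_def by auto
qed

section \<open>Adapted coframes\<close>

lemma linear_expand:
  fixes f :: "vec7 \<Rightarrow> real"
  assumes "linear f"
  shows "f x = (\<Sum>i\<in>UNIV. x $ i * f (axis i 1))"
proof -
  have "f x = f (\<Sum>i\<in>UNIV. x $ i *\<^sub>R axis i 1)"
    using basis_expansion[of x] by (simp add: scalar_mult_eq_scaleR)
  also have "\<dots> = (\<Sum>i\<in>UNIV. x $ i * f (axis i 1))"
    using assms by (simp add: linear_sum linear_cmul)
  finally show ?thesis .
qed

lemma cross7_self: "cross7 x x = 0"
  using cross7_swap[of x x] by (simp add: vec_eq_iff)

lemma cross7_minus: "cross7 (- x) y = - cross7 x y" "cross7 x (- y) = - cross7 x y"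
  using cross7_bilinear(3)[of "-1"] cross7_bilinear(4)[of _ "-1"] by simp_all

lemma inner_cross7_self: "cross7 x y \<bullet> x = 0" "cross7 x y \<bullet> y = 0"
  using inner_cross7_swap[of x y y] inner_cross7_swap[of x x y]
  by (simp_all add: cross7_self)

lemma cross7_cross7: "cross7 n (cross7 n y) = (n \<bullet> y) *\<^sub>R n - (n \<bullet> n) *\<^sub>R y"
proof (rule vector_eq_ldot[THEN iffD1, rule_format])
  fix z
  have "cross7 n (cross7 n y) \<bullet> z = - (cross7 n z \<bullet> cross7 n y)"
    by (rule inner_cross7_swap)
  also have "\<dots> = ((n \<bullet> y) *\<^sub>R n - (n \<bullet> n) *\<^sub>R y) \<bullet> z"
    unfolding cross7_polarised1 by (simp add: inner_diff_left inner_commute algebra_simps)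
  finally show "z \<bullet> cross7 n (cross7 n y) = z \<bullet> ((n \<bullet> y) *\<^sub>R n - (n \<bullet> n) *\<^sub>R y)"
    by (simp only: inner_commute)
qed

text \<open>
For a unit vector \<open>n\<close>: the identity on the line of \<open>n\<close> and multiplication by \<open>exp (i \<alpha>)\<close> on its complement, where
\<open>n \<times> \<cdot>\<close> is a complex structure.
\<close>

definition rot :: "vec7 \<Rightarrow> real \<Rightarrow> vec7 \<Rightarrow> vec7" where
  "rot n \<alpha> y = (n \<bullet> y) *\<^sub>R n + cos \<alpha> *\<^sub>R (y - (n \<bullet> y) *\<^sub>R n) + sin \<alpha> *\<^sub>R cross7 n y"

lemma rot_linear: "linear (rot n \<alpha>)"
  by (simp add: linear_iff rot_def cross7_bilinear inner_add_right algebra_simps)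

lemma rot_compose:
  assumes n: "n \<bullet> n = 1"
  shows "rot n \<alpha> (rot n \<beta> y) = rot n (\<alpha> + \<beta>) y"
proof -
  have 1: "n \<bullet> rot n \<beta> y = n \<bullet> y"
    using n inner_cross7_self(1)[of n y]
    by (simp add: rot_def inner_add_right inner_diff_right inner_commute)
  have 2: "cross7 n (rot n \<beta> y) = cos \<beta> *\<^sub>R cross7 n y + sin \<beta> *\<^sub>R ((n \<bullet> y) *\<^sub>R n - y)"
    using n by (simp add: rot_def cross7_bilinear cross7_self cross7_cross7 diff_conv_add_uminus cross7_minus
        del: add_uminus_conv_diff)
  show ?thesis
    unfolding rot_def[of n \<alpha>] 1 2 unfolding rot_def cos_add sin_add by (simp add: algebra_simps)
qed

lemma inner_rot:
  assumes n: "n \<bullet> n = 1"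
  shows "rot n \<alpha> y \<bullet> rot n \<alpha> z = y \<bullet> z"
proof -
  define y' z' where "y' = y - (n \<bullet> y) *\<^sub>R n" and "z' = z - (n \<bullet> z) *\<^sub>R n"
  have perp: "n \<bullet> y' = 0" "n \<bullet> z' = 0" using n by (simp_all add: y'_def z'_def inner_diff_right)
  have J: "cross7 n y = cross7 n y'" "cross7 n z = cross7 n z'"
    by (simp_all add: y'_def z'_def cross7_bilinear cross7_minus cross7_self diff_conv_add_uminus
        del: add_uminus_conv_diff)
  have r: "rot n \<alpha> y = (n \<bullet> y) *\<^sub>R n + cos \<alpha> *\<^sub>R y' + sin \<alpha> *\<^sub>R cross7 n y'"
    "rot n \<alpha> z = (n \<bullet> z) *\<^sub>R n + cos \<alpha> *\<^sub>R z' + sin \<alpha> *\<^sub>R cross7 n z'"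
    by (simp_all add: rot_def J y'_def[symmetric] z'_def[symmetric])
  have yz: "y = (n \<bullet> y) *\<^sub>R n + y'" "z = (n \<bullet> z) *\<^sub>R n + z'" by (simp_all add: y'_def z'_def)
  have i: "cross7 n y' \<bullet> cross7 n z' = y' \<bullet> z'" "n \<bullet> cross7 n y' = 0" "n \<bullet> cross7 n z' = 0"
    "cross7 n y' \<bullet> n = 0" "y' \<bullet> n = 0" "y' \<bullet> cross7 n z' = - (cross7 n y' \<bullet> z')"
    using cross7_polarised1[of n y' z'] n perp inner_cross7_self[of n] inner_cross7_swap[of n y' z']
    by (simp_all add: inner_commute)
  have "rot n \<alpha> y \<bullet> rot n \<alpha> z = (n \<bullet> y) * (n \<bullet> z) + ((cos \<alpha>)\<^sup>2 * (y' \<bullet> z') + (sin \<alpha>)\<^sup>2 * (y' \<bullet> z'))"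
    unfolding r by (simp add: inner_add_left inner_add_right n perp i power2_eq_square algebra_simps)
  also have "\<dots> = (n \<bullet> y) * (n \<bullet> z) + y' \<bullet> z'" by (simp flip: distrib_right)
  also have "\<dots> = ((n \<bullet> y) *\<^sub>R n + y') \<bullet> ((n \<bullet> z) *\<^sub>R n + z')"
    by (simp add: inner_add_left inner_add_right n perp i)
  also have "\<dots> = y \<bullet> z" by (rule arg_cong2[where f = inner, OF yz, symmetric])
  finally show ?thesis .
qed

text \<open>
On the complement of \<open>n\<close>, \<open>\<phi>\<^sub>0\<close> and \<open>\<psi>\<^sub>0(n, \<cdot>, \<cdot>, \<cdot>)\<close> are the real and the imaginary part of one complex trilinear
form: multiplying one argument by \<open>i\<close> turns the real part into minus the imaginary part.
\<close>

lemma phi_cross7_perp: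
  assumes n: "n \<bullet> n = 1" and "n \<bullet> y = 0" "n \<bullet> z = 0" "n \<bullet> w = 0"
  shows "cross7 (cross7 n y) z \<bullet> w = - Psi n y z w"
proof -
  have "cross7 (cross7 n y) z \<bullet> w = cross7 n y \<bullet> cross7 z w"
    using cross7_cyclic[of z w "cross7 n y"] by (simp add: inner_commute)
  then show ?thesis using assms by (simp add: Psi_def)
qed

text \<open>
A complex trilinear form is multiplied by the cube of \<open>exp (i \<alpha>)\<close>.
\<close>

lemma rot_triple_perp:
  fixes \<alpha> :: real
  assumes n: "n \<bullet> n = 1" and y: "n \<bullet> y = 0" and z: "n \<bullet> z = 0" and w: "n \<bullet> w = 0"
  defines "C \<equiv> \<lambda>y. cos \<alpha> *\<^sub>R y + sin \<alpha> *\<^sub>R cross7 n y"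
  shows "cross7 (C y) (C z) \<bullet> C w = cos (3 * \<alpha>) * (cross7 y z \<bullet> w) - sin (3 * \<alpha>) * Psi n y z w"
proof -
  let ?J = "cross7 n"
  have perp: "n \<bullet> ?J v = 0" for v using inner_cross7_self(1)[of n v] by (simp add: inner_commute)
  have JJ: "?J (?J v) = - v" if "n \<bullet> v = 0" for v using that n by (simp add: cross7_cross7)
  note J1 = phi_cross7_perp[OF n]
  have J2: "cross7 u (?J v) \<bullet> t = - Psi n u v t" if "n \<bullet> u = 0" "n \<bullet> v = 0" "n \<bullet> t = 0" for u v t
    using J1[OF that(2,1,3)] cross7_swap[of u "?J v"] Psi_swap(2)[of n v u t] by simp
  have J3: "cross7 u v \<bullet> ?J t = - Psi n u v t" if "n \<bullet> u = 0" "n \<bullet> v = 0" "n \<bullet> t = 0" for u v t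
    using J1[OF that(3,1,2)] cross7_cyclic[of u v "?J t"] Psi_swap(2)[of n t u v] Psi_swap(3)[of n u t v] by simp
  have PJ: "Psi n u (?J v) t = cross7 u v \<bullet> t" if "n \<bullet> u = 0" "n \<bullet> v = 0" "n \<bullet> t = 0" for u v t
    using J2[OF that(1) perp that(3), of v] JJ[OF that(2)] by (simp add: cross7_minus)
  have PJ': "Psi n u v (?J t) = cross7 u v \<bullet> t" if "n \<bullet> u = 0" "n \<bullet> v = 0" "n \<bullet> t = 0" for u v t
    using J3[OF that(1,2) perp, of t] JJ[OF that(3)] by (simp add: inner_minus_right)
  have e: "cross7 (?J y) z \<bullet> w = - Psi n y z w" "cross7 y (?J z) \<bullet> w = - Psi n y z w"
    "cross7 y z \<bullet> ?J w = - Psi n y z w" "cross7 (?J y) (?J z) \<bullet> w = - (cross7 y z \<bullet> w)"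
    "cross7 (?J y) z \<bullet> ?J w = - (cross7 y z \<bullet> w)" "cross7 y (?J z) \<bullet> ?J w = - (cross7 y z \<bullet> w)"
    "cross7 (?J y) (?J z) \<bullet> ?J w = Psi n y z w"
    using J1[OF y z w] J2[OF y z w] J3[OF y z w] J1[OF y perp w, of z] PJ[OF y z w]
      J1[OF y z perp, of w] PJ'[OF y z w] J2[OF y z perp, of w] J1[OF y perp perp, of z w]
      PJ'[OF y perp w, of z] J2[OF y z w]
    by simp_all
  have c3: "cos (3 * \<alpha>) = cos \<alpha> ^ 3 - 3 * cos \<alpha> * (sin \<alpha>)\<^sup>2"
    and s3: "sin (3 * \<alpha>) = 3 * (cos \<alpha>)\<^sup>2 * sin \<alpha> - sin \<alpha> ^ 3"
  proof -
    have "3 * \<alpha> = \<alpha> + (\<alpha> + \<alpha>)" by simp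
    then show "cos (3 * \<alpha>) = cos \<alpha> ^ 3 - 3 * cos \<alpha> * (sin \<alpha>)\<^sup>2"
      "sin (3 * \<alpha>) = 3 * (cos \<alpha>)\<^sup>2 * sin \<alpha> - sin \<alpha> ^ 3"
      by (simp_all only: cos_add sin_add) (simp_all add: power2_eq_square power3_eq_cube algebra_simps)
  qed
  show ?thesis
    unfolding C_def c3 s3
    by (simp add: cross7_bilinear inner_add_left inner_add_right e power2_eq_square power3_eq_cube algebra_simps)
qed

text \<open>
The three parts of the 3-form behave differently under the rotation: on the complement of \<open>n\<close> the cube of
\<open>exp (i u/3)\<close> appears, while the part containing \<open>n\<close> is \<open>n\<close> wedge a 2-form of type \<open>(1,1)\<close> and is unchanged. The last
term restores that part after multiplication by \<open>cos u\<close>.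
\<close>

lemma rot_triple:
  assumes n: "n \<bullet> n = 1"
  shows "cross7 (rot n (u / 3) y) (rot n (u / 3) z) \<bullet> rot n (u / 3) w
    = cos u * (cross7 y z \<bullet> w) - sin u * Psi n y z w
      + (1 - cos u) * ((n \<bullet> y) * (cross7 n z \<bullet> w) + (n \<bullet> z) * (cross7 n w \<bullet> y) + (n \<bullet> w) * (cross7 n y \<bullet> z))"
proof -
  define P where "P v = v - (n \<bullet> v) *\<^sub>R n" for v
  define C where "C v = cos (u / 3) *\<^sub>R v + sin (u / 3) *\<^sub>R cross7 n v" for v
  have perp: "n \<bullet> P v = 0" for v using n by (simp add: P_def inner_diff_right)
  have J: "cross7 n v = cross7 n (P v)" for v
    by (simp add: P_def cross7_bilinear cross7_minus cross7_self diff_conv_add_uminus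
        del: add_uminus_conv_diff)
  have rot: "rot n (u / 3) v = (n \<bullet> v) *\<^sub>R n + C (P v)" for v
    unfolding rot_def C_def P_def[symmetric] J[of v] by simp
  have CP: "n \<bullet> C (P v) = 0" for v
    using perp inner_cross7_self(1)[of n "P v"] by (simp add: C_def inner_add_right inner_commute)
  have JC: "cross7 n (C (P v)) \<bullet> C (P t) = cross7 n v \<bullet> t" for v t
  proof -
    have rotJ: "rot n (u / 3) (cross7 n v) = cross7 n (C (P v))"
      using n perp[of v] inner_cross7_self(1)[of n v]
      by (simp add: rot_def C_def cross7_bilinear cross7_cross7 J[of v] inner_commute)
    have "cross7 n v \<bullet> t = rot n (u / 3) (cross7 n v) \<bullet> rot n (u / 3) t"
      by (simp add: inner_rot[OF n])
    also have "\<dots> = cross7 n (C (P v)) \<bullet> C (P t)"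
      unfolding rotJ rot[of t] using inner_cross7_self(1)[of n "C (P v)"] by (simp add: inner_add_right)
    finally show ?thesis by simp
  qed
  have LHS: "cross7 (rot n (u / 3) y) (rot n (u / 3) z) \<bullet> rot n (u / 3) w
      = (n \<bullet> y) * (cross7 n z \<bullet> w) + (n \<bullet> z) * (cross7 n w \<bullet> y) + (n \<bullet> w) * (cross7 n y \<bullet> z)
        + cross7 (C (P y)) (C (P z)) \<bullet> C (P w)"
    unfolding rot
    using JC[of z w] JC[of w y] JC[of y z] cross7_self[of n]
      cross7_swap[of n "C (P y)"] inner_cross7_swap[of n "C (P w)" "C (P y)"]
      cross7_cyclic[of "C (P y)" "C (P z)" n]
    by (simp add: inner_cross7_self cross7_bilinear inner_add_left inner_add_right algebra_simps)
  have split: "cross7 y z \<bullet> w = (n \<bullet> y) * (cross7 n z \<bullet> w) + (n \<bullet> z) * (cross7 n w \<bullet> y)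
      + (n \<bullet> w) * (cross7 n y \<bullet> z) + cross7 (P y) (P z) \<bullet> P w"
  proof -
    have d: "v = (n \<bullet> v) *\<^sub>R n + P v" for v by (simp add: P_def)
    have JP: "cross7 n (P v) \<bullet> P t = cross7 n v \<bullet> t" for v t
      unfolding J[of v, symmetric] using inner_cross7_self(1)[of n v]
      by (simp add: P_def inner_diff_right)
    have "cross7 ((n \<bullet> y) *\<^sub>R n + P y) ((n \<bullet> z) *\<^sub>R n + P z) \<bullet> ((n \<bullet> w) *\<^sub>R n + P w)
       = (n \<bullet> y) * (cross7 n z \<bullet> w) + (n \<bullet> z) * (cross7 n w \<bullet> y)
      + (n \<bullet> w) * (cross7 n y \<bullet> z) + cross7 (P y) (P z) \<bullet> P w"
      using JP[of z w] JP[of w y] JP[of y z] cross7_self[of n]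
        cross7_swap[of n "P y"] inner_cross7_swap[of n "P w" "P y"] cross7_cyclic[of "P y" "P z" n]
      by (simp add: inner_cross7_self cross7_bilinear inner_add_left inner_add_right algebra_simps)
    then show ?thesis unfolding d[of y, symmetric] d[of z, symmetric] d[of w, symmetric] .
  qed
  have Psi: "Psi n y z w = Psi n (P y) (P z) (P w)"
  proof -
    have 1: "Psi n (P v) c d = Psi n v c d" for v c d
    proof -
      have "Psi n n c d = 0" using Psi_swap(1)[of n n c d] by simp
      then have "Psi (P v) n c d = Psi v n c d"
        unfolding P_def linear_diff[OF Psi_linear] linear_cmul[OF Psi_linear] by simp
      then show ?thesis using Psi_swap(1)[of n "P v" c d] Psi_swap(1)[of n v c d] by simp
    qed
    have 2: "Psi n b (P v) d = Psi n b v d" for b v d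
      using 1[of v b d] Psi_swap(2)[of n "P v" b d] Psi_swap(2)[of n v b d] by simp
    have 3: "Psi n b c (P v) = Psi n b c v" for b c v
      using 2[of b v c] Psi_swap(3)[of n b "P v" c] Psi_swap(3)[of n b v c] by simp
    show ?thesis by (simp only: 1 2 3)
  qed
  have "cross7 (C (P y)) (C (P z)) \<bullet> C (P w)
      = cos u * (cross7 (P y) (P z) \<bullet> P w) - sin u * Psi n (P y) (P z) (P w)"
    using rot_triple_perp[OF n perp perp perp, of "u / 3" y z w] by (simp add: C_def)
  then show ?thesis unfolding LHS Psi split by (simp add: algebra_simps)
qed

lemma interior_components:
  "interior4 v (hodge3 phi0) i j k = Psi v (axis i 1) (axis j 1) (axis k 1)"
  "interior3 v phi0 j k = cross7 v (axis j 1) \<bullet> axis k 1"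
proof -
  show "interior4 v (hodge3 phi0) i j k = Psi v (axis i 1) (axis j 1) (axis k 1)"
    unfolding interior4_def hodge3_phi0 using linear_expand[OF Psi_linear, of v] by simp
  have "linear (\<lambda>v. cross7 v (axis j 1) \<bullet> axis k 1)"
    by (simp add: linear_iff cross7_bilinear inner_add_left)
  from linear_expand[OF this, of v]
  show "interior3 v phi0 j k = cross7 v (axis j 1) \<bullet> axis k 1"
    by (simp add: interior3_def cross7_axis inner_axis)
qed

lemma isometric_form_components:
  "isometric_form f X x i j k = ((f x)\<^sup>2 - (norm (X x))\<^sup>2) * (cross7 (axis i 1) (axis j 1) \<bullet> axis k 1)
     - 2 * f x * Psi (X x) (axis i 1) (axis j 1) (axis k 1)
     + 2 * (X x $ i * (cross7 (X x) (axis j 1) \<bullet> axis k 1) + X x $ j * (cross7 (X x) (axis k 1) \<bullet> axis i 1)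
          + X x $ k * (cross7 (X x) (axis i 1) \<bullet> axis j 1))"
  unfolding isometric_form_def interior_components wedge12_def
  by (simp add: cross7_axis inner_axis)

text \<open>
The third part \<open>u/3\<close> of the angle arises because the form is cubic. The determinant is positive because the rotation by
\<open>u/3\<close> is the square of the rotation by \<open>u/6\<close>.
\<close>

lemma isometric_form_coframe:
  assumes f: "f x = cos (u / 2)" and X: "X x = sin (u / 2) *\<^sub>R n" and n: "norm n = 1"
  obtains A where "adapted_coframe (isometric_form f X x) A" "det A > 0"
    "\<And>i j. (\<Sum>m\<in>UNIV. A $ m $ i * A $ m $ j) = of_bool (i = j)"
proof
  have nn: "n \<bullet> n = 1" using n by (simp add: dot_square_norm)
  define A where "A \<alpha> = matrix (rot n \<alpha>)" for \<alpha>
  have A: "A \<alpha> $ m $ i = rot n \<alpha> (axis i 1) $ m" for \<alpha> m i by (simp add: A_def matrix_def)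
  have "orthogonal_transformation (rot n \<alpha>)" for \<alpha>
    using rot_linear inner_rot[OF nn] by (simp add: orthogonal_transformation_def)
  then have orth: "orthogonal_matrix (A \<alpha>)" for \<alpha>
    by (simp add: A_def orthogonal_transformation_matrix)
  have "A (u / 3) = A (u / 6) ** A (u / 6)"
  proof -
    have "rot n (u / 3) = rot n (u / 6) \<circ> rot n (u / 6)"
      by (simp add: fun_eq_iff rot_compose[OF nn])
    then show ?thesis unfolding A_def using matrix_compose[OF rot_linear rot_linear] by metis
  qed
  then have "det (A (u / 3)) = det (A (u / 6)) * det (A (u / 6))" by (simp add: det_mul)
  moreover have "det (A (u / 6)) = 1 \<or> det (A (u / 6)) = - 1" by (rule det_orthogonal_matrix[OF orth])
  ultimately show "det (A (u / 3)) > 0" by auto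
  show "(\<Sum>m\<in>UNIV. A (u / 3) $ m $ i * A (u / 3) $ m $ j) = of_bool (i = j)" for i j
    using inner_rot[OF nn, of "u / 3" "axis i 1" "axis j 1"]
    by (simp add: A inner_vec_def[of "rot _ _ _"] inner_axis_axis)
  have c: "(cos (u / 2))\<^sup>2 - (sin (u / 2))\<^sup>2 = cos u" "2 * cos (u / 2) * sin (u / 2) = sin u"
    using cos_double[of "u / 2"] sin_double[of "u / 2"] by simp_all
  have c3: "2 * (sin (u / 2))\<^sup>2 = 1 - cos u"
    using c(1) sin_cos_squared_add[of "u / 2"] by linarith
  show "adapted_coframe (isometric_form f X x) (A (u / 3))"
    unfolding adapted_coframe_def
  proof (intro conjI allI)
    show "invertible (A (u / 3))"
      using orth[of "u / 3"] orthogonal_matrix_def invertible_def by metis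
    fix i j k
    let ?i = "axis i 1 :: vec7" and ?j = "axis j 1 :: vec7" and ?k = "axis k 1 :: vec7"
    have Psi_scale: "Psi (t *\<^sub>R n) ?i ?j ?k = t * Psi n ?i ?j ?k" for t
      using linear_cmul[OF Psi_linear] by simp
    have "isometric_form f X x i j k = cos u * (cross7 ?i ?j \<bullet> ?k) - sin u * Psi n ?i ?j ?k
       + (2 * (sin (u / 2))\<^sup>2) * (n $ i * (cross7 n ?j \<bullet> ?k) + n $ j * (cross7 n ?k \<bullet> ?i)
          + n $ k * (cross7 n ?i \<bullet> ?j))"
      unfolding isometric_form_components f X c(1)[symmetric] c(2)[symmetric] Psi_scale
      by (simp add: n cross7_bilinear power2_eq_square algebra_simps)
    also have "\<dots> = cross7 (rot n (u / 3) ?i) (rot n (u / 3) ?j) \<bullet> rot n (u / 3) ?k"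
      unfolding rot_triple[OF nn] c3 by (simp add: inner_axis)
    also have "\<dots> = (\<Sum>c\<in>UNIV. \<Sum>a\<in>UNIV. \<Sum>b\<in>UNIV. phi0 a b c * A (u / 3) $ a $ i * A (u / 3) $ b $ j * A (u / 3) $ c $ k)"
      by (simp add: inner_vec_def cross7_def A sum_distrib_right)
    also have "\<dots> = (\<Sum>a\<in>UNIV. \<Sum>c\<in>UNIV. \<Sum>b\<in>UNIV. phi0 a b c * A (u / 3) $ a $ i * A (u / 3) $ b $ j * A (u / 3) $ c $ k)"
      by (rule sum.swap)
    also have "\<dots> = (\<Sum>a\<in>UNIV. \<Sum>b\<in>UNIV. \<Sum>c\<in>UNIV. phi0 a b c * A (u / 3) $ a $ i * A (u / 3) $ b $ j * A (u / 3) $ c $ k)"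
      by (intro sum.cong refl sum.swap)
    finally show "isometric_form f X x i j k
      = (\<Sum>a\<in>UNIV. \<Sum>b\<in>UNIV. \<Sum>c\<in>UNIV. phi0 a b c * (A (u / 3) $ a $ i) * (A (u / 3) $ b $ j) * (A (u / 3) $ c $ k))" .
  qed
qed

section \<open>Radially symmetric solitons\<close>

lemma partial_eq: "(h has_derivative D) (at x) \<Longrightarrow> partial p h x = D (axis p 1)"
  unfolding partial_def by (metis frechet_derivative_at)

lemma smooth_linear: "linear h \<Longrightarrow> smooth h" for h :: "vec7 \<Rightarrow> real"
  by (simp add: smooth_bounded_linear linear_conv_bounded_linear)

lemma has_derivative_linear: "linear h \<Longrightarrow> (h has_derivative h) (at x)" for h :: "vec7 \<Rightarrow> real"
  by (simp add: bounded_linear_imp_has_derivative linear_conv_bounded_linear)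

lemma linear_component: "linear (\<lambda>x::vec7. x $ i)"
  by (simp add: linear_iff)

lemma linear_cross7: "linear (\<lambda>x. cross7 x y \<bullet> z)" "linear (\<lambda>x. cross7 y x $ i)"
  by (simp_all add: linear_iff cross7_bilinear inner_add_left)

lemma radial_field_scale: "radial_field (\<lambda>r. c * r) x = c *\<^sub>R x"
  by (cases "x = 0") (simp_all add: radial_field_def sgn_div_norm)

text \<open>
All coefficients that occur for the soliton, divided by the powers of \<open>r\<close> that make them smooth even functions. The
relations are those of \<open>cos u\<close>, \<open>sin u\<close> and \<open>u'\<close> in terms of \<open>\<sigma>\<close>, \<open>\<kappa>\<close>, \<open>\<tau>\<close>, and the last one is the angle equation. The
functions with index 1 are the derivatives divided by \<open>r\<close>, as they appear in gradients of radial functions.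
\<close>

lemma angle_radial_functions:
  assumes u: "smooth u" "odd_fun u" "u 0 = 0" "angle_equation c u"
  obtains C \<sigma> \<kappa> \<tau> C1 \<sigma>1 \<kappa>1 \<tau>1 where
    "smooth C" "even_fun C" "smooth \<sigma>" "even_fun \<sigma>" "smooth \<kappa>" "even_fun \<kappa>" "smooth \<tau>" "even_fun \<tau>"
    "\<And>r. deriv C r = r * C1 r" "\<And>r. deriv \<sigma> r = r * \<sigma>1 r" "\<And>r. deriv \<kappa> r = r * \<kappa>1 r"
    "\<And>r. deriv \<tau> r = r * \<tau>1 r"
    "\<And>r. cos (u r) = C r" "\<And>r. sin (u r) = r * \<sigma> r" "\<And>r. C r = 1 - r\<^sup>2 * \<kappa> r"
    "\<And>r. r \<noteq> 0 \<Longrightarrow> \<sigma> r * \<sigma> r = \<kappa> r * (2 - r\<^sup>2 * \<kappa> r)"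
    "\<And>r. r \<noteq> 0 \<Longrightarrow> C1 r = - (\<sigma> r + r\<^sup>2 * \<tau> r) * \<sigma> r"
    "\<And>r. r \<noteq> 0 \<Longrightarrow> \<sigma>1 r = \<tau> r * C r - \<sigma> r * \<kappa> r"
    "\<And>r. r \<noteq> 0 \<Longrightarrow> \<kappa>1 r = \<tau> r * \<sigma> r - \<kappa> r * \<kappa> r"
    "\<And>r. r \<noteq> 0 \<Longrightarrow> \<sigma>1 r + r\<^sup>2 * \<tau>1 r + 8 * \<tau> r = c * (\<sigma> r + r\<^sup>2 * \<tau> r)"
proof -
  note du = smooth_deriv(2)[OF u(1)]
  define C where "C r = cos (u r)" for r
  have C: "smooth C" "even_fun C"
    using u(2) smooth_cos[OF u(1)] by (simp_all add: C_def[abs_def] even_fun_def odd_fun_def)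
  have "smooth (\<lambda>r. sin (u r))" "odd_fun (\<lambda>r. sin (u r))"
    using u(2) smooth_sin[OF u(1)] by (simp_all add: odd_fun_def)
  then obtain \<sigma> where \<sigma>: "smooth \<sigma>" "even_fun \<sigma>" "\<And>r. sin (u r) = r * \<sigma> r"
    using smooth_odd_factor by blast
  obtain k where k: "smooth k" "even_fun k" "\<And>r. C r = C 0 + r\<^sup>2 * k r"
    using smooth_even_factor[OF C] by blast
  define \<kappa> where "\<kappa> r = - k r" for r
  have \<kappa>: "smooth \<kappa>" "even_fun \<kappa>" "\<And>r. C r = 1 - r\<^sup>2 * \<kappa> r"
    using k smooth_minus[OF k(1)] u(3) by (simp_all add: \<kappa>_def[abs_def] even_fun_def C_def)
  have \<sigma>': "\<sigma> r + r * deriv \<sigma> r = deriv u r * C r" for r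
  proof -
    have "((\<lambda>r. r * \<sigma> r) has_field_derivative \<sigma> r + r * deriv \<sigma> r) (at r)"
      by (rule derivative_eq_intros smooth_deriv(2)[OF \<sigma>(1)] refl | simp)+
    moreover have "((\<lambda>r. r * \<sigma> r) has_field_derivative deriv u r * C r) (at r)"
      unfolding \<sigma>(3)[symmetric] C_def by (rule derivative_eq_intros du refl | simp)+
    ultimately show ?thesis by (rule DERIV_unique)
  qed
  have even_du: "even_fun (deriv u)" by (rule deriv_even_odd(1)[OF u(1,2)])
  have "smooth (\<lambda>r. deriv u r - \<sigma> r)" "even_fun (\<lambda>r. deriv u r - \<sigma> r)"
    using smooth_diff[OF smooth_deriv(1)[OF u(1)] \<sigma>(1)] even_du \<sigma>(2) by (simp_all add: even_fun_def)
  from smooth_even_factor[OF this]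
  obtain \<tau> where \<tau>: "smooth \<tau>" "even_fun \<tau>" "\<And>r. deriv u r - \<sigma> r = deriv u 0 - \<sigma> 0 + r\<^sup>2 * \<tau> r"
    by blast
  have u': "deriv u r = \<sigma> r + r\<^sup>2 * \<tau> r" for r
    using \<tau>(3)[of r] \<sigma>'[of 0] u(3) by (simp add: C_def)
  have d: "\<exists>q. \<forall>r. deriv g r = r * q r" if "smooth g" "even_fun g" for g
    using smooth_odd_factor[OF smooth_deriv(1)[OF that(1)] deriv_even_odd(2)[OF that]] by metis
  obtain C1 where C1: "\<And>r. deriv C r = r * C1 r" using d[OF C] by blast
  obtain \<sigma>1 where \<sigma>1: "\<And>r. deriv \<sigma> r = r * \<sigma>1 r" using d[OF \<sigma>(1,2)] by blast
  obtain \<kappa>1 where \<kappa>1: "\<And>r. deriv \<kappa> r = r * \<kappa>1 r" using d[OF \<kappa>(1,2)] by blast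
  obtain \<tau>1 where \<tau>1: "\<And>r. deriv \<tau> r = r * \<tau>1 r" using d[OF \<tau>(1,2)] by blast
  have a: "\<sigma> r * \<sigma> r = \<kappa> r * (2 - r\<^sup>2 * \<kappa> r)" if "r \<noteq> 0" for r
  proof -
    have "r\<^sup>2 * (\<sigma> r * \<sigma> r) = (sin (u r))\<^sup>2" by (simp add: \<sigma>(3) power2_eq_square)
    also have "\<dots> = 1 - (1 - r\<^sup>2 * \<kappa> r)\<^sup>2" by (simp add: sin_squared_eq C_def[symmetric] \<kappa>(3))
    also have "\<dots> = r\<^sup>2 * (\<kappa> r * (2 - r\<^sup>2 * \<kappa> r))" by (simp add: power2_eq_square algebra_simps)
    finally show ?thesis using that by simp
  qed
  have C': "deriv C r = - (r * \<sigma> r * deriv u r)" for r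
    unfolding C_def[abs_def] \<sigma>(3)[symmetric]
    by (rule DERIV_imp_deriv) (rule derivative_eq_intros du refl | simp)+
  have b: "C1 r = - (\<sigma> r + r\<^sup>2 * \<tau> r) * \<sigma> r" if "r \<noteq> 0" for r
  proof -
    have "r * C1 r = r * (- (\<sigma> r + r\<^sup>2 * \<tau> r) * \<sigma> r)"
      using C'[of r] unfolding C1 u' by (simp add: algebra_simps)
    then show ?thesis using that by simp
  qed
  have c': "\<sigma>1 r = \<tau> r * C r - \<sigma> r * \<kappa> r" if "r \<noteq> 0" for r
  proof -
    have "r\<^sup>2 * \<sigma>1 r = r\<^sup>2 * (\<tau> r * C r - \<sigma> r * \<kappa> r)"
      using \<sigma>'[of r] unfolding \<sigma>1 u' \<kappa>(3) by (simp add: algebra_simps power2_eq_square)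
    then show ?thesis using that by simp
  qed
  have d': "\<kappa>1 r = \<tau> r * \<sigma> r - \<kappa> r * \<kappa> r" if "r \<noteq> 0" for r
  proof -
    have "(C has_field_derivative - (2 * r * \<kappa> r + r\<^sup>2 * deriv \<kappa> r)) (at r)"
      unfolding \<kappa>(3)[abs_def] by (rule derivative_eq_intros smooth_deriv(2)[OF \<kappa>(1)] refl | simp)+
    from DERIV_imp_deriv[OF this]
    have "r * (r\<^sup>2 * \<kappa>1 r) = r * (\<sigma> r * \<sigma> r + r\<^sup>2 * (\<tau> r * \<sigma> r) - 2 * \<kappa> r)"
      unfolding C' \<kappa>1 u' by (simp add: algebra_simps)
    then have "r\<^sup>2 * \<kappa>1 r = \<sigma> r * \<sigma> r + r\<^sup>2 * (\<tau> r * \<sigma> r) - 2 * \<kappa> r" using that by simp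
    also have "\<dots> = r\<^sup>2 * (\<tau> r * \<sigma> r - \<kappa> r * \<kappa> r)" unfolding a[OF that] by (simp add: algebra_simps)
    finally show ?thesis using that by simp
  qed
  have e: "\<sigma>1 r + r\<^sup>2 * \<tau>1 r + 8 * \<tau> r = c * (\<sigma> r + r\<^sup>2 * \<tau> r)" if "r \<noteq> 0" for r
  proof -
    have "deriv u = (\<lambda>r. \<sigma> r + r\<^sup>2 * \<tau> r)" using u' by auto
    moreover have "deriv (\<lambda>r. \<sigma> r + r\<^sup>2 * \<tau> r) r = r * \<sigma>1 r + 2 * r * \<tau> r + r\<^sup>2 * (r * \<tau>1 r)"
      unfolding \<sigma>1[symmetric] \<tau>1[symmetric]
      by (rule DERIV_imp_deriv)
        (rule derivative_eq_intros smooth_deriv(2)[OF \<sigma>(1)] smooth_deriv(2)[OF \<tau>(1)] refl | simp)+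
    ultimately have "r\<^sup>2 * (r * \<sigma>1 r + 2 * r * \<tau> r + r\<^sup>2 * (r * \<tau>1 r))
        + (6 - c * r\<^sup>2) * r * (\<sigma> r + r\<^sup>2 * \<tau> r) - 6 * (r * \<sigma> r) = 0"
      using u(4)[unfolded angle_equation_def, rule_format, of r] \<sigma>(3)[of r] by simp
    then have "r ^ 3 * (\<sigma>1 r + r\<^sup>2 * \<tau>1 r + 8 * \<tau> r) = r ^ 3 * (c * (\<sigma> r + r\<^sup>2 * \<tau> r))"
      by (simp add: power2_eq_square power3_eq_cube algebra_simps)
    then show ?thesis using that by simp
  qed
  show ?thesis
    by (rule that[of C \<sigma> \<kappa> \<tau> C1 \<sigma>1 \<kappa>1 \<tau>1]) (use C \<sigma> \<kappa> \<tau> C1 \<sigma>1 \<kappa>1 \<tau>1 a b c' d' e C_def in auto)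
qed

text \<open>
The vector \<open>T\<^sub>p\<^sub>q\<close>, for fixed \<open>p\<close>, of the torsion described at the beginning.
\<close>

definition torsion_row :: "real \<Rightarrow> real \<Rightarrow> real \<Rightarrow> vec7 \<Rightarrow> 7 \<Rightarrow> vec7" where
  "torsion_row s t k x p = - (s *\<^sub>R axis p 1 + (t * x $ p) *\<^sub>R x + k *\<^sub>R cross7 (axis p 1) x)"

lemma hodge3_linear:
  "hodge3 (\<lambda>i j k. s * \<alpha> i j k + t * \<beta> i j k + v * \<gamma> i j k) i j k l
    = s * hodge3 \<alpha> i j k l + t * hodge3 \<beta> i j k l + v * hodge3 \<gamma> i j k l"
  unfolding hodge3_def by (simp add: sum.distrib sum_distrib_left algebra_simps)

lemma contract_wedge13:
  "(\<Sum>q\<in>UNIV. t $ q * wedge13 x \<omega> q i j k)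
    = (t \<bullet> x) * \<omega> i j k - x $ i * interior3 t \<omega> j k + x $ j * interior3 t \<omega> i k - x $ k * interior3 t \<omega> i j"
  unfolding wedge13_def interior3_def inner_vec_def
  by (simp add: sum.distrib sum_subtractf sum_distrib_left sum_distrib_right algebra_simps)

lemma contract_interior4: "interior3 t (interior4 x (hodge3 phi0)) j k = Psi x t (axis j 1) (axis k 1)"
proof -
  have "interior3 t (interior4 x (hodge3 phi0)) j k
      = - (\<Sum>q\<in>UNIV. t $ q * Psi (axis q 1) x (axis j 1) (axis k 1))"
    unfolding interior3_def interior_components
    by (simp add: Psi_swap(1)[of _ x] sum_negf)
  also have "\<dots> = - Psi t x (axis j 1) (axis k 1)"
    by (rule arg_cong[where f = uminus, OF linear_expand[OF Psi_linear, symmetric]])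
  also have "\<dots> = Psi x t (axis j 1) (axis k 1)" by (simp add: Psi_swap(1)[of t x])
  finally show ?thesis .
qed

text \<open>
The equation \<open>\<partial>\<^sub>p \<phi>\<^sub>i\<^sub>j\<^sub>l = T\<^sub>p\<^sub>q \<psi>\<^sub>q\<^sub>i\<^sub>j\<^sub>l\<close> at one point, with the derivatives of the coefficients replaced by
their values. By \<open>hodge3_interior4\<close> and \<open>hodge3_wedge12\<close>, \<open>\<psi> = \<psi>\<^sub>0 + \<sigma> x\<and>\<phi>\<^sub>0 - \<kappa> x\<and>(\<iota>(x)\<psi>\<^sub>0)\<close>. Its contraction
with the vector \<open>w = T\<^sub>p\<close> involves \<open>e\<^sub>p \<times> x\<close> in the arguments of \<open>\<phi>\<^sub>0\<close> and \<open>\<psi>\<^sub>0\<close>, and the two contraction identities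
reduce everything to the linearly independent tensors in the statement; the relation for \<open>s\<^sup>2\<close> serves to match the
coefficient of \<open>x\<and>(\<iota>(e\<^sub>p)\<phi>\<^sub>0)\<close>.
\<close>

lemma torsion_identity:
  assumes rel: "x \<noteq> 0 \<Longrightarrow> s * s = k * (2 - (x \<bullet> x) * k)" "C = 1 - (x \<bullet> x) * k"
      "x \<noteq> 0 \<Longrightarrow> C1 = - (s + (x \<bullet> x) * t) * s" "x \<noteq> 0 \<Longrightarrow> s1 = t * C - s * k" "x \<noteq> 0 \<Longrightarrow> k1 = t * s - k * k"
    and \<phi>: "\<phi> = (\<lambda>i j l. C * phi0 i j l + (- s) * interior4 x (hodge3 phi0) i j l
        + k * wedge12 x (interior3 x phi0) i j l)"
  shows "(\<Sum>q\<in>UNIV. torsion_row s t k x p $ q * hodge3 \<phi> q i j l)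
    = C1 * x $ p * phi0 i j l
      - (s1 * x $ p * Psi x (axis i 1) (axis j 1) (axis l 1) + s * Psi (axis p 1) (axis i 1) (axis j 1) (axis l 1))
      + (k1 * x $ p * wedge12 x (interior3 x phi0) i j l
        + k * (wedge12 (axis p 1) (interior3 x phi0) i j l + wedge12 x (interior3 (axis p 1) phi0) i j l))"
proof -
  let ?p = "axis p 1 :: vec7" and ?i = "axis i 1 :: vec7" and ?j = "axis j 1 :: vec7" and ?l = "axis l 1 :: vec7"
  define w where "w = torsion_row s t k x p"
  have hodge: "hodge3 \<phi> q i j l = hodge3 phi0 q i j l + s * wedge13 x phi0 q i j l
      - k * wedge13 x (interior4 x (hodge3 phi0)) q i j l" for q
    unfolding \<phi> hodge3_linear hodge3_interior4[OF phi0_alt3] hodge3_wedge12[OF phi0_alt3] rel(2)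
    by (simp add: algebra_simps)
  have "(\<Sum>q\<in>UNIV. w $ q * hodge3 \<phi> q i j l)
      = (\<Sum>q\<in>UNIV. w $ q * hodge3 phi0 q i j l) + s * (\<Sum>q\<in>UNIV. w $ q * wedge13 x phi0 q i j l)
        - k * (\<Sum>q\<in>UNIV. w $ q * wedge13 x (interior4 x (hodge3 phi0)) q i j l)"
    unfolding hodge by (simp add: sum.distrib sum_subtractf sum_distrib_left algebra_simps)
  also have "\<dots> = Psi w ?i ?j ?l
     + s * ((w \<bullet> x) * phi0 i j l - x $ i * (cross7 w ?j \<bullet> ?l) + x $ j * (cross7 w ?i \<bullet> ?l) - x $ l * (cross7 w ?i \<bullet> ?j))
     - k * ((w \<bullet> x) * Psi x ?i ?j ?l - x $ i * Psi x w ?j ?l + x $ j * Psi x w ?i ?l - x $ l * Psi x w ?i ?j)"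
    unfolding contract_wedge13 contract_interior4 interior_components interior4_def[symmetric] by simp
  also have "\<dots> = C1 * x $ p * phi0 i j l
      - (s1 * x $ p * Psi x ?i ?j ?l + s * Psi ?p ?i ?j ?l)
      + (k1 * x $ p * (x $ i * (cross7 x ?j \<bullet> ?l) - x $ j * (cross7 x ?i \<bullet> ?l) + x $ l * (cross7 x ?i \<bullet> ?j))
        + k * ((?p $ i * (cross7 x ?j \<bullet> ?l) - ?p $ j * (cross7 x ?i \<bullet> ?l) + ?p $ l * (cross7 x ?i \<bullet> ?j))
          + (x $ i * (cross7 ?p ?j \<bullet> ?l) - x $ j * (cross7 ?p ?i \<bullet> ?l) + x $ l * (cross7 ?p ?i \<bullet> ?j))))"
  proof (cases "x = 0")
    case True
    have z: "cross7 0 y = 0" "cross7 y 0 = 0" for y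
      using cross7_bilinear(3)[of 0 0 y] cross7_bilinear(4)[of y 0 0] by simp_all
    have w0: "w = - (s *\<^sub>R ?p)" using True by (simp add: w_def torsion_row_def z)
    have "Psi w ?i ?j ?l = - s * Psi ?p ?i ?j ?l"
      unfolding w0 linear_neg[OF Psi_linear] linear_cmul[OF Psi_linear] by simp
    then show ?thesis using True by (simp add: z)
  next
    case False
    define R where "R = x \<bullet> x"
    define v where "v = cross7 ?p x"
    have w_split: "w = - (s *\<^sub>R ?p + (t * x $ p) *\<^sub>R x + k *\<^sub>R v)"
      unfolding w_def torsion_row_def v_def ..
    have wx: "w \<bullet> x = - (s * x $ p + t * x $ p * R)"
      unfolding w_split R_def v_def by (simp add: inner_diff_left inner_cross7_self inner_axis' algebra_simps)
    have Psi_w: "Psi w a b d = - (s * Psi ?p a b d + t * x $ p * Psi x a b d + k * Psi v a b d)" for a b d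
      unfolding w_split linear_neg[OF Psi_linear] linear_add[OF Psi_linear] linear_cmul[OF Psi_linear] by simp
    have Psi_xw: "Psi x w b d = s * Psi ?p x b d + k * Psi v x b d" for b d
    proof -
      have "Psi x x b d = 0" using Psi_swap(1)[of x x b d] by simp
      then show ?thesis using Psi_w[of x b d] Psi_swap(1)[of w x b d] by simp
    qed
    have cw: "cross7 w b \<bullet> d = - (s * (cross7 ?p b \<bullet> d) + t * x $ p * (cross7 x b \<bullet> d)
        + k * ((?p \<bullet> b) * (x \<bullet> d) - (?p \<bullet> d) * (x \<bullet> b) - Psi ?p x b d))" for b d
    proof -
      have "cross7 v b \<bullet> d = (?p \<bullet> b) * (x \<bullet> d) - (?p \<bullet> d) * (x \<bullet> b) - Psi ?p x b d"
        using cross7_cyclic[of b d v] by (simp add: Psi_def v_def inner_commute)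
      then show ?thesis
        unfolding w_split linear_neg[OF linear_cross7(1)] linear_add[OF linear_cross7(1)]
          linear_cmul[OF linear_cross7(1)] by simp
    qed
    have ax: "x \<bullet> axis m 1 = x $ m" "axis m 1 \<bullet> x = x $ m" "?p \<bullet> axis m 1 = ?p $ m" for m
      by (simp_all add: inner_axis inner_axis')
    have vPsi: "Psi v ?i ?j ?l
      = - (?p $ i * (cross7 x ?j \<bullet> ?l) - ?p $ j * (cross7 x ?i \<bullet> ?l) + ?p $ l * (cross7 x ?i \<bullet> ?j)
       - x $ i * (cross7 ?p ?j \<bullet> ?l) + x $ j * (cross7 ?p ?i \<bullet> ?l) - x $ l * (cross7 ?p ?i \<bullet> ?j))"
      unfolding v_def Psi_cross7 ax
      using inner_cross7_swap[of x ?l ?i] inner_cross7_swap[of ?p ?l ?i]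
      by (simp add: cross7_cyclic)
    have vPsi_x: "Psi v x (axis a 1) (axis b 1) = - (x $ p * (cross7 x (axis a 1) \<bullet> axis b 1)
       - R * (cross7 ?p (axis a 1) \<bullet> axis b 1) + x $ a * (cross7 ?p x \<bullet> axis b 1) - x $ b * (cross7 ?p x \<bullet> axis a 1))" for a b
      unfolding v_def Psi_cross7 ax R_def
      using inner_cross7_swap[of ?p "axis b 1" x] by (simp add: inner_cross7_self cross7_self)
    have sq: "s * s * z = k * (2 - R * k) * z" for z using rel(1)[OF False] by (simp add: R_def)
    (* X, W, Z and H are the components of x wedge iota(x) phi0, e_p wedge iota(x) phi0,
       x wedge iota(e_p) phi0 and x wedge iota(x) iota(e_p) psi0; the terms with H cancel. *)
    define X where "X = x $ i * (cross7 x ?j \<bullet> ?l) - x $ j * (cross7 x ?i \<bullet> ?l) + x $ l * (cross7 x ?i \<bullet> ?j)"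
    define W where "W = ?p $ i * (cross7 x ?j \<bullet> ?l) - ?p $ j * (cross7 x ?i \<bullet> ?l) + ?p $ l * (cross7 x ?i \<bullet> ?j)"
    define Z where "Z = x $ i * (cross7 ?p ?j \<bullet> ?l) - x $ j * (cross7 ?p ?i \<bullet> ?l) + x $ l * (cross7 ?p ?i \<bullet> ?j)"
    define H where "H = x $ i * Psi ?p x ?j ?l - x $ j * Psi ?p x ?i ?l + x $ l * Psi ?p x ?i ?j"
    have 1: "Psi w ?i ?j ?l = - (s * Psi ?p ?i ?j ?l + t * x $ p * Psi x ?i ?j ?l - k * (W - Z))"
      unfolding Psi_w vPsi W_def Z_def by (simp add: algebra_simps)
    have 2: "x $ i * (cross7 w ?j \<bullet> ?l) - x $ j * (cross7 w ?i \<bullet> ?l) + x $ l * (cross7 w ?i \<bullet> ?j)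
        = - (s * Z + t * x $ p * X - k * H)"
      unfolding cw ax Z_def X_def H_def by (simp add: algebra_simps)
    have 3: "x $ i * Psi x w ?j ?l - x $ j * Psi x w ?i ?l + x $ l * Psi x w ?i ?j
        = s * H - k * (x $ p * X - R * Z)"
      unfolding Psi_xw vPsi_x Z_def X_def H_def by (simp add: algebra_simps)
    have "Psi w ?i ?j ?l
       + s * ((w \<bullet> x) * phi0 i j l - x $ i * (cross7 w ?j \<bullet> ?l) + x $ j * (cross7 w ?i \<bullet> ?l) - x $ l * (cross7 w ?i \<bullet> ?j))
       - k * ((w \<bullet> x) * Psi x ?i ?j ?l - x $ i * Psi x w ?j ?l + x $ j * Psi x w ?i ?l - x $ l * Psi x w ?i ?j)
      = Psi w ?i ?j ?l
       + s * ((w \<bullet> x) * phi0 i j l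
          - (x $ i * (cross7 w ?j \<bullet> ?l) - x $ j * (cross7 w ?i \<bullet> ?l) + x $ l * (cross7 w ?i \<bullet> ?j)))
       - k * ((w \<bullet> x) * Psi x ?i ?j ?l
          - (x $ i * Psi x w ?j ?l - x $ j * Psi x w ?i ?l + x $ l * Psi x w ?i ?j))"
      by (simp add: algebra_simps)
    also have "\<dots> = - (s + R * t) * s * x $ p * phi0 i j l
        - ((t * (1 - R * k) - s * k) * x $ p * Psi x ?i ?j ?l + s * Psi ?p ?i ?j ?l)
        + ((t * s - k * k) * x $ p * X + k * W + (s * s * Z + k * (R * k - 1) * Z))"
      unfolding 1 2 3 wx by (simp add: algebra_simps)
    also have "s * s * Z + k * (R * k - 1) * Z = k * Z"
      unfolding sq by (simp add: algebra_simps)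
    finally show ?thesis
      unfolding rel(3,4,5)[OF False] rel(2) R_def[symmetric] X_def[symmetric] W_def[symmetric] Z_def[symmetric]
      by (simp add: distrib_left)
  qed
  finally show ?thesis
    unfolding w_def wedge12_def interior_components
    using inner_cross7_swap[of x ?l ?i] inner_cross7_swap[of ?p ?l ?i] by simp
qed

definition torsion :: "(real \<Rightarrow> real) \<Rightarrow> (real \<Rightarrow> real) \<Rightarrow> (real \<Rightarrow> real) \<Rightarrow> vec7 \<Rightarrow> tensor2" where
  "torsion \<sigma> \<tau> \<kappa> x p q = torsion_row (\<sigma> (norm x)) (\<tau> (norm x)) (\<kappa> (norm x)) x p $ q"

lemma curl_radial:
  assumes "\<And>i k. \<phi> x i i k = 0"
  shows "curl \<phi> (\<lambda>y. c *\<^sub>R y) x k = 0"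
proof -
  have "partial i (\<lambda>y. (c *\<^sub>R y) $ j) x = c * of_bool (i = j)" for i j
    using partial_eq[OF has_derivative_linear, of "\<lambda>y. (c *\<^sub>R y) $ j" i x]
    by (simp add: linear_iff algebra_simps axis_def)
  then have "curl \<phi> (\<lambda>y. c *\<^sub>R y) x k = (\<Sum>i\<in>UNIV. \<Sum>j\<in>UNIV. if j = i then c * \<phi> x i i k else 0)"
    unfolding curl_def by (intro sum.cong) auto
  then show ?thesis by (simp add: assms)
qed

lemma lie_derivative_radial:
  "lie_derivative (\<lambda>y. c *\<^sub>R y) euclidean_metric x i j = 2 * c * euclidean_metric x i j"
proof -
  have "partial i (\<lambda>y. (c *\<^sub>R y) $ j) x = c * of_bool (i = j)" for i j
    using partial_eq[OF has_derivative_linear, of "\<lambda>y. (c *\<^sub>R y) $ j" i x]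
    by (simp add: linear_iff algebra_simps axis_def)
  moreover have "partial k (\<lambda>y. euclidean_metric y i j) x = 0" for k
    using partial_eq[OF has_derivative_const] by (simp add: euclidean_metric_def)
  ultimately have "lie_derivative (\<lambda>y. c *\<^sub>R y) euclidean_metric x i j
      = (\<Sum>k\<in>UNIV. (if k = i then c * of_bool (i = j) else 0) + (if k = j then c * of_bool (i = j) else 0))"
    unfolding lie_derivative_def euclidean_metric_def by (intro sum.cong) auto
  then show ?thesis by (simp add: sum.distrib euclidean_metric_def)
qed

text \<open>
The coefficient \<open>8 = 7 + 1\<close> comes from \<open>div (x\<^sub>i x\<^sub>k) = 8 x\<^sub>k\<close>. The term with the cross product is divergence-free, since
\<open>x \<times> x = 0\<close> and \<open>e\<^sub>i \<times> e\<^sub>i = 0\<close>.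
\<close>

lemma divergence_torsion:
  assumes "smooth \<sigma>" "smooth \<tau>" "smooth \<kappa>" "\<And>r. deriv \<sigma> r = r * \<sigma>1 r" "\<And>r. deriv \<tau> r = r * \<tau>1 r"
      "\<And>r. deriv \<kappa> r = r * \<kappa>1 r"
  shows "divergence (torsion \<sigma> \<tau> \<kappa>) x k
    = - (\<sigma>1 (norm x) + (norm x)\<^sup>2 * \<tau>1 (norm x) + 8 * \<tau> (norm x)) * x $ k"
proof -
  let ?r = "norm x"
  note rad = radial_has_derivative[OF assms(1,4), of x] radial_has_derivative[OF assms(2,5), of x]
    radial_has_derivative[OF assms(3,6), of x]
  note lin = has_derivative_linear[OF linear_component] has_derivative_linear[OF linear_cross7(2)]
  have p: "partial i (\<lambda>y. torsion \<sigma> \<tau> \<kappa> y i k) x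
     = - (\<sigma>1 ?r * (x $ i * axis i 1 $ k) + \<tau>1 ?r * (x $ i * x $ i * x $ k) + \<tau> ?r * (x $ k + x $ i * axis i 1 $ k)
        + \<kappa>1 ?r * (x $ i * cross7 (axis i 1) x $ k))" for i
  proof -
    have "((\<lambda>y. - (\<sigma> (norm y) * axis i 1 $ k + (\<tau> (norm y) * y $ i) * y $ k + \<kappa> (norm y) * cross7 (axis i 1) y $ k))
      has_derivative (\<lambda>v. - (\<sigma>1 ?r * (x \<bullet> v) * axis i 1 $ k + ((\<tau>1 ?r * (x \<bullet> v)) * x $ i + \<tau> ?r * v $ i) * x $ k
         + (\<tau> ?r * x $ i) * v $ k + (\<kappa>1 ?r * (x \<bullet> v) * cross7 (axis i 1) x $ k + \<kappa> ?r * cross7 (axis i 1) v $ k)))) (at x)"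
      by (rule derivative_eq_intros rad lin refl | simp)+ (simp add: fun_eq_iff algebra_simps)
    from partial_eq[OF this, of i] show ?thesis
      by (simp add: torsion_def torsion_row_def inner_axis cross7_self algebra_simps)
  qed
  have "divergence (torsion \<sigma> \<tau> \<kappa>) x k
     = - (\<sigma>1 ?r * (\<Sum>i\<in>UNIV. x $ i * axis i 1 $ k) + \<tau>1 ?r * ((\<Sum>i\<in>UNIV. x $ i * x $ i) * x $ k)
        + \<tau> ?r * ((\<Sum>i\<in>(UNIV :: 7 set). x $ k) + (\<Sum>i\<in>UNIV. x $ i * axis i 1 $ k))
        + \<kappa>1 ?r * (\<Sum>i\<in>UNIV. x $ i * cross7 (axis i 1) x $ k))"
    unfolding divergence_def p
    by (simp add: sum.distrib sum_negf sum_subtractf sum_distrib_left sum_distrib_right algebra_simps)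
  moreover have "(\<Sum>i\<in>UNIV. x $ i * axis i 1 $ k) = x $ k"
    using linear_expand[OF linear_component, of x k] by simp
  moreover have "(\<Sum>i\<in>UNIV. x $ i * x $ i) = ?r\<^sup>2"
    unfolding power2_norm_eq_inner inner_vec_def by simp
  moreover have "(\<Sum>i\<in>UNIV. x $ i * cross7 (axis i 1) x $ k) = 0"
  proof -
    have "linear (\<lambda>y. cross7 y x $ k)" by (simp add: linear_iff cross7_bilinear)
    from linear_expand[OF this, of x] show ?thesis by (simp add: cross7_self)
  qed
  ultimately show ?thesis by (simp add: algebra_simps)
qed

lemma interior_torsion:
  "interior_T (\<lambda>y. c *\<^sub>R y) (torsion \<sigma> \<tau> \<kappa>) x k = - (c * (\<sigma> (norm x) + (norm x)\<^sup>2 * \<tau> (norm x))) * x $ k"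
proof -
  let ?r = "norm x"
  have "interior_T (\<lambda>y. c *\<^sub>R y) (torsion \<sigma> \<tau> \<kappa>) x k
     = - (c * (\<sigma> ?r * (\<Sum>i\<in>UNIV. x $ i * axis i 1 $ k) + \<tau> ?r * ((\<Sum>i\<in>UNIV. x $ i * x $ i) * x $ k)
        + \<kappa> ?r * (\<Sum>i\<in>UNIV. x $ i * cross7 (axis i 1) x $ k)))"
    unfolding interior_T_def torsion_def torsion_row_def
    by (simp add: sum.distrib sum_negf sum_subtractf sum_distrib_left sum_distrib_right algebra_simps)
  moreover have "(\<Sum>i\<in>UNIV. x $ i * axis i 1 $ k) = x $ k"
    using linear_expand[OF linear_component, of x k] by simp
  moreover have "(\<Sum>i\<in>UNIV. x $ i * x $ i) = ?r\<^sup>2"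
    unfolding power2_norm_eq_inner inner_vec_def by simp
  moreover have "(\<Sum>i\<in>UNIV. x $ i * cross7 (axis i 1) x $ k) = 0"
  proof -
    have "linear (\<lambda>y. cross7 y x $ k)" by (simp add: linear_iff cross7_bilinear)
    from linear_expand[OF this, of x] show ?thesis by (simp add: cross7_self)
  qed
  ultimately show ?thesis by (simp add: algebra_simps)
qed


text \<open>
With \<open>X = s x\<close>, \<open>s = sin (u/2)/r\<close>, the double angle formulas turn the coefficients of the three pieces into
\<open>cos u\<close>, \<open>sin u / r\<close> and \<open>(1 - cos u)/r\<^sup>2\<close>.
\<close>

lemma isometric_form_radial:
  assumes \<sigma>: "\<And>r. sin (u r) = r * \<sigma> r" and \<kappa>: "\<And>r. cos (u r) = 1 - r\<^sup>2 * \<kappa> r" and u0: "u 0 = 0"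
  shows "isometric_form (\<lambda>x. cos (u (norm x) / 2)) (radial_field (\<lambda>r. sin (u r / 2))) x
    = (\<lambda>i j k. (1 - (norm x)\<^sup>2 * \<kappa> (norm x)) * phi0 i j k + (- \<sigma> (norm x)) * interior4 x (hodge3 phi0) i j k
        + \<kappa> (norm x) * wedge12 x (interior3 x phi0) i j k)"
proof (intro ext)
  fix i j k
  let ?r = "norm x"
  define s where "s = sin (u ?r / 2) / ?r"
  have X: "radial_field (\<lambda>r. sin (u r / 2)) x = s *\<^sub>R x"
    unfolding radial_field_def sgn_div_norm s_def by (simp add: inverse_eq_divide)
  have rs: "?r * s = sin (u ?r / 2)" using u0 by (cases "x = 0") (simp_all add: s_def)
  have c: "(cos (u ?r / 2))\<^sup>2 - (?r * s)\<^sup>2 = 1 - ?r\<^sup>2 * \<kappa> ?r"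
    unfolding rs \<kappa>[symmetric] using cos_double[of "u ?r / 2"] by simp
  have lin: "interior4 (s *\<^sub>R x) \<omega> i j k = s * interior4 x \<omega> i j k"
    "wedge12 (s *\<^sub>R x) (interior3 (s *\<^sub>R x) phi0) i j k = s\<^sup>2 * wedge12 x (interior3 x phi0) i j k" for \<omega>
    by (simp_all add: interior4_def interior3_def wedge12_def sum_distrib_left power2_eq_square algebra_simps)
  show "isometric_form (\<lambda>x. cos (u (norm x) / 2)) (radial_field (\<lambda>r. sin (u r / 2))) x i j k
    = (1 - ?r\<^sup>2 * \<kappa> ?r) * phi0 i j k + (- \<sigma> ?r) * interior4 x (hodge3 phi0) i j k
        + \<kappa> ?r * wedge12 x (interior3 x phi0) i j k"
  proof (cases "x = 0")
    case True
    then show ?thesis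
      unfolding isometric_form_def X using u0 by (simp add: interior4_def wedge12_def)
  next
    case False
    have "?r * (2 * cos (u ?r / 2) * s) = ?r * \<sigma> ?r"
      using sin_double[of "u ?r / 2"] rs \<sigma>[of ?r] by (simp add: mult_ac)
    then have s1: "2 * cos (u ?r / 2) * s = \<sigma> ?r" using False by simp
    have "?r\<^sup>2 * (2 * s\<^sup>2) = ?r\<^sup>2 * \<kappa> ?r"
      using c sin_cos_squared_add[of "u ?r / 2"] unfolding rs[symmetric] power_mult_distrib by linarith
    then have s2: "2 * s\<^sup>2 = \<kappa> ?r" using False by simp
    have "isometric_form (\<lambda>x. cos (u (norm x) / 2)) (radial_field (\<lambda>r. sin (u r / 2))) x i j k
      = ((cos (u ?r / 2))\<^sup>2 - (?r * s)\<^sup>2) * phi0 i j k - (2 * cos (u ?r / 2) * s) * interior4 x (hodge3 phi0) i j k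
        + (2 * s\<^sup>2) * wedge12 x (interior3 x phi0) i j k"
      unfolding isometric_form_def X lin by (simp add: power_mult_distrib mult_ac)
    then show ?thesis unfolding c s1 s2 by simp
  qed
qed

lemma radial_form_smooth:
  assumes "smooth C" "even_fun C" "smooth \<sigma>" "even_fun \<sigma>" "smooth \<kappa>" "even_fun \<kappa>"
  shows "smooth (\<lambda>x. C (norm x) * phi0 i j k + (- \<sigma> (norm x)) * interior4 x (hodge3 phi0) i j k
        + \<kappa> (norm x) * wedge12 x (interior3 x phi0) i j k)"
  unfolding interior_components wedge12_def
  by (intro smooth_add smooth_mult smooth_minus smooth_const smooth_radial assms
      smooth_linear[OF Psi_linear] smooth_linear[OF linear_component] smooth_linear[OF linear_cross7(1)])

lemma radial_form_partial:
  assumes "smooth C" "smooth \<sigma>" "smooth \<kappa>" "\<And>r. deriv C r = r * C1 r" "\<And>r. deriv \<sigma> r = r * \<sigma>1 r"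
      "\<And>r. deriv \<kappa> r = r * \<kappa>1 r"
  shows "partial p (\<lambda>x. C (norm x) * phi0 i j k + (- \<sigma> (norm x)) * interior4 x (hodge3 phi0) i j k
        + \<kappa> (norm x) * wedge12 x (interior3 x phi0) i j k) x
    = C1 (norm x) * x $ p * phi0 i j k
      - (\<sigma>1 (norm x) * x $ p * Psi x (axis i 1) (axis j 1) (axis k 1)
         + \<sigma> (norm x) * Psi (axis p 1) (axis i 1) (axis j 1) (axis k 1))
      + (\<kappa>1 (norm x) * x $ p * wedge12 x (interior3 x phi0) i j k
        + \<kappa> (norm x) * (wedge12 (axis p 1) (interior3 x phi0) i j k + wedge12 x (interior3 (axis p 1) phi0) i j k))"
proof -
  let ?r = "norm x"
  note rad = radial_has_derivative[OF assms(1,4), of x] radial_has_derivative[OF assms(2,5), of x]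
    radial_has_derivative[OF assms(3,6), of x]
  have wedge: "((\<lambda>x. wedge12 x (interior3 x phi0) i j k) has_derivative
      (\<lambda>v. wedge12 v (interior3 x phi0) i j k + wedge12 x (interior3 v phi0) i j k)) (at x)"
    unfolding wedge12_def interior_components
    by (rule derivative_eq_intros has_derivative_linear[OF linear_component]
        has_derivative_linear[OF linear_cross7(1)] refl | simp)+ (simp add: fun_eq_iff algebra_simps)
  have "((\<lambda>x. C (norm x) * phi0 i j k + (- \<sigma> (norm x)) * interior4 x (hodge3 phi0) i j k
        + \<kappa> (norm x) * wedge12 x (interior3 x phi0) i j k) has_derivative
     (\<lambda>v. C1 ?r * (x \<bullet> v) * phi0 i j k
      - (\<sigma>1 ?r * (x \<bullet> v) * Psi x (axis i 1) (axis j 1) (axis k 1)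
         + \<sigma> ?r * Psi v (axis i 1) (axis j 1) (axis k 1))
      + (\<kappa>1 ?r * (x \<bullet> v) * wedge12 x (interior3 x phi0) i j k
        + \<kappa> ?r * (wedge12 v (interior3 x phi0) i j k + wedge12 x (interior3 v phi0) i j k)))) (at x)"
    unfolding interior_components(1)
    by (rule derivative_eq_intros rad wedge has_derivative_linear[OF Psi_linear] refl | simp)+
      (simp add: fun_eq_iff algebra_simps)
  from partial_eq[OF this, of p] show ?thesis by (simp add: inner_axis)
qed

lemma radial_soliton:
  assumes u: "smooth u" "odd_fun u" "u 0 = 0" "angle_equation c u"
  shows "euclidean_soliton
    (isometric_form (\<lambda>x. cos (u (norm x) / 2)) (radial_field (\<lambda>r. sin (u r / 2)))) (radial_field (\<lambda>r. c * r)) c"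
proof -
  obtain C \<sigma> \<kappa> \<tau> C1 \<sigma>1 \<kappa>1 \<tau>1 where
    sm: "smooth C" "even_fun C" "smooth \<sigma>" "even_fun \<sigma>" "smooth \<kappa>" "even_fun \<kappa>" "smooth \<tau>" "even_fun \<tau>"
    and d: "\<And>r. deriv C r = r * C1 r" "\<And>r. deriv \<sigma> r = r * \<sigma>1 r" "\<And>r. deriv \<kappa> r = r * \<kappa>1 r"
    "\<And>r. deriv \<tau> r = r * \<tau>1 r"
    and C: "\<And>r. cos (u r) = C r" and \<sigma>: "\<And>r. sin (u r) = r * \<sigma> r" and \<kappa>: "\<And>r. C r = 1 - r\<^sup>2 * \<kappa> r"
    and rel: "\<And>r. r \<noteq> 0 \<Longrightarrow> \<sigma> r * \<sigma> r = \<kappa> r * (2 - r\<^sup>2 * \<kappa> r)"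
    "\<And>r. r \<noteq> 0 \<Longrightarrow> C1 r = - (\<sigma> r + r\<^sup>2 * \<tau> r) * \<sigma> r"
    "\<And>r. r \<noteq> 0 \<Longrightarrow> \<sigma>1 r = \<tau> r * C r - \<sigma> r * \<kappa> r"
    "\<And>r. r \<noteq> 0 \<Longrightarrow> \<kappa>1 r = \<tau> r * \<sigma> r - \<kappa> r * \<kappa> r"
    and ode: "\<And>r. r \<noteq> 0 \<Longrightarrow> \<sigma>1 r + r\<^sup>2 * \<tau>1 r + 8 * \<tau> r = c * (\<sigma> r + r\<^sup>2 * \<tau> r)"
    using angle_radial_functions[OF u] by blast
  define \<phi> where "\<phi> = isometric_form (\<lambda>x. cos (u (norm x) / 2)) (radial_field (\<lambda>r. sin (u r / 2)))"
  define Y :: "vec7 \<Rightarrow> vec7" where "Y = (\<lambda>y. c *\<^sub>R y)"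
  have Y: "radial_field (\<lambda>r. c * r) = Y" by (simp add: fun_eq_iff radial_field_scale Y_def)
  have \<phi>x: "\<phi> x = (\<lambda>i j k. C (norm x) * phi0 i j k + (- \<sigma> (norm x)) * interior4 x (hodge3 phi0) i j k
        + \<kappa> (norm x) * wedge12 x (interior3 x phi0) i j k)" for x
    unfolding \<phi>_def \<kappa> by (rule isometric_form_radial[OF \<sigma> _ u(3)]) (simp add: C \<kappa>)
  have coframe: "\<exists>A. adapted_coframe (\<phi> x) A \<and> det A > 0 \<and> (\<forall>i j. (\<Sum>m\<in>UNIV. A $ m $ i * A $ m $ j) = of_bool (i = j))" for x
  proof -
    (* At the origin every unit vector serves, because there sin (u/2) = 0. *)
    obtain n :: vec7 where n: "norm n = 1" "radial_field (\<lambda>r. sin (u r / 2)) x = sin (u (norm x) / 2) *\<^sub>R n"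
    proof (cases "x = 0")
      case True
      show ?thesis by (rule that[of "axis 1 1"]) (simp_all add: True radial_field_def u(3) norm_axis_1)
    next
      case False
      show ?thesis by (rule that[of "sgn x"]) (simp_all add: False radial_field_def norm_sgn)
    qed
    show ?thesis
    proof (rule isometric_form_coframe[where f = "\<lambda>x. cos (u (norm x) / 2)" and u = "u (norm x)" and x = x
          and X = "radial_field (\<lambda>r. sin (u r / 2))" and n = n, OF refl n(2) n(1)])
      fix A
      assume A: "adapted_coframe (isometric_form (\<lambda>x. cos (u (norm x) / 2)) (radial_field (\<lambda>r. sin (u r / 2))) x) A"
        "det A > 0" "\<And>i j. (\<Sum>m\<in>UNIV. A $ m $ i * A $ m $ j) = of_bool (i = j)"
      show ?thesis unfolding \<phi>_def by (intro exI[of _ A] conjI allI A)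
    qed
  qed
  have "has_torsion \<phi> (torsion \<sigma> \<tau> \<kappa>)"
    unfolding has_torsion_def
  proof (intro allI)
    fix x :: vec7 and p i j k
    have R: "x \<bullet> x = (norm x)\<^sup>2" by (simp add: power2_norm_eq_inner)
    have "(\<Sum>q\<in>UNIV. torsion_row (\<sigma> (norm x)) (\<tau> (norm x)) (\<kappa> (norm x)) x p $ q * hodge3 (\<phi> x) q i j k)
      = C1 (norm x) * x $ p * phi0 i j k
      - (\<sigma>1 (norm x) * x $ p * Psi x (axis i 1) (axis j 1) (axis k 1)
         + \<sigma> (norm x) * Psi (axis p 1) (axis i 1) (axis j 1) (axis k 1))
      + (\<kappa>1 (norm x) * x $ p * wedge12 x (interior3 x phi0) i j k
        + \<kappa> (norm x) * (wedge12 (axis p 1) (interior3 x phi0) i j k + wedge12 x (interior3 (axis p 1) phi0) i j k))"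
      by (rule torsion_identity[OF _ _ _ _ _ \<phi>x]) (use rel \<kappa> in \<open>auto simp: R\<close>)
    then show "partial p (\<lambda>y. \<phi> y i j k) x = (\<Sum>q\<in>UNIV. torsion \<sigma> \<tau> \<kappa> x p q * hodge3 (\<phi> x) q i j k)"
      unfolding \<phi>x radial_form_partial[OF sm(1,3,5) d(1,2,3)] torsion_def by simp
  qed
  moreover have "divergence (torsion \<sigma> \<tau> \<kappa>) x k
      = - (1/2) * curl \<phi> Y x k + interior_T Y (torsion \<sigma> \<tau> \<kappa>) x k" for x :: vec7 and k
  proof -
    have "\<phi> x i i k = 0" for i k
      unfolding \<phi>x using alt3_repeat(1)[OF phi0_alt3] alt3_repeat(1)[OF interior4_alt3[OF hodge3_alt4]]
        alt3_repeat(1)[OF wedge12_alt3[OF phi0_alt3]] by simp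
    then have "curl \<phi> Y x k = 0" unfolding Y_def by (rule curl_radial)
    then show ?thesis
      unfolding divergence_torsion[OF sm(3,7,5) d(2,4,3)] unfolding Y_def interior_torsion
      using ode[of "norm x"] by (cases "x = 0") simp_all
  qed
  moreover have "smooth (\<lambda>x. Y x $ k)" for k
    unfolding Y_def by (rule smooth_linear) (simp add: linear_iff algebra_simps)
  moreover have "G2_structure \<phi>"
    unfolding G2_structure_def
  proof (intro conjI allI)
    show "smooth (\<lambda>x. \<phi> x i j k)" for i j k
      unfolding \<phi>x by (rule radial_form_smooth[OF sm(1-6)])
    show "\<exists>A. adapted_coframe (\<phi> x) A" for x using coframe[of x] by blast
  qed
  moreover have "induces_metric \<phi> euclidean_metric"
    unfolding induces_metric_def euclidean_metric_def
  proof
    fix x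
    obtain A where A: "adapted_coframe (\<phi> x) A" "\<forall>i j. (\<Sum>m\<in>UNIV. A $ m $ i * A $ m $ j) = of_bool (i = j)"
      using coframe[of x] by blast
    show "\<exists>A. adapted_coframe (\<phi> x) A \<and> (\<forall>i j. of_bool (i = j) = (\<Sum>m\<in>UNIV. A $ m $ i * A $ m $ j))"
      using A by (intro exI[of _ A]) simp
  qed
  moreover have "induces_standard_orientation \<phi>"
    unfolding induces_standard_orientation_def using coframe by blast
  moreover have "lie_derivative Y euclidean_metric x i j = 2 * c * euclidean_metric x i j" for x i j
    unfolding Y_def by (rule lie_derivative_radial)
  ultimately show ?thesis
    unfolding euclidean_soliton_def Y \<phi>_def[symmetric] by blast
qed

theorem theorem3p17:
  fixes c b :: real
  assumes "b \<noteq> 0"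
  shows "(\<exists>!p. case p of (f, a) \<Rightarrow> global_solution c f a \<and> a 0 = 0 \<and> deriv a 0 = b) \<and>
    (\<forall>f a. global_solution c f a \<and> a 0 = 0 \<and> deriv a 0 = b \<longrightarrow>
       euclidean_soliton
         (isometric_form (\<lambda>x. f (norm x)) (radial_field a)) (radial_field (\<lambda>r. c * r)) c)"
proof (intro conjI allI impI)
  obtain f a where fa: "global_solution c f a" "a 0 = 0" "deriv a 0 = b"
    using global_solution_exists[of c b] by blast
  show "\<exists>!p. case p of (f, a) \<Rightarrow> global_solution c f a \<and> a 0 = 0 \<and> deriv a 0 = b"
  proof (rule ex1I[of _ "(f, a)"])
    show "case (f, a) of (f, a) \<Rightarrow> global_solution c f a \<and> a 0 = 0 \<and> deriv a 0 = b"
      using fa by simp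
    fix p assume "case p of (g, d) \<Rightarrow> global_solution c g d \<and> d 0 = 0 \<and> deriv d 0 = b"
    then obtain g d where p: "p = (g, d)" "global_solution c g d" "deriv d 0 = b" by (cases p) simp
    then show "p = (f, a)" using global_solution_unique[OF fa(1) p(2)] fa(3) by simp
  qed
next
  fix f a assume "global_solution c f a \<and> a 0 = 0 \<and> deriv a 0 = b"
  then obtain u where u: "smooth u" "odd_fun u" "u 0 = 0" "angle_equation c u"
    "a = (\<lambda>r. sin (u r / 2))" "f = (\<lambda>r. cos (u r / 2))"
    using global_solutionE by metis
  show "euclidean_soliton (isometric_form (\<lambda>x. f (norm x)) (radial_field a)) (radial_field (\<lambda>r. c * r)) c"
    unfolding u(5,6) by (rule radial_soliton[OF u(1-4)])
qed

end
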